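(* Let $0<\beta<\alpha<1$. Then the Riesz fractional derivative of order $\beta$, $D^\beta: Lip_\alpha(\gamma)\to Lip_{\alpha-\beta}(\gamma)$, is bounded; that is, $D^\beta f\in Lip_{\alpha-\beta}(\gamma)$ for every $f\in Lip_\alpha(\gamma)$ and there is a constant $C$, independent of $f$, such that $\|D^\beta f\|_{Lip_{\alpha-\beta}(\gamma)}\le C\|f\|_{Lip_\alpha(\gamma)}$ for all $f\in Lip_\alpha(\gamma)$.
   Context: Fix $d\ge 1$ and let $d\gamma(x)=\pi^{-d/2}e^{-|x|^2}dx$ be the Gaussian measure on $\mathbb{R}^d$; $\|\cdot\|_\infty$ is the norm of $L^\infty=L^\infty(\gamma)$. The Ornstein-Uhlenbeck semigroup is $T_0f=f$ and, for $t>0$, $$T_tf(x)=\frac{1}{\pi^{d/2}(1-e^{-2t})^{d/2}}\int_{\mathbb{R}^d}\exp\left(-\frac{|y-e^{-t}x|^2}{1-e^{-2t}}\right)f(y)\,dy ,$$ with generator $L=\frac12\Delta-\langle x,\nabla\rangle$. The Poisson-Hermite semigroup (generator $-(-L)^{1/2}$) is $$P_tf(x)=\frac{1}{\sqrt{\pi}}\int_0^\infty\frac{e^{-u}}{\sqrt{u}}\,T_{t^2/4u}f(x)\,du,\quad t>0,\qquad P_0f=f.$$ Gaussian Lipschitz spaces: for $\alpha>0$ let $n$ be the smallest integer greater than $\alpha$. $Lip_\alpha(\gamma)$ is the set of $f\in L^\infty$ for which there is a constant $A$ such that $\left\|\frac{\partial^nP_tf}{\partial t^n}\right\|_\infty\le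 A\,t^{-n+\alpha}$ for all $t>0$. The smallest such $A$ is denoted $A_\alpha(f)$, and $\|f\|_{Lip_\alpha(\gamma)}=\|f\|_\infty+A_\alpha(f)$. The Riesz fractional derivative of order $\beta$, formally $D^\beta=(-L)^{\beta/2}$, is given, for $0<\beta<\alpha<1$ and $f\in Lip_\alpha(\gamma)$, by $$D^\beta f=\frac{1}{c_\beta}\int_0^\infty s^{-\beta-1}(P_sf-f)\,ds,\qquad c_\beta=\int_0^\infty u^{-\beta-1}(e^{-u}-1)\,du .$$ *)

theory Defs
  imports "HOL-Probability.Probability"
begin

text \<open>
  The space $\mathbb{R}^d$ is an arbitrary Euclidean space \<open>'a\<close> with \<open>d = DIM('a) \<ge> 1\<close>.
  Elements of $L^\infty(\gamma)$ are represented by Borel functions; everything is stated for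
  arbitrary representatives, and inequalities between functions hold almost everywhere.
\<close>

definition gauss :: "'a::euclidean_space measure" where
  "gauss = density lborel
     (\<lambda>x. ennreal (pi powr (- real DIM('a) / 2) * exp (- (norm x)\<^sup>2)))"

text \<open>Since \<^const>\<open>esssup\<close> is \<open>\<infinity>\<close> on non-measurable functions, a bound on
  \<open>Linf_norm f\<close> includes the measurability of \<open>\<bar>f\<bar>\<close>.\<close>

definition Linf_norm :: "('a::euclidean_space \<Rightarrow> real) \<Rightarrow> ereal" where
  "Linf_norm f = esssup gauss (\<lambda>x. ereal \<bar>f x\<bar>)"

definition Linf :: "('a::euclidean_space \<Rightarrow> real) set" where
  "Linf = {f. f \<in> borel_measurable gauss \<and> Linf_norm f < \<infinity>}"

text \<open>The two semigroups are meaningful for \<open>t \<ge> 0\<close> only.\<close>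

definition ornstein_uhlenbeck ::
    "real \<Rightarrow> ('a::euclidean_space \<Rightarrow> real) \<Rightarrow> 'a \<Rightarrow> real" where
  "ornstein_uhlenbeck t f x =
     (if t = 0 then f x
      else 1 / (pi powr (real DIM('a) / 2) * (1 - exp (- 2 * t)) powr (real DIM('a) / 2)) *
        (LINT y|lborel. exp (- (norm (y - exp (- t) *\<^sub>R x))\<^sup>2 / (1 - exp (- 2 * t))) * f y))"

definition poisson_hermite ::
    "real \<Rightarrow> ('a::euclidean_space \<Rightarrow> real) \<Rightarrow> 'a \<Rightarrow> real" where
  "poisson_hermite t f x =
     (if t = 0 then f x
      else 1 / sqrt pi *
        (LINT u:{0<..}|lborel. exp (- u) / sqrt u * ornstein_uhlenbeck (t\<^sup>2 / (4 * u)) f x))"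

text \<open>The derivative is taken pointwise in \<open>x\<close>; for \<open>f\<close> in \<open>Linf\<close> the function
  \<open>t \<mapsto> poisson_hermite t f x\<close> is smooth on \<open>t > 0\<close> for every \<open>x\<close>.\<close>

definition poisson_hermite_deriv ::
    "nat \<Rightarrow> real \<Rightarrow> ('a::euclidean_space \<Rightarrow> real) \<Rightarrow> 'a \<Rightarrow> real" where
  "poisson_hermite_deriv n t f x = (deriv ^^ n) (\<lambda>s. poisson_hermite s f x) t"

definition lip_order :: "real \<Rightarrow> nat" where
  "lip_order \<alpha> = (LEAST n. \<alpha> < real n)"

definition is_lip_const :: "real \<Rightarrow> ('a::euclidean_space \<Rightarrow> real) \<Rightarrow> real \<Rightarrow> bool" where
  "is_lip_const \<alpha> f A \<longleftrightarrow>
     (\<forall>t>0. Linf_norm (poisson_hermite_deriv (lip_order \<alpha>) t f)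
              \<le> ereal (A * t powr (- real (lip_order \<alpha>) + \<alpha>)))"

definition gauss_Lip :: "real \<Rightarrow> ('a::euclidean_space \<Rightarrow> real) set" where
  "gauss_Lip \<alpha> = {f \<in> Linf. \<exists>A. is_lip_const \<alpha> f A}"

definition lip_const :: "real \<Rightarrow> ('a::euclidean_space \<Rightarrow> real) \<Rightarrow> real" where
  "lip_const \<alpha> f = (LEAST A. is_lip_const \<alpha> f A)"

definition lip_norm :: "real \<Rightarrow> ('a::euclidean_space \<Rightarrow> real) \<Rightarrow> real" where
  "lip_norm \<alpha> f = real_of_ereal (Linf_norm f) + lip_const \<alpha> f"

definition riesz_const :: "real \<Rightarrow> real" where
  "riesz_const \<beta> = (LINT u:{0<..}|lborel. u powr (- \<beta> - 1) * (exp (- u) - 1))"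

definition riesz_integrand ::
    "real \<Rightarrow> ('a::euclidean_space \<Rightarrow> real) \<Rightarrow> 'a \<Rightarrow> real \<Rightarrow> real" where
  "riesz_integrand \<beta> f x s = s powr (- \<beta> - 1) * (poisson_hermite s f x - f x)"

definition riesz_deriv ::
    "real \<Rightarrow> ('a::euclidean_space \<Rightarrow> real) \<Rightarrow> 'a \<Rightarrow> real" where
  "riesz_deriv \<beta> f x =
     1 / riesz_const \<beta> * (LINT s:{0<..}|lborel. riesz_integrand \<beta> f x s)"

end

theory Submission
  imports Defs
begin

text \<open>
  Write \<open>P\<^sub>t\<close> for the Poisson-Hermite semigroup, \<open>Q\<^sub>t\<close> for its time derivative and \<open>\<bar>_\<bar>\<close> for the
  essential supremum. For orders in \<open>(0, 1)\<close> the Lipschitz condition reads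
  \<open>\<bar>Q\<^sub>t f\<bar> \<le> A t powr (\<alpha> - 1)\<close>. The theorem rests on two facts about bounded \<open>f\<close>: the semigroup law
  \<open>P\<^sub>t P\<^sub>s = P\<^bsub>t+s\<^esub>\<close>, and the smoothing estimate \<open>\<bar>Q\<^sub>t f\<bar> \<le> 2 \<bar>f\<bar> / t\<close>.

  The semigroup law is obtained from its two ingredients. Mehler's formula writes the
  Ornstein-Uhlenbeck semigroup as an average over Gaussian displacements, so that its semigroup law
  says that independent Gaussians add up to a Gaussian (\<open>gauss_linear_combination\<close>). The
  subordination formula averages it over a random time with the one-half stable law of scale \<open>t\<close>,
  and these laws form a convolution semigroup (\<open>levy_convolution\<close>): after two linear substitutions
  this is an integral of Glasser type (\<open>glasser_integral\<close>). Moving the parameter \<open>t\<close> into the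
  density of the random time makes it possible to differentiate under the integral, which gives
  the smoothing estimate (\<open>levy_average_has_derivative\<close>).

  Let \<open>f\<close> satisfy the Lipschitz condition. From \<open>Q\<^bsub>t+s\<^esub> f = P\<^sub>t (Q\<^sub>s f)\<close> the condition improves from
  almost every point to every point, and the smoothing estimate applied to \<open>Q\<^sub>t f\<close> bounds
  \<open>\<bar>Q\<^bsub>t+s\<^esub> f - Q\<^sub>t f\<bar>\<close> by a multiple of \<open>A t powr (\<alpha> - 2) s\<close> as well as of \<open>A t powr (\<alpha> - 1)\<close>
  (\<open>poisson_hermite_deriv_increment\<close>). Integrating the condition in time gives
  \<open>\<bar>P\<^sub>s f - f\<bar> \<le> (A / \<alpha>) s powr \<alpha>\<close> almost everywhere, once the pointwise limit of \<open>P\<^sub>s f\<close> at time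
  \<open>0\<close> is identified with \<open>f\<close> through convergence in \<open>L\<^sup>1\<close> (\<open>poisson_hermite_holder_at_0\<close>). Hence the
  integral defining the Riesz derivative converges absolutely: near \<open>0\<close> because \<open>\<beta> < \<alpha>\<close>, and at
  infinity because \<open>P\<^sub>s f - f\<close> is bounded and \<open>\<beta> > 0\<close>.

  Finally Fubini and the semigroup law express \<open>P\<^sub>t\<close> of the Riesz derivative as a weighted integral
  of \<open>P\<^bsub>t+s\<^esub> f - P\<^sub>t f\<close> over \<open>s\<close>. Its increments in \<open>t\<close> are controlled by the two bounds on
  \<open>Q\<^bsub>t+s\<^esub> f - Q\<^sub>t f\<close>, the first used for \<open>s \<le> t\<close> and the second for \<open>s \<ge> t\<close>; both parts of the integral
  are of order \<open>A t powr (\<alpha> - \<beta> - 1)\<close>, which is the Lipschitz condition of order \<open>\<alpha> - \<beta>\<close>.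
\<close>

section \<open>The Gaussian measure\<close>

lemma nn_integral_gaussian_euclidean:
  "(\<integral>\<^sup>+x. ennreal (exp (- (norm (x::'a::euclidean_space))\<^sup>2)) \<partial>lborel)
     = ennreal (pi powr (real DIM('a) / 2))"
proof -
  have eq: "ennreal (exp (- (norm x)\<^sup>2)) = (\<Prod>b\<in>Basis. ennreal (exp (- (x \<bullet> b)\<^sup>2)))" for x :: 'a
  proof -
    have "(norm x)\<^sup>2 = (\<Sum>b\<in>Basis. (x \<bullet> b)\<^sup>2)"
      by (simp add: norm_eq_sqrt_inner euclidean_inner[of x x] power2_eq_square sum_nonneg)
    then have "exp (- (norm x)\<^sup>2) = (\<Prod>b\<in>Basis. exp (- (x \<bullet> b)\<^sup>2))"
      by (simp add: exp_sum flip: sum_negf)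
    then show ?thesis by (simp add: prod_ennreal)
  qed
  have hb: "has_bochner_integral lborel (\<lambda>x::real. exp (- x\<^sup>2)) (sqrt pi)"
    using has_bochner_integral_even_function[OF gaussian_moment_0] by simp
  have one: "(\<integral>\<^sup>+x. ennreal (exp (- x\<^sup>2)) \<partial>lborel) = ennreal (sqrt pi)"
    using hb by (subst nn_integral_eq_integral) (auto simp: has_bochner_integral_iff)
  have "(\<integral>\<^sup>+x. ennreal (exp (- (norm (x::'a))\<^sup>2)) \<partial>lborel)
      = (\<Prod>b\<in>(Basis::'a set). \<integral>\<^sup>+x. ennreal (exp (- x\<^sup>2)) \<partial>lborel)"
    unfolding eq by (rule nn_integral_lborel_prod) auto
  also have "\<dots> = ennreal (sqrt pi ^ DIM('a))"
    by (simp add: one ennreal_power)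
  also have "sqrt pi ^ DIM('a) = pi powr (real DIM('a) / 2)"
    by (simp add: powr_half_sqrt[symmetric] powr_powr flip: powr_realpow)
  finally show ?thesis .
qed

lemma sets_gauss[simp, measurable_cong]: "sets gauss = sets borel"
  by (simp add: gauss_def)

lemma space_gauss[simp]: "space gauss = UNIV"
  by (simp add: gauss_def)

lemma prob_space_gauss: "prob_space (gauss :: 'a::euclidean_space measure)"
proof (rule prob_spaceI)
  have "emeasure (gauss :: 'a measure) UNIV
     = (\<integral>\<^sup>+x. ennreal (pi powr (- real DIM('a) / 2)) * ennreal (exp (- (norm (x::'a))\<^sup>2)) \<partial>lborel)"
    unfolding gauss_def by (subst emeasure_density) (auto simp: ennreal_mult)
  also have "\<dots> = ennreal (pi powr (- real DIM('a) / 2)) * ennreal (pi powr (real DIM('a) / 2))"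
    by (subst nn_integral_cmult) (auto simp: nn_integral_gaussian_euclidean)
  also have "\<dots> = 1"
    by (simp add: ennreal_mult[symmetric] powr_add[symmetric])
  finally show "emeasure (gauss :: 'a measure) (space gauss) = 1" by simp
qed

interpretation gauss: prob_space gauss by (rule prob_space_gauss)
interpretation gauss_pair: pair_prob_space gauss gauss ..

lemma AE_gauss_iff: "(AE x in gauss. P x) \<longleftrightarrow> (AE x in lborel. P x)"
  unfolding gauss_def by (subst AE_density) (auto simp: )

lemma nn_integral_gauss:
  fixes f :: "'a::euclidean_space \<Rightarrow> ennreal"
  assumes [measurable]: "f \<in> borel_measurable borel"
  shows "(\<integral>\<^sup>+x. f x \<partial>gauss) = ennreal (pi powr (- real DIM('a) / 2)) *
     (\<integral>\<^sup>+x. ennreal (exp (- (norm x)\<^sup>2)) * f x \<partial>lborel)"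
  unfolding gauss_def
  by (subst nn_integral_density) (auto simp: ennreal_mult mult.assoc nn_integral_cmult)

lemma nn_integral_lborel_affine:
  fixes f :: "'a::euclidean_space \<Rightarrow> ennreal"
  assumes [measurable]: "f \<in> borel_measurable borel" and c: "c \<noteq> 0"
  shows "(\<integral>\<^sup>+x. f x \<partial>lborel) = ennreal (\<bar>c\<bar> ^ DIM('a)) * (\<integral>\<^sup>+x. f (t + c *\<^sub>R x) \<partial>lborel)"
  by (subst lborel_affine[OF c, of t])
     (simp add: nn_integral_density nn_integral_distr nn_integral_cmult)

text \<open>Two independent Gaussians add up to a Gaussian. Substituting \<open>y = c z + d w\<close> for
  \<open>w\<close> leaves an inner integral over \<open>z\<close> that is computed by completing the square,
  $|z|^2 + |y - cz|^2/d^2 = |y|^2/e^2 + (e/d)^2|z - (c/e^2)y|^2$.\<close>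

lemma gauss_linear_combination:
  fixes c d e :: real and G :: "'a::euclidean_space \<Rightarrow> ennreal"
  assumes [measurable]: "G \<in> borel_measurable borel"
    and d: "d > 0" and e: "e > 0" and cde: "c\<^sup>2 + d\<^sup>2 = e\<^sup>2"
  shows "(\<integral>\<^sup>+z. \<integral>\<^sup>+w. G (c *\<^sub>R z + d *\<^sub>R w) \<partial>gauss \<partial>gauss) = (\<integral>\<^sup>+z. G (e *\<^sub>R z) \<partial>gauss)"
proof -
  let ?K = "ennreal (pi powr (- real DIM('a) / 2))"
  let ?D = "DIM('a)"
  have square: "exp (- (norm z)\<^sup>2) * exp (- (norm ((1/d) *\<^sub>R (y - c *\<^sub>R z)))\<^sup>2)
     = exp (- (norm ((1/e) *\<^sub>R y))\<^sup>2) * exp (- (norm ((e/d) *\<^sub>R (z - (c/e\<^sup>2) *\<^sub>R y)))\<^sup>2)"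
    for y z :: 'a
  proof -
    have c2: "c\<^sup>2 = e\<^sup>2 - d\<^sup>2" using cde by simp
    have "(norm z)\<^sup>2 + (norm ((1/d) *\<^sub>R (y - c *\<^sub>R z)))\<^sup>2
      = (norm ((1/e) *\<^sub>R y))\<^sup>2 + (norm ((e/d) *\<^sub>R (z - (c/e\<^sup>2) *\<^sub>R y)))\<^sup>2"
    proof -
      have "(norm z)\<^sup>2 + (norm ((1/d) *\<^sub>R (y - c *\<^sub>R z)))\<^sup>2
        = z \<bullet> z + (y \<bullet> y - 2 * c * (z \<bullet> y) + c\<^sup>2 * (z \<bullet> z)) / d\<^sup>2"
        unfolding dot_square_norm[symmetric]
        by (simp add: inner_diff_left inner_diff_right inner_commute power2_eq_square algebra_simps add_divide_distrib diff_divide_distrib)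
      also have "\<dots> = (y \<bullet> y) / e\<^sup>2 + (e\<^sup>2 / d\<^sup>2) * (z \<bullet> z - 2 * (c/e\<^sup>2) * (z \<bullet> y) + (c\<^sup>2/e\<^sup>2/e\<^sup>2) * (y \<bullet> y))"
        unfolding c2 using d e by (simp add: field_simps power2_eq_square)
      also have "\<dots> = (norm ((1/e) *\<^sub>R y))\<^sup>2 + (norm ((e/d) *\<^sub>R (z - (c/e\<^sup>2) *\<^sub>R y)))\<^sup>2"
        unfolding dot_square_norm[symmetric] using d e
        by (simp add: inner_diff_left inner_diff_right inner_commute power2_eq_square field_simps)
      finally show ?thesis .
    qed
    then show ?thesis by (simp add: exp_add[symmetric])
  qed
  have sub_w: "(\<integral>\<^sup>+w. ennreal (exp (- (norm w)\<^sup>2)) * G (c *\<^sub>R z + d *\<^sub>R w) \<partial>lborel)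
     = ennreal ((1/d) ^ ?D) * (\<integral>\<^sup>+y. ennreal (exp (- (norm ((1/d) *\<^sub>R (y - c *\<^sub>R z)))\<^sup>2)) * G y \<partial>lborel)"
    for z :: 'a
    using d
    by (subst nn_integral_lborel_affine[where c="1/d" and t="- (c/d) *\<^sub>R z"])
       (auto simp: scaleR_diff_right algebra_simps)
  have sub_z: "(\<integral>\<^sup>+z. ennreal (exp (- (norm z)\<^sup>2)) * ennreal (exp (- (norm ((1/d) *\<^sub>R (y - c *\<^sub>R z)))\<^sup>2)) \<partial>lborel)
     = ennreal (exp (- (norm ((1/e) *\<^sub>R y))\<^sup>2)) * (ennreal ((d/e)^?D) * ennreal (pi powr (real ?D / 2)))"
    for y :: 'a
  proof -
    have "(\<integral>\<^sup>+z. ennreal (exp (- (norm ((e/d) *\<^sub>R (z - (c/e\<^sup>2) *\<^sub>R y)))\<^sup>2)) \<partial>lborel)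
      = ennreal ((d/e)^?D) * ennreal (pi powr (real ?D / 2))"
      using d e by (subst nn_integral_lborel_affine[where c="d/e" and t="(c/e\<^sup>2) *\<^sub>R y"])
        (auto simp: nn_integral_gaussian_euclidean[where 'a='a])
    then show ?thesis
      unfolding ennreal_mult[OF exp_ge_zero exp_ge_zero, symmetric] square
      by (simp add: ennreal_mult nn_integral_cmult)
  qed
  have "(\<integral>\<^sup>+z. \<integral>\<^sup>+w. G (c *\<^sub>R z + d *\<^sub>R w) \<partial>gauss \<partial>gauss)
     = ?K * (\<integral>\<^sup>+z. ennreal (exp (- (norm z)\<^sup>2)) * (?K *
         (\<integral>\<^sup>+w. ennreal (exp (- (norm w)\<^sup>2)) * G (c *\<^sub>R z + d *\<^sub>R w) \<partial>lborel)) \<partial>lborel)"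
    by (simp add: nn_integral_gauss)
  also have "\<dots>
     = ?K * ?K * ennreal ((1/d) ^ ?D) * (\<integral>\<^sup>+z. \<integral>\<^sup>+y. ennreal (exp (- (norm z)\<^sup>2)) *
        (ennreal (exp (- (norm ((1/d) *\<^sub>R (y - c *\<^sub>R z)))\<^sup>2)) * G y) \<partial>lborel \<partial>lborel)"
    unfolding sub_w by (simp add: nn_integral_cmult[symmetric] mult_ac)
  also have "(\<integral>\<^sup>+z. \<integral>\<^sup>+y. ennreal (exp (- (norm z)\<^sup>2)) *
        (ennreal (exp (- (norm ((1/d) *\<^sub>R (y - c *\<^sub>R z)))\<^sup>2)) * G y) \<partial>lborel \<partial>lborel)
    = (\<integral>\<^sup>+y. \<integral>\<^sup>+z. ennreal (exp (- (norm z)\<^sup>2)) *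
        (ennreal (exp (- (norm ((1/d) *\<^sub>R (y - c *\<^sub>R z)))\<^sup>2)) * G y) \<partial>lborel \<partial>lborel)"
    by (rule lborel_pair.Fubini') measurable
  also have "\<dots> = (\<integral>\<^sup>+y. G y * (ennreal (exp (- (norm ((1/e) *\<^sub>R y))\<^sup>2)) * (ennreal ((d/e)^?D) * ennreal (pi powr (real ?D / 2)))) \<partial>lborel)"
  proof (rule nn_integral_cong)
    fix y :: 'a
    have "(\<integral>\<^sup>+z. ennreal (exp (- (norm z)\<^sup>2)) *
        (ennreal (exp (- (norm ((1/d) *\<^sub>R (y - c *\<^sub>R z)))\<^sup>2)) * G y) \<partial>lborel)
      = (\<integral>\<^sup>+z. G y * (ennreal (exp (- (norm z)\<^sup>2)) *
        ennreal (exp (- (norm ((1/d) *\<^sub>R (y - c *\<^sub>R z)))\<^sup>2))) \<partial>lborel)"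
      by (simp only: mult_ac)
    also have "\<dots> = G y * (\<integral>\<^sup>+z. ennreal (exp (- (norm z)\<^sup>2)) *
        ennreal (exp (- (norm ((1/d) *\<^sub>R (y - c *\<^sub>R z)))\<^sup>2)) \<partial>lborel)"
      by (rule nn_integral_cmult) measurable
    finally show "(\<integral>\<^sup>+z. ennreal (exp (- (norm z)\<^sup>2)) *
        (ennreal (exp (- (norm ((1/d) *\<^sub>R (y - c *\<^sub>R z)))\<^sup>2)) * G y) \<partial>lborel)
      = G y * (ennreal (exp (- (norm ((1/e) *\<^sub>R y))\<^sup>2)) * (ennreal ((d/e)^?D) * ennreal (pi powr (real ?D / 2))))"
      unfolding sub_z .
  qed
  also have "\<dots> = ennreal ((d/e)^?D) * ennreal (pi powr (real ?D / 2)) * (\<integral>\<^sup>+y. ennreal (exp (- (norm ((1/e) *\<^sub>R y))\<^sup>2)) * G y \<partial>lborel)"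
    by (subst nn_integral_cmult[symmetric]) (auto simp: mult_ac)
  also have "(\<integral>\<^sup>+y. ennreal (exp (- (norm ((1/e) *\<^sub>R y))\<^sup>2)) * G y \<partial>lborel)
     = ennreal (e ^ ?D) * (\<integral>\<^sup>+y. ennreal (exp (- (norm y)\<^sup>2)) * G (e *\<^sub>R y) \<partial>lborel)"
    using e by (subst nn_integral_lborel_affine[where c=e and t=0]) auto
  finally have *: "(\<integral>\<^sup>+z. \<integral>\<^sup>+w. G (c *\<^sub>R z + d *\<^sub>R w) \<partial>gauss \<partial>gauss)
    = ?K * ?K * ennreal ((1/d) ^ ?D) * (ennreal ((d/e)^?D) * ennreal (pi powr (real ?D / 2)) * (ennreal (e ^ ?D) *
        (\<integral>\<^sup>+y. ennreal (exp (- (norm y)\<^sup>2)) * G (e *\<^sub>R y) \<partial>lborel)))" .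
  have "pi powr (- real ?D / 2) * (1/d) ^ ?D * (d/e)^?D * pi powr (real ?D / 2) * e ^ ?D = 1"
    using d e by (simp add: powr_minus power_divide field_simps)
  then have "ennreal (pi powr (- real ?D / 2)) * ennreal ((1/d) ^ ?D) * ennreal ((d/e)^?D) * ennreal (pi powr (real ?D / 2)) * ennreal (e ^ ?D) = 1"
    using d e by (simp add: ennreal_mult[symmetric])
  moreover have "(k * k * p) * (q * r * (u * X)) = (k * p * q * r * u) * (k * X)" for k p q r u X :: ennreal
    by (simp only: mult_ac)
  ultimately have "?K * ?K * ennreal ((1/d) ^ ?D) * (ennreal ((d/e)^?D) * ennreal (pi powr (real ?D / 2)) * (ennreal (e ^ ?D) * X)) = ?K * X" for X
    by (simp only: mult_1_left)
  then show ?thesis unfolding * by (subst nn_integral_gauss) simp_all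
qed

section \<open>Mehler's formula and the Ornstein-Uhlenbeck semigroup\<close>

text \<open>The Ornstein-Uhlenbeck process started at \<open>x\<close>, at time \<open>t \<ge> 0\<close>, has the law of
  \<open>ou_path t x z\<close> for a Gaussian \<open>z\<close>. The square root is meaningful for \<open>t \<ge> 0\<close> only.\<close>

definition ou_path :: "real \<Rightarrow> 'a::euclidean_space \<Rightarrow> 'a \<Rightarrow> 'a" where
  "ou_path t x z = exp (- t) *\<^sub>R x + sqrt (1 - exp (- 2 * t)) *\<^sub>R z"

lemma measurable_ou_path[measurable]:
  assumes [measurable]: "f \<in> M \<rightarrow>\<^sub>M borel" "g \<in> M \<rightarrow>\<^sub>M borel" "h \<in> M \<rightarrow>\<^sub>M borel"
  shows "(\<lambda>w. ou_path (f w) (g w) (h w)) \<in> M \<rightarrow>\<^sub>M borel"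
  unfolding ou_path_def by measurable

lemma integral_lborel_affine:
  fixes f :: "'a::euclidean_space \<Rightarrow> real"
  assumes [measurable]: "f \<in> borel_measurable borel" and c: "c \<noteq> 0"
  shows "(\<integral>x. f x \<partial>lborel) = \<bar>c\<bar> ^ DIM('a) * (\<integral>x. f (t + c *\<^sub>R x) \<partial>lborel)"
  by (subst lborel_affine[OF c, of t])
     (simp add: integral_density integral_distr)

lemma integral_gauss:
  fixes f :: "'a::euclidean_space \<Rightarrow> real"
  assumes [measurable]: "f \<in> borel_measurable borel"
  shows "(\<integral>x. f x \<partial>gauss) = pi powr (- real DIM('a) / 2) * (\<integral>x. exp (- (norm x)\<^sup>2) * f x \<partial>lborel)"
  unfolding gauss_def
  by (subst integral_density) (auto simp: mult.assoc)

text \<open>Mehler's formula as an expectation, from the substitution of the kernel's argument by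
  \<open>ou_path t x z\<close>. Positivity, contractivity and continuity in \<open>t\<close> become visible in this form.\<close>

lemma ornstein_uhlenbeck_eq:
  fixes f :: "'a::euclidean_space \<Rightarrow> real"
  assumes [measurable]: "f \<in> borel_measurable borel" and t: "t \<ge> 0"
  shows "ornstein_uhlenbeck t f x = (\<integral>z. f (ou_path t x z) \<partial>gauss)"
proof (cases "t = 0")
  case True
  then show ?thesis by (simp add: ornstein_uhlenbeck_def ou_path_def gauss.prob_space[simplified])
next
  case False
  define s where "s = 1 - exp (- 2 * t)"
  have s: "s > 0" using t False by (simp add: s_def)
  have "(LINT y|lborel. exp (- (norm (y - exp (- t) *\<^sub>R x))\<^sup>2 / s) * f y)
     = sqrt s ^ DIM('a) * (\<integral>z. exp (- (norm z)\<^sup>2) * f (ou_path t x z) \<partial>lborel)"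
    using s by (subst integral_lborel_affine[where c="sqrt s" and t="exp (- t) *\<^sub>R x"])
       (auto simp: ou_path_def s_def power_mult_distrib)
  moreover have "sqrt s ^ DIM('a) = s powr (real DIM('a) / 2)"
    using s by (simp add: powr_half_sqrt[symmetric] powr_powr flip: powr_realpow)
  ultimately show ?thesis
    using False s
    unfolding ornstein_uhlenbeck_def s_def[symmetric]
    by (subst integral_gauss) (auto simp: powr_minus divide_simps)
qed

lemma measurable_ornstein_uhlenbeck[measurable]:
  fixes f :: "'a::euclidean_space \<Rightarrow> real"
  assumes [measurable]: "f \<in> borel_measurable borel" "r \<in> borel_measurable M" "g \<in> M \<rightarrow>\<^sub>M borel"
  shows "(\<lambda>w. ornstein_uhlenbeck (r w) f (g w)) \<in> borel_measurable M"
  unfolding ornstein_uhlenbeck_def by measurable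

lemma ornstein_uhlenbeck_cong_AE:
  fixes f g :: "'a::euclidean_space \<Rightarrow> real"
  assumes [measurable]: "f \<in> borel_measurable borel" "g \<in> borel_measurable borel"
    and eq: "AE x in lborel. f x = g x" and t: "t \<noteq> 0"
  shows "ornstein_uhlenbeck t f x = ornstein_uhlenbeck t g x"
proof -
  have "(LINT y|lborel. exp (- (norm (y - exp (- t) *\<^sub>R x))\<^sup>2 / (1 - exp (- 2 * t))) * f y)
    = (LINT y|lborel. exp (- (norm (y - exp (- t) *\<^sub>R x))\<^sup>2 / (1 - exp (- 2 * t))) * g y)"
    by (rule integral_cong_AE) (use eq in auto)
  then show ?thesis using t by (simp add: ornstein_uhlenbeck_def)
qed

lemma ornstein_uhlenbeck_bound:
  fixes f :: "'a::euclidean_space \<Rightarrow> real"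
  assumes [measurable]: "f \<in> borel_measurable borel" and t: "t \<ge> 0" and M: "\<And>x. \<bar>f x\<bar> \<le> M"
  shows "\<bar>ornstein_uhlenbeck t f x\<bar> \<le> M"
proof -
  have "\<bar>\<integral>z. f (ou_path t x z) \<partial>gauss\<bar> \<le> (\<integral>z. M \<partial>(gauss :: 'a measure))"
    by (rule integral_abs_bound_integral)
       (auto intro!: gauss.integrable_const_bound[where B=M] simp: M)
  then show ?thesis by (simp add: ornstein_uhlenbeck_eq t gauss.prob_space[simplified])
qed

text \<open>The Markov property of the Ornstein-Uhlenbeck process: the Gaussian displacements of the
  two time steps combine because their variances add up to that of a single step.\<close>

lemma nn_integral_ou_path_ou_path:
  fixes G :: "'a::euclidean_space \<Rightarrow> ennreal"
  assumes [measurable]: "G \<in> borel_measurable borel" and r: "r > 0" and s: "s > 0"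
  shows "(\<integral>\<^sup>+z. \<integral>\<^sup>+w. G (ou_path s (ou_path r x z) w) \<partial>gauss \<partial>gauss) = (\<integral>\<^sup>+z. G (ou_path (r + s) x z) \<partial>gauss)"
proof -
  have 1: "1 - exp (- 2 * (r + s)) > 0" "1 - exp (- 2 * s) > 0" "1 - exp (- 2 * r) > 0" using r s by auto
  have sq: "(exp (- s) * sqrt (1 - exp (- 2 * r)))\<^sup>2 + (sqrt (1 - exp (- 2 * s)))\<^sup>2 = (sqrt (1 - exp (- 2 * (r + s))))\<^sup>2"
    using 1 by (simp add: power_mult_distrib algebra_simps exp_double[symmetric] exp_add[symmetric])
  have eq: "ou_path s (ou_path r x z) w = exp (- (r + s)) *\<^sub>R x +
     ((exp (- s) * sqrt (1 - exp (- 2 * r))) *\<^sub>R z + sqrt (1 - exp (- 2 * s)) *\<^sub>R w)" for z w :: 'a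
    by (simp add: ou_path_def algebra_simps exp_add[symmetric])
  show ?thesis
    unfolding eq using 1
    by (subst gauss_linear_combination[OF _ _ _ sq, of "\<lambda>y. G (exp (- (r + s)) *\<^sub>R x + y)"])
       (auto simp: ou_path_def)
qed

text \<open>Both sides are integrals of \<open>f\<close> against probability measures, which agree by
  \<open>nn_integral_ou_path_ou_path\<close> applied to indicator functions.\<close>

lemma ornstein_uhlenbeck_semigroup:
  fixes f :: "'a::euclidean_space \<Rightarrow> real"
  assumes [measurable]: "f \<in> borel_measurable borel" and M: "\<And>x. \<bar>f x\<bar> \<le> M" and r: "r > 0" and s: "s > 0"
  shows "ornstein_uhlenbeck r (ornstein_uhlenbeck s f) x = ornstein_uhlenbeck (r + s) f x"
proof -
  have D: "distr (gauss \<Otimes>\<^sub>M gauss) borel (\<lambda>(z, w). ou_path s (ou_path r x z) w)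
      = distr gauss borel (ou_path (r + s) x)" (is "?L = ?R")
  proof (rule measure_eqI)
    fix A assume "A \<in> sets ?L"
    then have [measurable]: "A \<in> sets borel" by simp
    have "emeasure ?L A = (\<integral>\<^sup>+y. indicator A y \<partial>?L)" by simp
    also have "\<dots> = (\<integral>\<^sup>+z. \<integral>\<^sup>+w. indicator A (ou_path s (ou_path r x z) w) \<partial>gauss \<partial>gauss)"
      by (subst nn_integral_distr) (auto simp: gauss.nn_integral_fst[symmetric])
    also have "\<dots> = (\<integral>\<^sup>+z. indicator A (ou_path (r + s) x z) \<partial>gauss)"
      by (rule nn_integral_ou_path_ou_path) (auto simp: r s)
    also have "\<dots> = (\<integral>\<^sup>+y. indicator A y \<partial>?R)"
      by (subst nn_integral_distr) auto
    finally show "emeasure ?L A = emeasure ?R A" by simp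
  qed simp
  have "ornstein_uhlenbeck r (ornstein_uhlenbeck s f) x = (\<integral>z. \<integral>w. f (ou_path s (ou_path r x z) w) \<partial>gauss \<partial>gauss)"
    using r s by (simp add: ornstein_uhlenbeck_eq)
  also have "\<dots> = (\<integral>p. f ((\<lambda>(z, w). ou_path s (ou_path r x z) w) p) \<partial>(gauss \<Otimes>\<^sub>M gauss))"
    by (subst gauss_pair.integral_fst'[symmetric])
       (auto intro!: gauss_pair.integrable_const_bound[where B=M] simp: M split: prod.split)
  also have "\<dots> = (\<integral>y. f y \<partial>?L)"
    by (subst integral_distr) auto
  also have "\<dots> = ornstein_uhlenbeck (r + s) f x"
    unfolding D using r s by (subst integral_distr) (auto simp: ornstein_uhlenbeck_eq)
  finally show ?thesis .
qed

text \<open>The Gaussian measure is the stationary law of the process. This is the source of the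
  contractivity of the Poisson-Hermite semigroup in \<open>L\<^sup>1\<close>.\<close>

lemma nn_integral_ou_path_invariant:
  fixes G :: "'a::euclidean_space \<Rightarrow> ennreal"
  assumes [measurable]: "G \<in> borel_measurable borel" and t: "t > 0"
  shows "(\<integral>\<^sup>+x. \<integral>\<^sup>+z. G (ou_path t x z) \<partial>gauss \<partial>gauss) = (\<integral>\<^sup>+x. G x \<partial>gauss)"
  unfolding ou_path_def using t
  by (subst gauss_linear_combination[where e=1]) (auto simp: exp_double[symmetric])

section \<open>The one-half stable subordinator\<close>

text \<open>The function \<open>g n = t * sqrt n - s / sqrt n\<close> maps the half-line increasingly onto the
  line, so the integral with the weight \<open>g'\<close> is Gaussian. The inversion \<open>n \<mapsto> s\<^sup>2 / (t\<^sup>2 n)\<close>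
  turns \<open>g\<close> into \<open>- g\<close> and exchanges the two summands of \<open>g'\<close>, which therefore contribute
  equally. This determines the integrals with the weights \<open>1 / sqrt n\<close> and \<open>1 / (n * sqrt n)\<close>.\<close>

lemma glasser_integral:
  fixes s t y :: real
  assumes s: "s > 0" and t: "t > 0" and y: "y > 0"
  shows "(\<integral>\<^sup>+n. ennreal (indicator {0<..} n * ((1 + 1 / n) / sqrt n * exp (- y * (t * sqrt n - s / sqrt n)\<^sup>2))) \<partial>lborel)
    = ennreal (sqrt (pi / y) * (1 / s + 1 / t))"
proof -
  let ?S = "{0<..} :: real set"
  define \<phi> where "\<phi> n = exp (- y * (t * sqrt n - s / sqrt n)\<^sup>2)" for n
  define g where "g n = t * sqrt n - s / sqrt n" for n
  have S: "?S \<in> sets lebesgue" by simp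
  have phi_pos: "\<phi> n > 0" for n by (simp add: \<phi>_def)
  have gauss_line: "(\<lambda>x. exp (- y * x\<^sup>2)) absolutely_integrable_on UNIV"
     "integral UNIV (\<lambda>x. exp (- y * x\<^sup>2)) = sqrt (pi / y)"
  proof -
    have hb: "has_bochner_integral lborel (\<lambda>x::real. exp (- x\<^sup>2)) (sqrt pi)"
      using has_bochner_integral_even_function[OF gaussian_moment_0] by simp
    have "has_bochner_integral lborel (\<lambda>x::real. exp (- (0 + sqrt y * x)\<^sup>2)) (sqrt pi /\<^sub>R \<bar>sqrt y\<bar>)"
      using lborel_has_bochner_integral_real_affine_iff[of "sqrt y" "\<lambda>x. exp (- x\<^sup>2)" "sqrt pi" 0] hb y by simp
    then have hb2: "has_bochner_integral lborel (\<lambda>x::real. exp (- y * x\<^sup>2)) (sqrt (pi / y))"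
      using y by (simp add: power_mult_distrib real_sqrt_mult real_sqrt_inverse divide_inverse mult.commute)
    then have "integrable lborel (\<lambda>x::real. exp (- y * x\<^sup>2))" "(\<integral>x. exp (- y * x\<^sup>2) \<partial>lborel) = sqrt (pi / y)"
      by (auto simp: has_bochner_integral_iff)
    then show "(\<lambda>x. exp (- y * x\<^sup>2)) absolutely_integrable_on UNIV"
     "integral UNIV (\<lambda>x. exp (- y * x\<^sup>2)) = sqrt (pi / y)"
      by (auto simp: set_integrable_def integrable_completion integral_lborel)
  qed
  have der: "(g has_field_derivative (t / sqrt n + s / (n * sqrt n)) / 2) (at n within ?S)" if "n \<in> ?S" for n
    unfolding g_def using that
    by (auto intro!: derivative_eq_intros simp: field_simps)
  have mono: "g a < g b" if "0 < a" "a < b" for a b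
    unfolding g_def using that s t by (intro diff_strict_mono) (auto intro!: divide_strict_left_mono)
  have inj: "inj_on g ?S"
    by (rule inj_onI) (metis greaterThan_iff linorder_neqE_linordered_idom mono order_less_irrefl)
  have img: "g ` ?S = UNIV"
  proof -
    have "x \<in> g ` ?S" for x
    proof -
      \<comment> \<open>The square root of the preimage solves \<open>t * q\<^sup>2 - x * q - s = 0\<close>.\<close>
      define q where "q = (x + sqrt (x\<^sup>2 + 4 * s * t)) / (2 * t)"
      have "\<bar>x\<bar> < sqrt (x\<^sup>2 + 4 * s * t)" using s t by (intro real_less_rsqrt) auto
      then have q: "q > 0" using t by (simp add: q_def)
      have r: "(sqrt (x\<^sup>2 + 4 * s * t))\<^sup>2 = x\<^sup>2 + 4 * s * t" using s t by simp
      have "t * q\<^sup>2 - s = x * q"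
        unfolding q_def using r t by (simp add: field_simps power2_eq_square)
      then have "x = g (q\<^sup>2)" using q by (simp add: g_def field_simps power2_eq_square)
      then show ?thesis using q by (intro image_eqI[where x="q\<^sup>2"]) auto
    qed
    then show ?thesis by auto
  qed
  have A: "(\<lambda>n. \<bar>(t / sqrt n + s / (n * sqrt n)) / 2\<bar> * \<phi> n) absolutely_integrable_on ?S \<and>
     integral ?S (\<lambda>n. \<bar>(t / sqrt n + s / (n * sqrt n)) / 2\<bar> * \<phi> n) = sqrt (pi / y)"
    using has_absolute_integral_change_of_variables_1'[OF S der inj, of "\<lambda>x. exp (- y * x\<^sup>2)" "sqrt (pi / y)"]
      gauss_line unfolding img g_def \<phi>_def by simp
  let ?f = "\<lambda>n. \<phi> n / sqrt n" and ?h = "\<lambda>n. \<phi> n / (n * sqrt n)"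
  have A1: "(\<lambda>n. (t * ?f n + s * ?h n) / 2) absolutely_integrable_on ?S"
    by (rule iffD2[OF set_integrable_cong[OF refl refl] A[THEN conjunct1]])
       (use s t in \<open>auto simp: field_simps\<close>)
  have A2: "integral ?S (\<lambda>n. (t * ?f n + s * ?h n) / 2) = sqrt (pi / y)"
    by (subst A[THEN conjunct2, symmetric], rule Henstock_Kurzweil_Integration.integral_cong)
       (use s t in \<open>auto simp: field_simps\<close>)
  have meas_f: "set_borel_measurable lebesgue ?S ?f" and meas_h: "set_borel_measurable lebesgue ?S ?h"
    unfolding set_borel_measurable_def \<phi>_def by (auto intro!: measurable_completion)
  have B1: "?f absolutely_integrable_on ?S"
    by (rule set_integrable_bound[OF set_integrable_mult_right[of "2/t", OF A1]])
       (use s t phi_pos in \<open>auto simp: field_simps less_imp_le intro!: AE_I2 meas_f\<close>)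
  have B2: "?h absolutely_integrable_on ?S"
    by (rule set_integrable_bound[OF set_integrable_mult_right[of "2/s", OF A1]])
       (use s t phi_pos in \<open>auto simp: field_simps less_imp_le intro!: AE_I2 meas_h\<close>)
  \<comment> \<open>The inversion \<open>n \<mapsto> c / n\<close>, which fixes the zero of \<open>g\<close>.\<close>
  define c where "c = s\<^sup>2 / t\<^sup>2"
  have c: "c > 0" "sqrt c = s / t" using s t by (auto simp: c_def real_sqrt_divide)
  have der2: "((\<lambda>n. c / n) has_field_derivative (- c / n\<^sup>2)) (at n within ?S)" if "n \<in> ?S" for n
    using that by (auto intro!: derivative_eq_intros simp: power2_eq_square)
  have inj2: "inj_on (\<lambda>n. c / n) ?S" using c by (auto intro!: inj_onI)
  have img2: "(\<lambda>n. c / n) ` ?S = ?S"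
    using c by (auto intro!: image_eqI[where x="c / _"])
  have C: "(\<lambda>n. \<bar>- c / n\<^sup>2\<bar> * ?f (c / n)) absolutely_integrable_on ?S \<and>
     integral ?S (\<lambda>n. \<bar>- c / n\<^sup>2\<bar> * ?f (c / n)) = integral ?S ?f"
    using has_absolute_integral_change_of_variables_1'[OF S der2 inj2, of ?f "integral ?S ?f"] B1 unfolding img2 by simp
  have inv: "\<bar>- c / n\<^sup>2\<bar> * ?f (c / n) = (s / t) * ?h n" if n: "n > 0" for n
  proof -
    have "t * sqrt (c / n) - s / sqrt (c / n) = - (t * sqrt n - s / sqrt n)"
      using n s t c by (simp add: real_sqrt_divide field_simps)
    then have "\<phi> (c / n) = \<phi> n" unfolding \<phi>_def by (simp only: power2_minus)
    moreover have "c / n\<^sup>2 / sqrt (c / n) = (s / t) / (n * sqrt n)"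
    proof -
      have "c / n\<^sup>2 / sqrt (c / n) = (c / sqrt c) * (sqrt n / n / n)"
        using n by (simp add: real_sqrt_divide power2_eq_square)
      also have "c / sqrt c = s / t" using c by (metis less_imp_le real_div_sqrt)
      also have "sqrt n / n = 1 / sqrt n" using n by (metis less_imp_le real_div_sqrt divide_divide_eq_left' div_by_1 div_self inverse_eq_divide inverse_divide)
      finally show ?thesis by (simp add: mult.commute)
    qed
    moreover have "\<bar>- c / n\<^sup>2\<bar> * ?f (c / n) = (c / n\<^sup>2 / sqrt (c / n)) * \<phi> (c / n)"
      using n c by simp
    ultimately show ?thesis by simp
  qed
  have P: "integral ?S ?f = (s / t) * integral ?S ?h"
  proof -
    have "integral ?S ?f = integral ?S (\<lambda>n. (s / t) * ?h n)"
      unfolding C[THEN conjunct2, symmetric]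
      by (rule Henstock_Kurzweil_Integration.integral_cong) (use inv in auto)
    then show ?thesis by (simp only: Henstock_Kurzweil_Integration.integral_mult_right)
  qed
  have hf: "(?f has_integral integral ?S ?f) ?S" and hh: "(?h has_integral integral ?S ?h) ?S"
    using B1 B2 by (auto dest: set_lebesgue_integral_eq_integral(1) intro: integrable_integral)
  have "((\<lambda>n. (t * ?f n + s * ?h n) / 2) has_integral (t * integral ?S ?f + s * integral ?S ?h) / 2) ?S"
    by (intro has_integral_divide has_integral_add has_integral_mult_right hf hh)
  from integral_unique[OF this] have Q: "t * integral ?S ?f + s * integral ?S ?h = 2 * sqrt (pi / y)"
    unfolding A2 by simp
  have h_val: "integral ?S ?h = sqrt (pi / y) / s" and f_val: "integral ?S ?f = sqrt (pi / y) / t"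
    using Q P s t by (auto simp: field_simps)
  have "((\<lambda>n. ?f n + ?h n) has_integral sqrt (pi / y) * (1 / s + 1 / t)) ?S"
    using has_integral_add[OF hf hh] unfolding h_val f_val by (simp add: algebra_simps)
  then have "((\<lambda>n. (1 + 1 / n) / sqrt n * \<phi> n) has_integral sqrt (pi / y) * (1 / s + 1 / t)) ?S"
    by (rule has_integral_eq[rotated]) (auto simp: field_simps)
  from nn_integral_has_integral_lebesgue[OF _ this] show ?thesis
    by (simp add: \<phi>_def)
qed

text \<open>The Gamma distribution of shape \<open>1 / 2\<close>. For \<open>u\<close> with this law, \<open>t\<^sup>2 / (4 * u)\<close> is the hitting
  time of level \<open>t\<close> of a Brownian motion (of variance \<open>2\<close> per unit time), a one-half stable time.\<close>

definition half_gamma :: "real measure" where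
  "half_gamma = density lborel (\<lambda>u. ennreal (indicator {0<..} u * (exp (- u) / sqrt (pi * u))))"

text \<open>The density of \<open>w = 1 / (4 * r)\<close> when \<open>r = t\<^sup>2 / (4 * u)\<close> and \<open>u\<close> follows \<open>half_gamma\<close>. In
  the variable \<open>w\<close> the substitutions below are all linear.\<close>

definition levy_kernel :: "real \<Rightarrow> real \<Rightarrow> real" where
  "levy_kernel t w = indicator {0<..} w * (t * exp (- t\<^sup>2 * w) / sqrt (pi * w))"

lemma levy_kernel_nonneg: "t \<ge> 0 \<Longrightarrow> levy_kernel t w \<ge> 0"
  by (auto simp: levy_kernel_def indicator_def)

lemma measurable_levy_kernel[measurable]: "levy_kernel t \<in> borel_measurable borel"
  unfolding levy_kernel_def by measurable

lemma sets_half_gamma[simp, measurable_cong]: "sets half_gamma = sets borel"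
  by (simp add: half_gamma_def)

lemma space_half_gamma[simp]: "space half_gamma = UNIV"
  by (simp add: half_gamma_def)

lemma nn_integral_half_gamma:
  assumes [measurable]: "f \<in> borel_measurable borel"
  shows "(\<integral>\<^sup>+u. f u \<partial>half_gamma) = (\<integral>\<^sup>+u. ennreal (indicator {0<..} u * (exp (- u) / sqrt (pi * u))) * f u \<partial>lborel)"
  unfolding half_gamma_def by (subst nn_integral_density) auto

lemma integral_half_gamma:
  fixes f :: "real \<Rightarrow> real"
  assumes [measurable]: "f \<in> borel_measurable borel"
  shows "(\<integral>u. f u \<partial>half_gamma) = (\<integral>u. indicator {0<..} u * (exp (- u) / sqrt (pi * u)) * f u \<partial>lborel)"
  unfolding half_gamma_def by (subst integral_density) (auto simp: indicator_def)

lemma AE_half_gamma: "AE u in half_gamma. u > 0"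
  unfolding half_gamma_def by (subst AE_density) (auto simp: indicator_def)

lemma half_gamma_density_eq:
  "indicator {0<..} u * (exp (- u) / sqrt (pi * u)) = 1 / sqrt pi * (indicator {0..} u * u powr (1 / 2 - 1) / exp u)"
proof (cases "u > 0")
  case True
  have "u powr (1 / 2 - 1) = 1 / sqrt u"
    using True powr_minus_divide[of u "1 / 2"] powr_half_sqrt[of u] by simp
  then show ?thesis using True by (simp add: real_sqrt_mult exp_minus inverse_eq_divide)
next
  case False
  then show ?thesis by (cases "u = 0") auto
qed

lemma prob_space_half_gamma: "prob_space half_gamma"
proof (rule prob_spaceI)
  have "(\<integral>\<^sup>+u. 1 \<partial>half_gamma)
     = (\<integral>\<^sup>+u. ennreal (1 / sqrt pi) * ennreal (indicator {0..} u * u powr (1 / 2 - 1) / exp u) \<partial>lborel)"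
    by (subst nn_integral_half_gamma) (simp, simp only: half_gamma_density_eq mult_1_right, simp add: ennreal_mult[symmetric])
  also have "\<dots> = ennreal (1 / sqrt pi) * ennreal (Gamma (1 / 2))"
    by (subst nn_integral_cmult) (auto simp: Gamma_conv_nn_integral_real)
  also have "\<dots> = 1" by (simp add: Gamma_one_half_real ennreal_mult[symmetric])
  finally show "emeasure half_gamma (space half_gamma) = 1" by simp
qed

interpretation half_gamma: prob_space half_gamma by (rule prob_space_half_gamma)

lemma half_gamma_mean: "integrable half_gamma (\<lambda>u. u)" "(\<integral>u. u \<partial>half_gamma) = 1 / 2"
proof -
  have G: "Gamma (3 / 2 :: real) = sqrt pi / 2"
  proof -
    have "(1 / 2 :: real) \<notin> \<int>\<^sub>\<le>\<^sub>0" using nonpos_Ints_nonpos[of "1 / 2 :: real"] by auto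
    then show ?thesis using Gamma_plus1[of "1 / 2 :: real"] by (simp add: Gamma_one_half_real)
  qed
  have nn: "(\<integral>\<^sup>+u. ennreal u \<partial>half_gamma)
     = (\<integral>\<^sup>+u. ennreal (1 / sqrt pi) * ennreal (indicator {0..} u * u powr (3 / 2 - 1) / exp u) \<partial>lborel)"
  proof (subst nn_integral_half_gamma, simp, rule nn_integral_cong)
    fix u :: real
    have "u * u powr (1 / 2 - 1) = u powr (3 / 2 - 1)" if "u > 0"
      using that by (simp add: powr_mult_base)
    then have "indicator {0<..} u * (exp (- u) / sqrt (pi * u)) * u = 1 / sqrt pi * (indicator {0..} u * u powr (3 / 2 - 1) / exp u)"
      unfolding half_gamma_density_eq by (cases "u > 0"; cases "u = 0") (auto simp: mult.commute)
    moreover have "ennreal (indicator {0<..} u * (exp (- u) / sqrt (pi * u))) * ennreal u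
      = ennreal (indicator {0<..} u * (exp (- u) / sqrt (pi * u)) * u)"
      by (cases "u > 0") (auto simp: ennreal_mult[symmetric])
    ultimately show "ennreal (indicator {0<..} u * (exp (- u) / sqrt (pi * u))) * ennreal u
      = ennreal (1 / sqrt pi) * ennreal (indicator {0..} u * u powr (3 / 2 - 1) / exp u)"
      by (simp add: ennreal_mult[symmetric])
  qed
  also have "\<dots> = ennreal (1 / sqrt pi) * ennreal (Gamma (3 / 2))"
    by (subst nn_integral_cmult) (auto simp: Gamma_conv_nn_integral_real)
  also have "\<dots> = ennreal (1 / 2)" by (simp add: G ennreal_mult[symmetric])
  finally have nn: "(\<integral>\<^sup>+u. ennreal u \<partial>half_gamma) = ennreal (1 / 2)" .
  have pos: "AE u in half_gamma. 0 \<le> u" using AE_half_gamma by eventually_elim simp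
  have "has_bochner_integral half_gamma (\<lambda>u. u) (1 / 2)"
    by (rule has_bochner_integral_nn_integral[OF _ pos _ nn]) auto
  then show "integrable half_gamma (\<lambda>u. u)" "(\<integral>u. u \<partial>half_gamma) = 1 / 2"
    by (auto simp: has_bochner_integral_iff)
qed

lemma poisson_hermite_eq:
  fixes f :: "'a::euclidean_space \<Rightarrow> real"
  assumes [measurable]: "f \<in> borel_measurable borel" and t: "t \<noteq> 0"
  shows "poisson_hermite t f x = (\<integral>u. ornstein_uhlenbeck (t\<^sup>2 / (4 * u)) f x \<partial>half_gamma)"
proof -
  have "poisson_hermite t f x = (\<integral>u. 1 / sqrt pi * (indicator {0<..} u *\<^sub>R (exp (- u) / sqrt u * ornstein_uhlenbeck (t\<^sup>2 / (4 * u)) f x)) \<partial>lborel)"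
    using t unfolding poisson_hermite_def set_lebesgue_integral_def by (simp only: integral_mult_right_zero if_False)
  also have "\<dots> = (\<integral>u. indicator {0<..} u * (exp (- u) / sqrt (pi * u)) * ornstein_uhlenbeck (t\<^sup>2 / (4 * u)) f x \<partial>lborel)"
    by (rule Bochner_Integration.integral_cong) (auto simp: real_sqrt_mult)
  also have "\<dots> = (\<integral>u. ornstein_uhlenbeck (t\<^sup>2 / (4 * u)) f x \<partial>half_gamma)"
    by (rule integral_half_gamma[symmetric]) measurable
  finally show ?thesis .
qed

text \<open>The substitution \<open>u = t\<^sup>2 * w\<close> moves the dependence on \<open>t\<close> from the argument of an
  arbitrary function into a smooth density.\<close>

lemma levy_kernel_scale:
  assumes t: "t > 0"
  shows "t\<^sup>2 * (indicator {0<..} (t\<^sup>2 * w) * (exp (- (t\<^sup>2 * w)) / sqrt (pi * (t\<^sup>2 * w)))) = levy_kernel t w"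
proof (cases "w > 0")
  case True
  then show ?thesis using t by (simp add: levy_kernel_def real_sqrt_mult field_simps power2_eq_square)
next
  case False
  then show ?thesis using t by (simp add: levy_kernel_def zero_less_mult_iff)
qed

lemma integral_levy_kernel:
  fixes F :: "real \<Rightarrow> real"
  assumes [measurable]: "F \<in> borel_measurable borel" and t: "t > 0"
  shows "(\<integral>u. F (t\<^sup>2 / (4 * u)) \<partial>half_gamma) = (\<integral>w. levy_kernel t w * F (1 / (4 * w)) \<partial>lborel)"
proof -
  have "(\<integral>u. F (t\<^sup>2 / (4 * u)) \<partial>half_gamma) = t\<^sup>2 * (\<integral>w. indicator {0<..} (t\<^sup>2 * w) *
      (exp (- (t\<^sup>2 * w)) / sqrt (pi * (t\<^sup>2 * w))) * F (t\<^sup>2 / (4 * (t\<^sup>2 * w))) \<partial>lborel)"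
    using t by (subst integral_half_gamma, simp, subst lborel_integral_real_affine[where c="t\<^sup>2" and t=0]) auto
  also have "\<dots> = (\<integral>w. levy_kernel t w * F (1 / (4 * w)) \<partial>lborel)"
    unfolding levy_kernel_scale[OF t, symmetric] integral_mult_right_zero[symmetric] using t
    by (intro Bochner_Integration.integral_cong) (simp_all add: mult.assoc)
  finally show ?thesis .
qed

lemma nn_integral_levy_kernel:
  fixes F :: "real \<Rightarrow> ennreal"
  assumes [measurable]: "F \<in> borel_measurable borel" and t: "t > 0"
  shows "(\<integral>\<^sup>+u. F (t\<^sup>2 / (4 * u)) \<partial>half_gamma) = (\<integral>\<^sup>+w. ennreal (levy_kernel t w) * F (1 / (4 * w)) \<partial>lborel)"
proof -
  have "(\<integral>\<^sup>+u. F (t\<^sup>2 / (4 * u)) \<partial>half_gamma) = ennreal (t\<^sup>2) * (\<integral>\<^sup>+w. ennreal (indicator {0<..} (t\<^sup>2 * w) *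
      (exp (- (t\<^sup>2 * w)) / sqrt (pi * (t\<^sup>2 * w)))) * F (t\<^sup>2 / (4 * (t\<^sup>2 * w))) \<partial>lborel)"
    using t by (subst nn_integral_half_gamma, simp, subst nn_integral_real_affine[where c="t\<^sup>2" and t=0]) auto
  also have "\<dots> = (\<integral>\<^sup>+w. ennreal (t\<^sup>2) * ennreal (indicator {0<..} (t\<^sup>2 * w) *
      (exp (- (t\<^sup>2 * w)) / sqrt (pi * (t\<^sup>2 * w)))) * F (t\<^sup>2 / (4 * (t\<^sup>2 * w))) \<partial>lborel)"
    by (subst nn_integral_cmult[symmetric]) (auto simp: mult.assoc)
  also have "\<dots> = (\<integral>\<^sup>+w. ennreal (levy_kernel t w) * F (1 / (4 * w)) \<partial>lborel)"
    unfolding levy_kernel_scale[OF t, symmetric] using t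
    by (intro nn_integral_cong) (simp add: ennreal_mult'[symmetric])
  finally show ?thesis .
qed

text \<open>The exponents combine through
  $(1 + 1/n)(s^2 + t^2 n) = (s + t)^2 + (t\sqrt{n} - s/\sqrt{n})^2$.\<close>

lemma levy_kernel_product:
  assumes s: "s > 0" and t: "t > 0" and n: "n > 0" and y: "y > 0"
  shows "(1 + 1 / n) * (levy_kernel s ((1 + 1 / n) * y) * (((1 + 1 / n) * y) * levy_kernel t (((1 + 1 / n) * y) * n)))
    = s * t / pi * exp (- y * (s + t)\<^sup>2) * ((1 + 1 / n) / sqrt n * exp (- y * (t * sqrt n - s / sqrt n)\<^sup>2))"
proof -
  define a where "a = 1 + 1 / n"
  have a: "a > 0" using n by (simp add: a_def add_pos_pos)
  have e1: "a * (s\<^sup>2 + t\<^sup>2 * n) = (s + t)\<^sup>2 + (t * sqrt n - s / sqrt n)\<^sup>2"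
  proof -
    have "(t * sqrt n - s / sqrt n)\<^sup>2 = t\<^sup>2 * n - 2 * s * t + s\<^sup>2 / n"
      using n by (simp add: power2_diff power_mult_distrib power_divide)
    then show ?thesis using n unfolding a_def by (simp add: field_simps power2_eq_square)
  qed
  have "exp (- s\<^sup>2 * (a * y)) * exp (- t\<^sup>2 * (a * y * n)) = exp (- y * (a * (s\<^sup>2 + t\<^sup>2 * n)))"
    by (simp add: exp_add[symmetric] algebra_simps)
  also have "\<dots> = exp (- y * (s + t)\<^sup>2) * exp (- y * (t * sqrt n - s / sqrt n)\<^sup>2)"
    unfolding e1 by (simp add: exp_add[symmetric] algebra_simps)
  finally have e: "exp (- s\<^sup>2 * (a * y)) * exp (- t\<^sup>2 * (a * y * n)) = \<dots>" .
  have r: "sqrt (pi * (a * y)) * sqrt (pi * (a * y * n)) = pi * (a * y) * sqrt n"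
    using a y n by (simp add: real_sqrt_mult[symmetric]) (simp add: real_sqrt_mult mult_ac flip: power2_eq_square)
  have "a * (levy_kernel s (a * y) * ((a * y) * levy_kernel t ((a * y) * n)))
    = a * (a * y) * s * t * (exp (- s\<^sup>2 * (a * y)) * exp (- t\<^sup>2 * (a * y * n))) / (sqrt (pi * (a * y)) * sqrt (pi * (a * y * n)))"
    using a y n by (simp add: levy_kernel_def)
  also have "\<dots> = s * t / pi * exp (- y * (s + t)\<^sup>2) * (a / sqrt n * exp (- y * (t * sqrt n - s / sqrt n)\<^sup>2))"
    unfolding e r using a y n by (simp add: field_simps)
  finally show ?thesis unfolding a_def .
qed

text \<open>The one-half stable laws form a convolution semigroup. Both times are expressed through
  their densities in \<open>v\<close> and \<open>w\<close>; then \<open>w = v * n\<close> makes the sum \<open>1 / v + 1 / w\<close> equal to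
  \<open>(1 + 1 / n) / v\<close>, and \<open>v = (1 + 1 / n) * y\<close> makes it equal to \<open>1 / y\<close>. The remaining integral
  over \<open>n\<close> is \<open>glasser_integral\<close>.\<close>

lemma levy_convolution:
  fixes G :: "real \<Rightarrow> ennreal"
  assumes [measurable]: "G \<in> borel_measurable borel" and s: "s > 0" and t: "t > 0"
  shows "(\<integral>\<^sup>+u. \<integral>\<^sup>+v. G (s\<^sup>2 / (4 * u) + t\<^sup>2 / (4 * v)) \<partial>half_gamma \<partial>half_gamma)
     = (\<integral>\<^sup>+u. G ((s + t)\<^sup>2 / (4 * u)) \<partial>half_gamma)"
proof -
  have K: "ennreal (levy_kernel r w) = indicator {0<..} w * ennreal (levy_kernel r w)" for r w
    by (simp add: levy_kernel_def indicator_def)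
  have inner: "ennreal (levy_kernel s v) * (\<integral>\<^sup>+w. ennreal (levy_kernel t w) * G (1 / (4 * v) + 1 / (4 * w)) \<partial>lborel)
    = (\<integral>\<^sup>+n. indicator {0<..} n * (ennreal (levy_kernel s v) * ennreal (v * levy_kernel t (v * n)) * G ((1 + 1 / n) / (4 * v))) \<partial>lborel)"
    for v
  proof (cases "v > 0")
    case True
    have "(\<integral>\<^sup>+w. ennreal (levy_kernel t w) * G (1 / (4 * v) + 1 / (4 * w)) \<partial>lborel)
      = ennreal v * (\<integral>\<^sup>+n. ennreal (levy_kernel t (v * n)) * G (1 / (4 * v) + 1 / (4 * (v * n))) \<partial>lborel)"
      using True by (subst nn_integral_real_affine[where c=v and t=0]) auto
    also have "\<dots> = (\<integral>\<^sup>+n. indicator {0<..} n * (ennreal (v * levy_kernel t (v * n)) * G ((1 + 1 / n) / (4 * v))) \<partial>lborel)"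
    proof (subst nn_integral_cmult[symmetric], measurable, rule nn_integral_cong)
      fix n :: real
      show "ennreal v * (ennreal (levy_kernel t (v * n)) * G (1 / (4 * v) + 1 / (4 * (v * n))))
        = indicator {0<..} n * (ennreal (v * levy_kernel t (v * n)) * G ((1 + 1 / n) / (4 * v)))"
      proof (cases "n > 0")
        case n: True
        have "(1 + 1 / n) / (4 * v) = 1 / (4 * v) + 1 / (4 * (v * n))"
          using True n by (simp add: field_simps)
        moreover have "ennreal (v * levy_kernel t (v * n)) = ennreal v * ennreal (levy_kernel t (v * n))"
          using True by (intro ennreal_mult') simp
        ultimately show ?thesis using n by (simp add: mult.assoc)
      next
        case False
        then show ?thesis using True by (simp add: levy_kernel_def zero_less_mult_iff)
      qed
    qed
    finally show ?thesis
      by (simp only:) (subst nn_integral_cmult[symmetric], measurable, simp only: mult_ac)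
  next
    case False
    then show ?thesis by (simp add: levy_kernel_def)
  qed
  have outer: "(\<integral>\<^sup>+v. indicator {0<..} n * (ennreal (levy_kernel s v) * ennreal (v * levy_kernel t (v * n)) * G ((1 + 1 / n) / (4 * v))) \<partial>lborel)
    = (\<integral>\<^sup>+y. indicator {0<..} y * G (1 / (4 * y)) * (ennreal (s * t / pi * exp (- y * (s + t)\<^sup>2)) *
       ennreal (indicator {0<..} n * ((1 + 1 / n) / sqrt n * exp (- y * (t * sqrt n - s / sqrt n)\<^sup>2)))) \<partial>lborel)" for n
  proof (cases "n > 0")
    case True
    define a where "a = 1 + 1 / n"
    have a: "a > 0" using True by (simp add: a_def add_pos_pos)
    have "(\<integral>\<^sup>+v. indicator {0<..} n * (ennreal (levy_kernel s v) * ennreal (v * levy_kernel t (v * n)) * G (a / (4 * v))) \<partial>lborel)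
      = ennreal a * (\<integral>\<^sup>+y. ennreal (levy_kernel s (a * y)) * ennreal (a * y * levy_kernel t (a * y * n)) * G (a / (4 * (a * y))) \<partial>lborel)"
      using True a by (subst nn_integral_real_affine[where c=a and t=0]) auto
    also have "\<dots> = (\<integral>\<^sup>+y. ennreal a * (ennreal (levy_kernel s (a * y)) * ennreal (a * y * levy_kernel t (a * y * n)) * G (a / (4 * (a * y)))) \<partial>lborel)"
      by (rule nn_integral_cmult[symmetric]) measurable
    also have "\<dots> = (\<integral>\<^sup>+y. indicator {0<..} y * G (1 / (4 * y)) * (ennreal (s * t / pi * exp (- y * (s + t)\<^sup>2)) *
       ennreal (indicator {0<..} n * ((1 + 1 / n) / sqrt n * exp (- y * (t * sqrt n - s / sqrt n)\<^sup>2)))) \<partial>lborel)"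
    proof (rule nn_integral_cong)
      fix y :: real
      show "ennreal a * (ennreal (levy_kernel s (a * y)) * ennreal (a * y * levy_kernel t (a * y * n)) * G (a / (4 * (a * y))))
        = indicator {0<..} y * G (1 / (4 * y)) * (ennreal (s * t / pi * exp (- y * (s + t)\<^sup>2)) *
       ennreal (indicator {0<..} n * ((1 + 1 / n) / sqrt n * exp (- y * (t * sqrt n - s / sqrt n)\<^sup>2))))"
      proof (cases "y > 0")
        case y: True
        have "ennreal a * (ennreal (levy_kernel s (a * y)) * ennreal (a * y * levy_kernel t (a * y * n)))
          = ennreal (a * (levy_kernel s (a * y) * (a * y * levy_kernel t (a * y * n))))"
          using a y s t by (simp add: ennreal_mult levy_kernel_nonneg)
        also have "\<dots> = ennreal (s * t / pi * exp (- y * (s + t)\<^sup>2)) *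
            ennreal (indicator {0<..} n * ((1 + 1 / n) / sqrt n * exp (- y * (t * sqrt n - s / sqrt n)\<^sup>2)))"
          using levy_kernel_product[OF s t True y, folded a_def] s t y True a
          by (simp add: ennreal_mult[symmetric] a_def[symmetric])
        finally have E: "ennreal a * (ennreal (levy_kernel s (a * y)) * ennreal (a * y * levy_kernel t (a * y * n))) = \<dots>" .
        have "a / (4 * (a * y)) = 1 / (4 * y)" using a by simp
        moreover have "k * (p * q * g) = (k * (p * q)) * g" for k p q g :: ennreal by (simp only: mult_ac)
        ultimately show ?thesis using y by (simp only: E) (simp add: mult.commute)
      next
        case False
        then show ?thesis using a by (simp add: levy_kernel_def zero_less_mult_iff)
      qed
    qed
    finally show ?thesis unfolding a_def .
  qed simp
  have kernel_sum: "ennreal (s * t / pi * exp (- y * (s + t)\<^sup>2)) * ennreal (sqrt (pi / y) * (1 / s + 1 / t)) = ennreal (levy_kernel (s + t) y)"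
    if "y > 0" for y
  proof -
    have "s * t / pi * exp (- y * (s + t)\<^sup>2) * (sqrt (pi / y) * (1 / s + 1 / t)) = (s + t) * exp (- y * (s + t)\<^sup>2) * (sqrt pi / pi / sqrt y)"
    proof -
      have st: "s * t * (1 / s + 1 / t) = s + t" using s t by (simp add: field_simps)
      have "s * t / pi * exp (- y * (s + t)\<^sup>2) * (sqrt (pi / y) * (1 / s + 1 / t))
        = (s * t * (1 / s + 1 / t)) * exp (- y * (s + t)\<^sup>2) * (sqrt pi / pi / sqrt y)"
        by (simp add: real_sqrt_divide)
      then show ?thesis unfolding st .
    qed
    also have "sqrt pi / pi / sqrt y = 1 / sqrt (pi * y)"
      using that by (simp add: real_sqrt_mult field_simps)
    finally show ?thesis using s t that by (simp add: ennreal_mult[symmetric] levy_kernel_def mult.commute)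
  qed
  have "(\<integral>\<^sup>+u. \<integral>\<^sup>+v. G (s\<^sup>2 / (4 * u) + t\<^sup>2 / (4 * v)) \<partial>half_gamma \<partial>half_gamma)
    = (\<integral>\<^sup>+u. \<integral>\<^sup>+w. ennreal (levy_kernel t w) * G (s\<^sup>2 / (4 * u) + 1 / (4 * w)) \<partial>lborel \<partial>half_gamma)"
    by (intro nn_integral_cong nn_integral_levy_kernel[where F="\<lambda>r. G (_ + r)"] t) measurable
  also have "\<dots> = (\<integral>\<^sup>+v. ennreal (levy_kernel s v) * (\<integral>\<^sup>+w. ennreal (levy_kernel t w) * G (1 / (4 * v) + 1 / (4 * w)) \<partial>lborel) \<partial>lborel)"
    by (rule nn_integral_levy_kernel[where F="\<lambda>r. \<integral>\<^sup>+w. ennreal (levy_kernel t w) * G (r + 1 / (4 * w)) \<partial>lborel"])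
       (use s in measurable)
  also have "\<dots> = (\<integral>\<^sup>+n. \<integral>\<^sup>+v. indicator {0<..} n * (ennreal (levy_kernel s v) * ennreal (v * levy_kernel t (v * n)) * G ((1 + 1 / n) / (4 * v))) \<partial>lborel \<partial>lborel)"
    unfolding inner by (rule lborel_pair.Fubini') measurable
  also have "\<dots> = (\<integral>\<^sup>+y. \<integral>\<^sup>+n. indicator {0<..} y * G (1 / (4 * y)) * (ennreal (s * t / pi * exp (- y * (s + t)\<^sup>2)) *
       ennreal (indicator {0<..} n * ((1 + 1 / n) / sqrt n * exp (- y * (t * sqrt n - s / sqrt n)\<^sup>2)))) \<partial>lborel \<partial>lborel)"
    unfolding outer by (rule lborel_pair.Fubini') measurable
  also have "\<dots> = (\<integral>\<^sup>+y. indicator {0<..} y * G (1 / (4 * y)) * (ennreal (s * t / pi * exp (- y * (s + t)\<^sup>2)) *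
       (\<integral>\<^sup>+n. ennreal (indicator {0<..} n * ((1 + 1 / n) / sqrt n * exp (- y * (t * sqrt n - s / sqrt n)\<^sup>2))) \<partial>lborel)) \<partial>lborel)"
    by (simp add: nn_integral_cmult)
  also have "\<dots> = (\<integral>\<^sup>+y. ennreal (levy_kernel (s + t) y) * G (1 / (4 * y)) \<partial>lborel)"
  proof (rule nn_integral_cong)
    fix y :: real
    show "indicator {0<..} y * G (1 / (4 * y)) * (ennreal (s * t / pi * exp (- y * (s + t)\<^sup>2)) *
       (\<integral>\<^sup>+n. ennreal (indicator {0<..} n * ((1 + 1 / n) / sqrt n * exp (- y * (t * sqrt n - s / sqrt n)\<^sup>2))) \<partial>lborel))
      = ennreal (levy_kernel (s + t) y) * G (1 / (4 * y))"
    proof (cases "y > 0")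
      case True
      then show ?thesis by (simp only: glasser_integral[OF s t True] kernel_sum[OF True]) (simp add: mult.commute)
    next
      case False
      then show ?thesis by (simp add: levy_kernel_def)
    qed
  qed
  also have "\<dots> = (\<integral>\<^sup>+u. G ((s + t)\<^sup>2 / (4 * u)) \<partial>half_gamma)"
    using s t by (subst nn_integral_levy_kernel) auto
  finally show ?thesis .
qed

text \<open>Differentiation under the integral sign with the difference quotients dominated by a local
  Lipschitz bound. This form asks for differentiability at the single point \<open>t\<close>.\<close>

lemma has_field_derivative_integral:
  fixes h :: "real \<Rightarrow> 'w \<Rightarrow> real"
  assumes t: "a < t" "t < b"
    and h: "\<And>s. a < s \<Longrightarrow> s < b \<Longrightarrow> integrable M (h s)"
    and [measurable]: "d \<in> borel_measurable M"
    and der: "AE w in M. ((\<lambda>s. h s w) has_field_derivative d w) (at t)"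
    and G: "integrable M G"
    and lip: "\<And>s. a < s \<Longrightarrow> s < b \<Longrightarrow> AE w in M. \<bar>h s w - h t w\<bar> \<le> \<bar>s - t\<bar> * G w"
  shows "((\<lambda>s. \<integral>w. h s w \<partial>M) has_field_derivative (\<integral>w. d w \<partial>M)) (at t)"
  unfolding has_field_derivative_iff tendsto_at_iff_sequentially
proof (intro allI impI)
  fix X :: "nat \<Rightarrow> real"
  assume X: "\<forall>i. X i \<in> UNIV - {t}" and lim: "X \<longlonglongrightarrow> t"
  have "eventually (\<lambda>n. a < X n \<and> X n < b) sequentially"
    using order_tendstoD[OF lim] t by (auto intro: eventually_conj)
  then obtain N where N: "\<And>n. n \<ge> N \<Longrightarrow> a < X n \<and> X n < b"
    by (auto simp: eventually_sequentially)
  define Y where "Y n = X (n + N)" for n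
  have Y: "a < Y n" "Y n < b" "Y n \<noteq> t" for n using N[of "n + N"] X by (auto simp: Y_def)
  have limY: "Y \<longlonglongrightarrow> t" unfolding Y_def using lim by (rule LIMSEQ_ignore_initial_segment)
  have meas: "(\<lambda>w. (h (Y n) w - h t w) / (Y n - t)) \<in> borel_measurable M" for n
    using borel_measurable_integrable[OF h[OF Y(1,2)[of n]]] borel_measurable_integrable[OF h[OF t]] by measurable
  have "(\<lambda>n. \<integral>w. (h (Y n) w - h t w) / (Y n - t) \<partial>M) \<longlonglongrightarrow> (\<integral>w. d w \<partial>M)"
  proof (rule integral_dominated_convergence[OF _ meas G])
    show "AE w in M. (\<lambda>n. (h (Y n) w - h t w) / (Y n - t)) \<longlonglongrightarrow> d w"
      using der
    proof eventually_elim
      case (elim w)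
      then show ?case
        unfolding has_field_derivative_iff tendsto_at_iff_sequentially
        using limY Y(3) by (auto simp: o_def)
    qed
    show "AE w in M. norm ((h (Y n) w - h t w) / (Y n - t)) \<le> G w" for n
      using lip[OF Y(1,2)[of n]]
    proof eventually_elim
      case (elim w)
      then show ?case using Y(3)[of n] by (simp add: divide_le_eq mult.commute)
    qed
  qed simp
  moreover have "(\<integral>w. (h (Y n) w - h t w) / (Y n - t) \<partial>M)
     = ((\<integral>w. h (Y n) w \<partial>M) - (\<integral>w. h t w \<partial>M)) / (Y n - t)" for n
    using h[OF Y(1,2)[of n]] h[OF t] by (simp only: integral_divide_zero Bochner_Integration.integral_diff)
  ultimately have "(\<lambda>n. ((\<integral>w. h (Y n) w \<partial>M) - (\<integral>w. h t w \<partial>M)) / (Y n - t)) \<longlonglongrightarrow> (\<integral>w. d w \<partial>M)"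
    by (simp only:)
  then show "((\<lambda>s. ((\<integral>w. h s w \<partial>M) - (\<integral>w. h t w \<partial>M)) / (s - t)) \<circ> X) \<longlonglongrightarrow> (\<integral>w. d w \<partial>M)"
    unfolding Y_def o_def by (rule LIMSEQ_offset)
qed

lemma integral_levy_kernel_1: "t > 0 \<Longrightarrow> integrable lborel (levy_kernel t)"
    "t > 0 \<Longrightarrow> (\<integral>w. levy_kernel t w \<partial>lborel) = 1"
proof -
  assume t: "t > 0"
  have "(\<integral>\<^sup>+w. ennreal (levy_kernel t w) \<partial>lborel) = ennreal 1"
    using nn_integral_levy_kernel[of "\<lambda>_. 1" t] t half_gamma.emeasure_space_1 by simp
  then have "has_bochner_integral lborel (levy_kernel t) 1"
    using t by (intro has_bochner_integral_nn_integral) (auto simp: levy_kernel_nonneg)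
  then show "integrable lborel (levy_kernel t)" "(\<integral>w. levy_kernel t w \<partial>lborel) = 1"
    by (auto simp: has_bochner_integral_iff)
qed

lemma integral_levy_kernel_mult:
    "t > 0 \<Longrightarrow> integrable lborel (\<lambda>w. levy_kernel t w * w)"
    "t > 0 \<Longrightarrow> (\<integral>w. levy_kernel t w * w \<partial>lborel) = 1 / (2 * t\<^sup>2)"
proof -
  assume t: "t > 0"
  have pos: "levy_kernel t w * w \<ge> 0" for w using t by (auto simp: levy_kernel_def indicator_def)
  have "(\<integral>\<^sup>+w. ennreal (levy_kernel t w * w) \<partial>lborel) = (\<integral>\<^sup>+w. ennreal (levy_kernel t w) * ennreal w \<partial>lborel)"
    using t by (intro nn_integral_cong ennreal_mult' levy_kernel_nonneg) simp
  also have "\<dots> = (\<integral>\<^sup>+u. ennreal (u / t\<^sup>2) \<partial>half_gamma)"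
    using nn_integral_levy_kernel[of "\<lambda>r. ennreal (1 / (4 * r))" t] t by simp
  also have "\<dots> = ennreal (\<integral>u. u / t\<^sup>2 \<partial>half_gamma)"
  proof (rule nn_integral_eq_integral)
    show "AE u in half_gamma. 0 \<le> u / t\<^sup>2" using AE_half_gamma by eventually_elim simp
  qed (simp add: half_gamma_mean)
  also have "\<dots> = ennreal (1 / (2 * t\<^sup>2))" by (simp add: half_gamma_mean)
  finally have "has_bochner_integral lborel (\<lambda>w. levy_kernel t w * w) (1 / (2 * t\<^sup>2))"
    using t pos by (intro has_bochner_integral_nn_integral) auto
  then show "integrable lborel (\<lambda>w. levy_kernel t w * w)" "(\<integral>w. levy_kernel t w * w \<partial>lborel) = 1 / (2 * t\<^sup>2)"
    by (auto simp: has_bochner_integral_iff)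
qed

lemma levy_kernel_time_derivative:
  assumes "t > 0"
  shows "((\<lambda>s. levy_kernel s w) has_field_derivative (1 / t - 2 * t * w) * levy_kernel t w) (at t)"
proof -
  have "((\<lambda>s. s * exp (- s\<^sup>2 * w)) has_field_derivative (1 / t - 2 * t * w) * (t * exp (- t\<^sup>2 * w))) (at t)"
    using assms by (auto intro!: derivative_eq_intros simp: field_simps power2_eq_square)
  from DERIV_cmult[OF DERIV_cdivide[OF this, of "sqrt (pi * w)"], of "indicator {0<..} w"]
  show ?thesis unfolding levy_kernel_def by (simp add: mult_ac)
qed

text \<open>For times in \<open>(t / 2, 2 * t)\<close> the exponential is at most the one at time \<open>t / 2\<close>, so the
  time derivatives of the kernel have a common integrable bound there.\<close>

lemma levy_kernel_lipschitz:
  assumes s: "t / 2 < s" "s < 2 * t"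
  shows "\<bar>levy_kernel s w - levy_kernel t w\<bar> \<le> \<bar>s - t\<bar> * (2 / t * levy_kernel (t / 2) w + 16 * t * (levy_kernel (t / 2) w * w))"
proof -
  have t: "t > 0" using s by simp
  show ?thesis
  proof (cases "w > 0")
    case w: True
    define B where "B = 2 / t * levy_kernel (t / 2) w + 16 * t * (levy_kernel (t / 2) w * w)"
    have bound: "norm ((1 / r - 2 * r * w) * levy_kernel r w) \<le> B" if r: "r \<in> {t / 2<..<2 * t}" for r
    proof -
      have r0: "r > 0" using r t by auto
      have r2: "r\<^sup>2 \<le> 4 * t\<^sup>2" using power_mono[of r "2 * t" 2] r r0 by (simp add: power_mult_distrib)
      have e: "exp (- r\<^sup>2 * w) \<le> exp (- (t / 2)\<^sup>2 * w)"
        using power_mono[of "t / 2" r 2] r t w by simp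
      have "norm ((1 / r - 2 * r * w) * levy_kernel r w) = \<bar>1 - 2 * r\<^sup>2 * w\<bar> * exp (- r\<^sup>2 * w) / sqrt (pi * w)"
      proof -
        have "(1 / r - 2 * r * w) * levy_kernel r w = (1 - 2 * r\<^sup>2 * w) * exp (- r\<^sup>2 * w) / sqrt (pi * w)"
          using r0 w by (simp add: levy_kernel_def field_simps power2_eq_square)
        then show ?thesis using w by (simp add: abs_mult)
      qed
      also have "\<dots> \<le> (1 + 8 * t\<^sup>2 * w) * exp (- (t / 2)\<^sup>2 * w) / sqrt (pi * w)"
      proof -
        have "2 * r\<^sup>2 * w \<le> 8 * t\<^sup>2 * w" using mult_right_mono[OF r2, of w] w by simp
        moreover have "0 \<le> 2 * r\<^sup>2 * w" using w by simp
        ultimately have "\<bar>1 - 2 * r\<^sup>2 * w\<bar> \<le> 1 + 8 * t\<^sup>2 * w" by linarith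
        then show ?thesis using e w by (intro divide_right_mono mult_mono) auto
      qed
      also have "\<dots> = B" using t w by (simp add: B_def levy_kernel_def field_simps power2_eq_square)
      finally show ?thesis .
    qed
    have "norm (levy_kernel s w - levy_kernel t w) \<le> B * norm (s - t)"
    proof (rule field_differentiable_bound[where S="{t / 2<..<2 * t}"])
      fix z assume "z \<in> {t / 2<..<2 * t}"
      then show "((\<lambda>s. levy_kernel s w) has_field_derivative (1 / z - 2 * z * w) * levy_kernel z w) (at z within {t / 2<..<2 * t})"
        using t by (intro has_field_derivative_at_within[OF levy_kernel_time_derivative]) auto
    qed (use bound s t in auto)
    then show ?thesis by (simp add: B_def mult.commute)
  next
    case False
    then show ?thesis by (simp add: levy_kernel_def)
  qed
qed

text \<open>The smoothing estimate. The logarithmic derivative of the kernel is \<open>1 / t - 2 * t * w\<close>, and \<open>w\<close>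
  has mean \<open>1 / (2 * t\<^sup>2)\<close>, so the two terms contribute \<open>1 / t\<close> each.\<close>

lemma levy_average_has_derivative:
  fixes F :: "real \<Rightarrow> real"
  assumes [measurable]: "F \<in> borel_measurable borel" and M: "\<And>r. \<bar>F r\<bar> \<le> M" and t: "t > 0"
  obtains D where "((\<lambda>s. \<integral>u. F (s\<^sup>2 / (4 * u)) \<partial>half_gamma) has_field_derivative D) (at t)" "\<bar>D\<bar> \<le> 2 * M / t"
proof -
  define d where "d w = (1 / t - 2 * t * w) * levy_kernel t w * F (1 / (4 * w))" for w
  define G where "G w = M * (2 / t * levy_kernel (t / 2) w + 16 * t * (levy_kernel (t / 2) w * w))" for w
  have M0: "M \<ge> 0" using M[of 0] by linarith
  have [measurable]: "d \<in> borel_measurable borel" unfolding d_def by measurable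
  have int: "integrable lborel (\<lambda>w. levy_kernel s w * F (1 / (4 * w)))" if "s > 0" for s
    by (rule Bochner_Integration.integrable_bound[OF integrable_mult_left[OF integral_levy_kernel_1(1)[OF that], of M]])
       (use M M0 that in \<open>auto simp: abs_mult levy_kernel_nonneg intro!: AE_I2 mult_left_mono\<close>)
  have "((\<lambda>s. \<integral>w. levy_kernel s w * F (1 / (4 * w)) \<partial>lborel) has_field_derivative (\<integral>w. d w \<partial>lborel)) (at t)"
  proof (rule has_field_derivative_integral[where a="t / 2" and b="2 * t" and G=G])
    show "integrable lborel (\<lambda>w. levy_kernel s w * F (1 / (4 * w)))" if "t / 2 < s" for s
      using int[of s] that t by simp
    show "AE w in lborel. ((\<lambda>s. levy_kernel s w * F (1 / (4 * w))) has_field_derivative d w) (at t)"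
      unfolding d_def by (intro AE_I2 DERIV_cmult_right levy_kernel_time_derivative t)
    show "integrable lborel G"
      unfolding G_def using t integral_levy_kernel_1(1)[of "t / 2"] integral_levy_kernel_mult(1)[of "t / 2"]
      by (intro integrable_mult_right Bochner_Integration.integrable_add) auto
    show "AE w in lborel. \<bar>levy_kernel s w * F (1 / (4 * w)) - levy_kernel t w * F (1 / (4 * w))\<bar> \<le> \<bar>s - t\<bar> * G w"
      if "t / 2 < s" "s < 2 * t" for s
    proof (rule AE_I2)
      fix w
      have "\<bar>levy_kernel s w * F (1 / (4 * w)) - levy_kernel t w * F (1 / (4 * w))\<bar>
        = \<bar>levy_kernel s w - levy_kernel t w\<bar> * \<bar>F (1 / (4 * w))\<bar>"
        by (simp add: abs_mult[symmetric] left_diff_distrib)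
      also have "\<dots> \<le> (\<bar>s - t\<bar> * (2 / t * levy_kernel (t / 2) w + 16 * t * (levy_kernel (t / 2) w * w))) * M"
        using levy_kernel_lipschitz[OF that, of w] M M0 by (intro mult_mono) auto
      finally show "\<bar>levy_kernel s w * F (1 / (4 * w)) - levy_kernel t w * F (1 / (4 * w))\<bar> \<le> \<bar>s - t\<bar> * G w"
        by (simp add: G_def mult_ac)
    qed
  qed (use t in auto)
  then have D: "((\<lambda>s. \<integral>u. F (s\<^sup>2 / (4 * u)) \<partial>half_gamma) has_field_derivative (\<integral>w. d w \<partial>lborel)) (at t)"
    by (rule has_field_derivative_transform_within_open[where S="{0<..}"])
       (use t in \<open>auto simp: integral_levy_kernel\<close>)
  have I: "integrable lborel (\<lambda>w. M * (1 / t * levy_kernel t w + 2 * t * (levy_kernel t w * w)))"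
    using t integral_levy_kernel_1(1)[of t] integral_levy_kernel_mult(1)[of t]
    by (intro integrable_mult_right Bochner_Integration.integrable_add) auto
  have dM: "\<bar>d w\<bar> \<le> M * (1 / t * levy_kernel t w + 2 * t * (levy_kernel t w * w))" for w
  proof (cases "w > 0")
    case True
    have "\<bar>d w\<bar> = \<bar>1 / t - 2 * t * w\<bar> * levy_kernel t w * \<bar>F (1 / (4 * w))\<bar>"
      using t by (simp add: d_def abs_mult levy_kernel_nonneg)
    also have "\<dots> \<le> (1 / t + 2 * t * w) * levy_kernel t w * M"
    proof -
      have "0 \<le> 1 / t" "0 \<le> 2 * t * w" using t True by auto
      then have "\<bar>1 / t - 2 * t * w\<bar> \<le> 1 / t + 2 * t * w" by linarith
      then show ?thesis using M t True by (intro mult_mono) (auto simp: levy_kernel_nonneg)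
    qed
    finally show ?thesis by (simp add: algebra_simps)
  next
    case False
    then show ?thesis by (simp add: d_def levy_kernel_def)
  qed
  have "\<bar>\<integral>w. d w \<partial>lborel\<bar> \<le> (\<integral>w. M * (1 / t * levy_kernel t w + 2 * t * (levy_kernel t w * w)) \<partial>lborel)"
    by (rule integral_abs_bound_integral[OF Bochner_Integration.integrable_bound[OF I] I])
       (use dM in \<open>auto intro!: AE_I2 intro: order_trans[OF _ abs_ge_self]\<close>)
  also have "\<dots> = M * (1 / t * 1 + 2 * t * (1 / (2 * t\<^sup>2)))"
    using t integral_levy_kernel_1[of t] integral_levy_kernel_mult[of t]
    by (simp only: integral_mult_right_zero Bochner_Integration.integral_add integrable_mult_right)
  also have "\<dots> = 2 * M / t" using t by (simp add: field_simps power2_eq_square)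
  finally show ?thesis using D that by blast
qed

section \<open>The Poisson-Hermite semigroup\<close>

interpretation gauss_gamma: pair_prob_space gauss half_gamma ..
interpretation gamma_gauss: pair_prob_space half_gamma gauss ..
interpretation gamma_gamma: pair_prob_space half_gamma half_gamma ..

text \<open>As for the Ornstein-Uhlenbeck semigroup, the passage to signed functions goes through the
  equality of the image measures.\<close>

lemma levy_convolution_integral:
  fixes F :: "real \<Rightarrow> real"
  assumes [measurable]: "F \<in> borel_measurable borel" and M: "\<And>r. \<bar>F r\<bar> \<le> M" and s: "s > 0" and t: "t > 0"
  shows "(\<integral>u. \<integral>v. F (s\<^sup>2 / (4 * u) + t\<^sup>2 / (4 * v)) \<partial>half_gamma \<partial>half_gamma)
     = (\<integral>u. F ((s + t)\<^sup>2 / (4 * u)) \<partial>half_gamma)"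
proof -
  have D: "distr (half_gamma \<Otimes>\<^sub>M half_gamma) borel (\<lambda>(u, v). s\<^sup>2 / (4 * u) + t\<^sup>2 / (4 * v))
      = distr half_gamma borel (\<lambda>u. (s + t)\<^sup>2 / (4 * u))" (is "?L = ?R")
  proof (rule measure_eqI)
    fix A assume "A \<in> sets ?L"
    then have [measurable]: "A \<in> sets borel" by simp
    have "emeasure ?L A = (\<integral>\<^sup>+y. indicator A y \<partial>?L)" by simp
    also have "\<dots> = (\<integral>\<^sup>+u. \<integral>\<^sup>+v. indicator A (s\<^sup>2 / (4 * u) + t\<^sup>2 / (4 * v)) \<partial>half_gamma \<partial>half_gamma)"
      by (subst nn_integral_distr) (auto simp: half_gamma.nn_integral_fst[symmetric])
    also have "\<dots> = (\<integral>\<^sup>+u. indicator A ((s + t)\<^sup>2 / (4 * u)) \<partial>half_gamma)"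
      by (rule levy_convolution) (auto simp: s t)
    also have "\<dots> = (\<integral>\<^sup>+y. indicator A y \<partial>?R)"
      by (subst nn_integral_distr) auto
    finally show "emeasure ?L A = emeasure ?R A" by simp
  qed simp
  have "(\<integral>u. \<integral>v. F (s\<^sup>2 / (4 * u) + t\<^sup>2 / (4 * v)) \<partial>half_gamma \<partial>half_gamma)
      = (\<integral>p. F ((\<lambda>(u, v). s\<^sup>2 / (4 * u) + t\<^sup>2 / (4 * v)) p) \<partial>(half_gamma \<Otimes>\<^sub>M half_gamma))"
    by (subst gamma_gamma.integral_fst'[symmetric])
       (auto intro!: gamma_gamma.integrable_const_bound[where B=M] simp: M split: prod.split)
  also have "\<dots> = (\<integral>y. F y \<partial>?L)"
    by (subst integral_distr) auto
  also have "\<dots> = (\<integral>u. F ((s + t)\<^sup>2 / (4 * u)) \<partial>half_gamma)"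
    unfolding D by (subst integral_distr) auto
  finally show ?thesis .
qed

text \<open>The law of the position at the random time, so that the semigroup acts by integration against
  a probability measure and Fubini's theorem applies to it. The absolute value makes the time
  nonnegative for every \<open>u\<close>, including the null set \<open>u \<le> 0\<close>.\<close>

definition ph_kernel :: "real \<Rightarrow> 'a::euclidean_space \<Rightarrow> 'a measure" where
  "ph_kernel t x = distr (half_gamma \<Otimes>\<^sub>M gauss) borel (\<lambda>(u, z). ou_path \<bar>t\<^sup>2 / (4 * u)\<bar> x z)"

lemma sets_ph_kernel[simp, measurable_cong]: "sets (ph_kernel t x) = sets borel"
  by (simp add: ph_kernel_def)

lemma space_ph_kernel[simp]: "space (ph_kernel t x) = UNIV"
  by (simp add: ph_kernel_def)

lemma prob_space_ph_kernel: "prob_space (ph_kernel t x)"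
  unfolding ph_kernel_def by (rule gamma_gauss.prob_space_distr) measurable

interpretation ph_kernel: prob_space "ph_kernel t x" for t x by (rule prob_space_ph_kernel)

lemma nn_integral_ph_kernel:
  assumes [measurable]: "G \<in> borel_measurable borel"
  shows "(\<integral>\<^sup>+y. G y \<partial>ph_kernel t x) = (\<integral>\<^sup>+u. \<integral>\<^sup>+z. G (ou_path \<bar>t\<^sup>2 / (4 * u)\<bar> x z) \<partial>gauss \<partial>half_gamma)"
  unfolding ph_kernel_def
  by (subst nn_integral_distr) (auto simp: gauss.nn_integral_fst[symmetric])

lemma poisson_hermite_eq_abs:
  fixes f :: "'a::euclidean_space \<Rightarrow> real"
  assumes [measurable]: "f \<in> borel_measurable borel" and t: "t \<noteq> 0"
  shows "poisson_hermite t f x = (\<integral>u. ornstein_uhlenbeck \<bar>t\<^sup>2 / (4 * u)\<bar> f x \<partial>half_gamma)"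
  unfolding poisson_hermite_eq[OF assms]
proof (rule integral_cong_AE)
  show "AE u in half_gamma. ornstein_uhlenbeck (t\<^sup>2 / (4 * u)) f x = ornstein_uhlenbeck \<bar>t\<^sup>2 / (4 * u)\<bar> f x"
    using AE_half_gamma by eventually_elim simp
qed measurable

lemma poisson_hermite_eq_integral_kernel:
  fixes f :: "'a::euclidean_space \<Rightarrow> real"
  assumes [measurable]: "f \<in> borel_measurable borel" and M: "\<And>x. \<bar>f x\<bar> \<le> M" and t: "t \<noteq> 0"
  shows "poisson_hermite t f x = (\<integral>y. f y \<partial>ph_kernel t x)"
proof -
  have "poisson_hermite t f x = (\<integral>u. \<integral>z. f (ou_path \<bar>t\<^sup>2 / (4 * u)\<bar> x z) \<partial>gauss \<partial>half_gamma)"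
    using t by (simp add: poisson_hermite_eq_abs ornstein_uhlenbeck_eq)
  also have "\<dots> = (\<integral>p. f ((\<lambda>(u, z). ou_path \<bar>t\<^sup>2 / (4 * u)\<bar> x z) p) \<partial>(half_gamma \<Otimes>\<^sub>M gauss))"
    by (subst gamma_gauss.integral_fst'[symmetric])
       (auto intro!: gamma_gauss.integrable_const_bound[where B=M] simp: M split: prod.split)
  also have "\<dots> = (\<integral>y. f y \<partial>ph_kernel t x)"
    unfolding ph_kernel_def by (subst integral_distr) auto
  finally show ?thesis .
qed

lemma measurable_poisson_hermite[measurable]:
  fixes f :: "'a::euclidean_space \<Rightarrow> real"
  assumes [measurable]: "f \<in> borel_measurable borel" "r \<in> borel_measurable M" "g \<in> M \<rightarrow>\<^sub>M borel"
  shows "(\<lambda>w. poisson_hermite (r w) f (g w)) \<in> borel_measurable M"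
  unfolding poisson_hermite_def set_lebesgue_integral_def by measurable

lemma poisson_hermite_cong_AE:
  fixes f g :: "'a::euclidean_space \<Rightarrow> real"
  assumes [measurable]: "f \<in> borel_measurable borel" "g \<in> borel_measurable borel"
    and eq: "AE x in gauss. f x = g x" and t: "t \<noteq> 0"
  shows "poisson_hermite t f x = poisson_hermite t g x"
proof -
  have "ornstein_uhlenbeck (t\<^sup>2 / (4 * u)) f x = ornstein_uhlenbeck (t\<^sup>2 / (4 * u)) g x" if "u > 0" for u
    using that t eq unfolding AE_gauss_iff by (intro ornstein_uhlenbeck_cong_AE) auto
  then show ?thesis
    unfolding poisson_hermite_eq[OF assms(1) t] poisson_hermite_eq[OF assms(2) t]
    by (intro integral_cong_AE) (use AE_half_gamma in \<open>auto elim!: eventually_mono\<close>)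
qed

text \<open>Absolute continuity of the kernel: the semigroup sends the indicator of a null set to \<open>0\<close>
  everywhere, because it does not distinguish functions that agree almost everywhere.\<close>

lemma AE_ph_kernel:
  fixes x :: "'a::euclidean_space"
  assumes ae: "AE y in gauss. P y" and t: "t \<noteq> 0"
  shows "AE y in ph_kernel t x. P y"
proof -
  obtain N where N: "{y \<in> space gauss. \<not> P y} \<subseteq> N" "emeasure gauss N = 0" "N \<in> sets (gauss :: 'a measure)"
    using ae by (rule AE_E)
  have [measurable]: "N \<in> sets borel" using N(3) by simp
  have "AE y in gauss. y \<notin> N" using N by (intro AE_not_in) (simp add: null_sets_def)
  then have "AE y in gauss. indicator N y = (0 :: real)" by eventually_elim simp
  then have "poisson_hermite t (indicator N) x = poisson_hermite t (\<lambda>_. 0) x"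
    by (intro poisson_hermite_cong_AE t) auto
  moreover have "poisson_hermite t (indicator N) x = measure (ph_kernel t x) N"
    using t by (subst poisson_hermite_eq_integral_kernel[where M=1]) (simp_all add: indicator_le_1)
  moreover have "poisson_hermite t (\<lambda>_. 0) x = 0"
    using t by (subst poisson_hermite_eq_integral_kernel[where M=0]) auto
  ultimately have "measure (ph_kernel t x) N = 0" by simp
  then have "N \<in> null_sets (ph_kernel t x)"
    by (simp add: null_sets_def ph_kernel.emeasure_eq_measure)
  then have "AE y in ph_kernel t x. y \<notin> N" by (rule AE_not_in)
  then show ?thesis using N(1) by (auto elim!: eventually_mono)
qed

lemma poisson_hermite_bound_AE:
  fixes f :: "'a::euclidean_space \<Rightarrow> real"
  assumes [measurable]: "f \<in> borel_measurable borel" and B: "\<And>x. \<bar>f x\<bar> \<le> B" and M: "AE x in gauss. \<bar>f x\<bar> \<le> M" and t: "t \<noteq> 0"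
  shows "\<bar>poisson_hermite t f x\<bar> \<le> M"
proof -
  have "\<bar>\<integral>y. f y \<partial>ph_kernel t x\<bar> \<le> (\<integral>y. \<bar>f y\<bar> \<partial>ph_kernel t x)"
    by (rule integral_abs_bound)
  also have "\<dots> \<le> (\<integral>y. M \<partial>ph_kernel t x)"
    by (rule integral_mono_AE[OF _ _ AE_ph_kernel[OF M t]])
       (auto intro!: ph_kernel.integrable_const_bound[where B=B] simp: B)
  also have "\<dots> = M" using ph_kernel.prob_space[of t x] by simp
  finally show ?thesis by (simp add: poisson_hermite_eq_integral_kernel[where M=B] B t)
qed

lemma poisson_hermite_bound:
  fixes f :: "'a::euclidean_space \<Rightarrow> real"
  assumes "f \<in> borel_measurable borel" and "\<And>x. \<bar>f x\<bar> \<le> M" and "t \<noteq> 0"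
  shows "\<bar>poisson_hermite t f x\<bar> \<le> M"
  using assms by (intro poisson_hermite_bound_AE[where B=M]) auto

lemma ou_poisson_hermite:
  fixes f :: "'a::euclidean_space \<Rightarrow> real"
  assumes [measurable]: "f \<in> borel_measurable borel" and M: "\<And>x. \<bar>f x\<bar> \<le> M" and r: "r > 0" and s: "s \<noteq> 0"
  shows "ornstein_uhlenbeck r (poisson_hermite s f) x = (\<integral>v. ornstein_uhlenbeck (r + s\<^sup>2 / (4 * v)) f x \<partial>half_gamma)"
proof -
  have "ornstein_uhlenbeck r (poisson_hermite s f) x
     = (\<integral>z. \<integral>v. ornstein_uhlenbeck \<bar>s\<^sup>2 / (4 * v)\<bar> f (ou_path r x z) \<partial>half_gamma \<partial>gauss)"
    using r s by (simp add: ornstein_uhlenbeck_eq[of "poisson_hermite s f"] poisson_hermite_eq_abs)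
  also have "\<dots> = (\<integral>v. \<integral>z. ornstein_uhlenbeck \<bar>s\<^sup>2 / (4 * v)\<bar> f (ou_path r x z) \<partial>gauss \<partial>half_gamma)"
    by (rule gauss_gamma.Fubini_integral[symmetric])
       (auto intro!: gauss_gamma.integrable_const_bound[where B=M] AE_I2 ornstein_uhlenbeck_bound simp: M split: prod.split)
  also have "\<dots> = (\<integral>v. ornstein_uhlenbeck r (ornstein_uhlenbeck \<bar>s\<^sup>2 / (4 * v)\<bar> f) x \<partial>half_gamma)"
    using r by (simp add: ornstein_uhlenbeck_eq[of "ornstein_uhlenbeck _ f"])
  also have "\<dots> = (\<integral>v. ornstein_uhlenbeck (r + s\<^sup>2 / (4 * v)) f x \<partial>half_gamma)"
  proof (rule integral_cong_AE)
    show "(\<lambda>v. ornstein_uhlenbeck r (ornstein_uhlenbeck \<bar>s\<^sup>2 / (4 * v)\<bar> f) x) \<in> borel_measurable half_gamma"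
      using r by (simp add: ornstein_uhlenbeck_eq[of "ornstein_uhlenbeck _ f"])
    show "AE v in half_gamma. ornstein_uhlenbeck r (ornstein_uhlenbeck \<bar>s\<^sup>2 / (4 * v)\<bar> f) x = ornstein_uhlenbeck (r + s\<^sup>2 / (4 * v)) f x"
      using AE_half_gamma
    proof eventually_elim
      case (elim v)
      then show ?case using r s ornstein_uhlenbeck_semigroup[OF assms(1) M r, of "s\<^sup>2 / (4 * v)"] by simp
    qed
  qed simp
  finally show ?thesis .
qed

text \<open>Conditioned on the two random times, the Ornstein-Uhlenbeck semigroup law adds the times;
  the sum of the times is then distributed according to \<open>levy_convolution_integral\<close>.\<close>

lemma poisson_hermite_semigroup:
  fixes f :: "'a::euclidean_space \<Rightarrow> real"
  assumes [measurable]: "f \<in> borel_measurable borel" and M: "\<And>x. \<bar>f x\<bar> \<le> M" and t: "t > 0" and s: "s > 0"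
  shows "poisson_hermite t (poisson_hermite s f) x = poisson_hermite (t + s) f x"
proof -
  let ?F = "\<lambda>r. ornstein_uhlenbeck \<bar>r\<bar> f x"
  have "poisson_hermite t (poisson_hermite s f) x = (\<integral>u. ornstein_uhlenbeck (t\<^sup>2 / (4 * u)) (poisson_hermite s f) x \<partial>half_gamma)"
    using t by (intro poisson_hermite_eq) auto
  also have "\<dots> = (\<integral>u. \<integral>v. ?F (t\<^sup>2 / (4 * u) + s\<^sup>2 / (4 * v)) \<partial>half_gamma \<partial>half_gamma)"
  proof (rule integral_cong_AE)
    show "AE u in half_gamma. ornstein_uhlenbeck (t\<^sup>2 / (4 * u)) (poisson_hermite s f) x
       = (\<integral>v. ?F (t\<^sup>2 / (4 * u) + s\<^sup>2 / (4 * v)) \<partial>half_gamma)"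
      using AE_half_gamma
    proof eventually_elim
      case (elim u)
      then have r: "t\<^sup>2 / (4 * u) > 0" using t by simp
      have "(\<integral>v. ornstein_uhlenbeck (t\<^sup>2 / (4 * u) + s\<^sup>2 / (4 * v)) f x \<partial>half_gamma)
         = (\<integral>v. ?F (t\<^sup>2 / (4 * u) + s\<^sup>2 / (4 * v)) \<partial>half_gamma)"
      proof (rule integral_cong_AE)
        show "AE v in half_gamma. ornstein_uhlenbeck (t\<^sup>2 / (4 * u) + s\<^sup>2 / (4 * v)) f x = ?F (t\<^sup>2 / (4 * u) + s\<^sup>2 / (4 * v))"
          using AE_half_gamma
        proof eventually_elim
          case (elim v)
          then have "t\<^sup>2 / (4 * u) + s\<^sup>2 / (4 * v) \<ge> 0" using r by simp
          then show ?case by simp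
        qed
      qed measurable
      then show ?case using ou_poisson_hermite[OF assms(1) M r, of s x] s by simp
    qed
  qed measurable
  also have "\<dots> = (\<integral>u. ?F ((t + s)\<^sup>2 / (4 * u)) \<partial>half_gamma)"
    using t s by (intro levy_convolution_integral[where M=M]) (auto intro!: ornstein_uhlenbeck_bound simp: M)
  also have "\<dots> = poisson_hermite (t + s) f x"
    using t s by (simp add: poisson_hermite_eq_abs)
  finally show ?thesis .
qed

lemma nn_integral_ph_kernel_invariant:
  fixes G :: "'a::euclidean_space \<Rightarrow> ennreal"
  assumes [measurable]: "G \<in> borel_measurable borel" and t: "t \<noteq> 0"
  shows "(\<integral>\<^sup>+x. \<integral>\<^sup>+y. G y \<partial>ph_kernel t x \<partial>gauss) = (\<integral>\<^sup>+x. G x \<partial>gauss)"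
proof -
  have "(\<integral>\<^sup>+x. \<integral>\<^sup>+y. G y \<partial>ph_kernel t x \<partial>gauss)
     = (\<integral>\<^sup>+x. \<integral>\<^sup>+u. \<integral>\<^sup>+z. G (ou_path \<bar>t\<^sup>2 / (4 * u)\<bar> x z) \<partial>gauss \<partial>half_gamma \<partial>gauss)"
    by (simp add: nn_integral_ph_kernel)
  also have "\<dots> = (\<integral>\<^sup>+u. \<integral>\<^sup>+x. \<integral>\<^sup>+z. G (ou_path \<bar>t\<^sup>2 / (4 * u)\<bar> x z) \<partial>gauss \<partial>gauss \<partial>half_gamma)"
    by (rule gauss_gamma.Fubini'[symmetric]) measurable
  also have "\<dots> = (\<integral>\<^sup>+u. (\<integral>\<^sup>+x. G x \<partial>gauss) \<partial>half_gamma)"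
  proof (rule nn_integral_cong_AE)
    show "AE u in half_gamma. (\<integral>\<^sup>+x. \<integral>\<^sup>+z. G (ou_path \<bar>t\<^sup>2 / (4 * u)\<bar> x z) \<partial>gauss \<partial>gauss) = (\<integral>\<^sup>+x. G x \<partial>gauss)"
      using AE_half_gamma
    proof eventually_elim
      case (elim u)
      then show ?case using t by (intro nn_integral_ou_path_invariant) auto
    qed
  qed
  also have "\<dots> = (\<integral>\<^sup>+x. G x \<partial>gauss)" using half_gamma.emeasure_space_1 by simp
  finally show ?thesis .
qed

lemma poisson_hermite_has_derivative:
  fixes f :: "'a::euclidean_space \<Rightarrow> real"
  assumes [measurable]: "f \<in> borel_measurable borel" and M: "\<And>x. \<bar>f x\<bar> \<le> M" and t: "t > 0"
  shows "((\<lambda>s. poisson_hermite s f x) has_field_derivative poisson_hermite_deriv 1 t f x) (at t)"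
    and "\<bar>poisson_hermite_deriv 1 t f x\<bar> \<le> 2 * M / t"
proof -
  have b: "\<bar>ornstein_uhlenbeck \<bar>r\<bar> f x\<bar> \<le> M" for r by (intro ornstein_uhlenbeck_bound M) auto
  obtain D where D: "((\<lambda>s. \<integral>u. ornstein_uhlenbeck \<bar>s\<^sup>2 / (4 * u)\<bar> f x \<partial>half_gamma) has_field_derivative D) (at t)"
     "\<bar>D\<bar> \<le> 2 * M / t"
    by (rule levy_average_has_derivative[where F="\<lambda>r. ornstein_uhlenbeck \<bar>r\<bar> f x", OF _ b t]) auto
  have 1: "((\<lambda>s. poisson_hermite s f x) has_field_derivative D) (at t)"
    using D(1)
    by (rule has_field_derivative_transform_within_open[where S="{0<..}"])
       (use t in \<open>auto simp: poisson_hermite_eq_abs\<close>)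
  then have "poisson_hermite_deriv 1 t f x = D"
    by (simp add: poisson_hermite_deriv_def DERIV_imp_deriv)
  then show "((\<lambda>s. poisson_hermite s f x) has_field_derivative poisson_hermite_deriv 1 t f x) (at t)"
     "\<bar>poisson_hermite_deriv 1 t f x\<bar> \<le> 2 * M / t"
    using 1 D(2) by simp_all
qed

section \<open>Time derivatives of the Poisson-Hermite semigroup\<close>

lemma measurable_poisson_hermite_deriv:
  fixes f :: "'a::euclidean_space \<Rightarrow> real"
  assumes f[measurable]: "f \<in> borel_measurable borel" and M: "\<And>x. \<bar>f x\<bar> \<le> M" and t: "t > 0"
  shows "poisson_hermite_deriv 1 t f \<in> borel_measurable borel"
proof (rule borel_measurable_LIMSEQ_real)
  fix x :: 'a
  let ?h = "\<lambda>n. inverse (real (Suc n))"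
  have "(\<lambda>n. ?h n) \<longlonglongrightarrow> 0" by (rule LIMSEQ_inverse_real_of_nat)
  then have "filterlim ?h (at 0) sequentially"
    by (auto simp: filterlim_at)
  then show "(\<lambda>n. (poisson_hermite (t + ?h n) f x - poisson_hermite t f x) / ?h n) \<longlonglongrightarrow> poisson_hermite_deriv 1 t f x"
    using poisson_hermite_has_derivative(1)[OF f M t, of x] unfolding DERIV_def
    by (rule filterlim_compose[rotated])
qed measurable

lemma poisson_hermite_lipschitz:
  fixes f :: "'a::euclidean_space \<Rightarrow> real"
  assumes f: "f \<in> borel_measurable borel" and M: "\<And>x. \<bar>f x\<bar> \<le> M" and c: "c > 0" "c \<le> a" "c \<le> b"
  shows "\<bar>poisson_hermite b f x - poisson_hermite a f x\<bar> \<le> 2 * M / c * \<bar>b - a\<bar>"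
proof -
  have M0: "0 \<le> M" using M[of 0] by linarith
  have "norm (poisson_hermite b f x - poisson_hermite a f x) \<le> 2 * M / c * norm (b - a)"
  proof (rule field_differentiable_bound[where S="{c..}" and f'="\<lambda>z. poisson_hermite_deriv 1 z f x"])
    fix z assume z: "z \<in> {c..}"
    then have z0: "z > 0" using c by simp
    show "((\<lambda>s. poisson_hermite s f x) has_field_derivative poisson_hermite_deriv 1 z f x) (at z within {c..})"
      by (rule has_field_derivative_at_within[OF poisson_hermite_has_derivative(1)[OF f M z0]])
    have "2 * M / z \<le> 2 * M / c" using z c M0 by (intro divide_left_mono) auto
    then show "norm (poisson_hermite_deriv 1 z f x) \<le> 2 * M / c"
      using poisson_hermite_has_derivative(2)[OF f M z0, of x] by simp
  qed (use c in auto)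
  then show ?thesis by simp
qed

text \<open>The law \<open>P\<^sub>t (P\<^sub>r f) = P\<^bsub>t+r\<^esub> f\<close> is differentiated in \<open>r\<close> at \<open>r = s\<close>; the Lipschitz bound in time
  justifies differentiating under the kernel.\<close>

lemma poisson_hermite_deriv_semigroup:
  fixes f :: "'a::euclidean_space \<Rightarrow> real"
  assumes f[measurable]: "f \<in> borel_measurable borel" and M: "\<And>x. \<bar>f x\<bar> \<le> M" and t: "t > 0" and s: "s > 0"
  shows "poisson_hermite_deriv 1 (t + s) f x = poisson_hermite t (poisson_hermite_deriv 1 s f) x"
proof -
  have "((\<lambda>r. \<integral>y. poisson_hermite r f y \<partial>ph_kernel t x) has_field_derivative
     (\<integral>y. poisson_hermite_deriv 1 s f y \<partial>ph_kernel t x)) (at s)"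
  proof (rule has_field_derivative_integral[where a="s / 2" and b="2 * s" and G="\<lambda>_. 2 * M / (s / 2)"])
    show "integrable (ph_kernel t x) (poisson_hermite r f)" if "s / 2 < r" for r
      using that s by (intro ph_kernel.integrable_const_bound[where B=M]) (auto intro!: poisson_hermite_bound M AE_I2)
    show "poisson_hermite_deriv 1 s f \<in> borel_measurable (ph_kernel t x)"
      using measurable_poisson_hermite_deriv[OF f M s] by simp
    show "AE y in ph_kernel t x. ((\<lambda>r. poisson_hermite r f y) has_field_derivative poisson_hermite_deriv 1 s f y) (at s)"
      by (intro AE_I2 poisson_hermite_has_derivative(1)[OF f M s])
    show "AE y in ph_kernel t x. \<bar>poisson_hermite r f y - poisson_hermite s f y\<bar> \<le> \<bar>r - s\<bar> * (2 * M / (s / 2))"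
      if "s / 2 < r" for r
      using poisson_hermite_lipschitz[OF f M, of "s / 2" s r] that s by (intro AE_I2) (simp add: mult.commute)
  qed (use s in auto)
  moreover have "(\<integral>y. poisson_hermite_deriv 1 s f y \<partial>ph_kernel t x) = poisson_hermite t (poisson_hermite_deriv 1 s f) x"
    using poisson_hermite_has_derivative(2)[OF f M s] measurable_poisson_hermite_deriv[OF f M s] t
    by (subst poisson_hermite_eq_integral_kernel[where M="2 * M / s"]) auto
  ultimately have "((\<lambda>r. \<integral>y. poisson_hermite r f y \<partial>ph_kernel t x) has_field_derivative
     poisson_hermite t (poisson_hermite_deriv 1 s f) x) (at s)" by simp
  then have 1: "((\<lambda>r. poisson_hermite (t + r) f x) has_field_derivative
     poisson_hermite t (poisson_hermite_deriv 1 s f) x) (at s)"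
  proof (rule has_field_derivative_transform_within_open[where S="{0<..}"])
    fix r :: real assume r: "r \<in> {0<..}"
    have "(\<integral>y. poisson_hermite r f y \<partial>ph_kernel t x) = poisson_hermite t (poisson_hermite r f) x"
      using r t by (subst poisson_hermite_eq_integral_kernel[where M=M]) (auto intro!: poisson_hermite_bound M)
    then show "(\<integral>y. poisson_hermite r f y \<partial>ph_kernel t x) = poisson_hermite (t + r) f x"
      using r poisson_hermite_semigroup[OF f M t, of r x] by simp
  qed (use s in auto)
  have "((\<lambda>r. poisson_hermite (t + r) f x) has_field_derivative poisson_hermite_deriv 1 (t + s) f x) (at s)"
  proof -
    have "((\<lambda>r. t + r) has_field_derivative 1) (at s)" by (auto intro!: derivative_eq_intros)
    from DERIV_chain2[OF poisson_hermite_has_derivative(1)[OF f M, of "t + s" x] this]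
    show ?thesis using s t by (simp only: mult_1_right add_pos_pos)
  qed
  then show ?thesis using 1 by (rule DERIV_unique)
qed

text \<open>For \<open>s < t\<close> the derivative at time \<open>t\<close> is the average of the one at time \<open>s\<close> against a
  kernel that charges no null set, so the bound at time \<open>s\<close> holds at every point; then \<open>s\<close> tends to \<open>t\<close>.\<close>

lemma poisson_hermite_deriv_bound_everywhere:
  fixes f :: "'a::euclidean_space \<Rightarrow> real"
  assumes f: "f \<in> borel_measurable borel" and M: "\<And>x. \<bar>f x\<bar> \<le> M"
    and A: "\<And>t. t > 0 \<Longrightarrow> AE x in gauss. \<bar>poisson_hermite_deriv 1 t f x\<bar> \<le> A * t powr (\<alpha> - 1)" and t: "t > 0"
  shows "\<bar>poisson_hermite_deriv 1 t f x\<bar> \<le> A * t powr (\<alpha> - 1)"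
proof (rule tendsto_lowerbound)
  have "continuous (at t) (\<lambda>s. A * s powr (\<alpha> - 1))" using t by (auto intro!: continuous_intros)
  then show "((\<lambda>s. A * s powr (\<alpha> - 1)) \<longlongrightarrow> A * t powr (\<alpha> - 1)) (at_left t)"
    by (auto simp: continuous_at intro: filterlim_mono[OF _ order_refl at_le])
  show "eventually (\<lambda>s. \<bar>poisson_hermite_deriv 1 t f x\<bar> \<le> A * s powr (\<alpha> - 1)) (at_left t)"
    using eventually_at_left_real[OF t]
  proof eventually_elim
    case (elim s)
    then have s: "s > 0" "t - s > 0" by auto
    have "\<bar>poisson_hermite (t - s) (poisson_hermite_deriv 1 s f) x\<bar> \<le> A * s powr (\<alpha> - 1)"
      using poisson_hermite_has_derivative(2)[OF f M s(1)] s
      by (intro poisson_hermite_bound_AE[where B="2 * M / s"] measurable_poisson_hermite_deriv[OF f M s(1)] A) auto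
    then show ?case using poisson_hermite_deriv_semigroup[OF f M s(2) s(1), of x] by simp
  qed
qed simp

text \<open>The functions \<open>(A / \<alpha>) s powr \<alpha> \<plusminus> P\<^sub>s f x\<close> are nondecreasing in \<open>s\<close>.\<close>

lemma poisson_hermite_holder:
  fixes f :: "'a::euclidean_space \<Rightarrow> real"
  assumes f: "f \<in> borel_measurable borel" and M: "\<And>x. \<bar>f x\<bar> \<le> M" and \<alpha>: "\<alpha> > 0"
    and A: "\<forall>t>0. \<forall>x. \<bar>poisson_hermite_deriv 1 t f x\<bar> \<le> A * t powr (\<alpha> - 1)" and ab: "0 < a" "a \<le> b"
  shows "\<bar>poisson_hermite b f x - poisson_hermite a f x\<bar> \<le> A / \<alpha> * b powr \<alpha>"
proof -
  have A0: "0 \<le> A" using order_trans[OF abs_ge_zero A[rule_format, of 1 x]] by simp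
  have pw: "((\<lambda>s. A / \<alpha> * s powr \<alpha>) has_field_derivative A * s powr (\<alpha> - 1)) (at s)" if "s > 0" for s
    using that \<alpha> by (auto intro!: derivative_eq_intros)
  have "A / \<alpha> * a powr \<alpha> - poisson_hermite a f x \<le> A / \<alpha> * b powr \<alpha> - poisson_hermite b f x"
  proof (rule DERIV_nonneg_imp_nondecreasing[OF ab(2)])
    fix s assume "a \<le> s" "s \<le> b"
    then have s: "s > 0" using ab by simp
    show "\<exists>y. ((\<lambda>s. A / \<alpha> * s powr \<alpha> - poisson_hermite s f x) has_real_derivative y) (at s) \<and> 0 \<le> y"
      using DERIV_diff[OF pw[OF s] poisson_hermite_has_derivative(1)[OF f M s, of x]] A[rule_format, OF s, of x] by (auto simp: abs_le_iff)
  qed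
  moreover have "A / \<alpha> * a powr \<alpha> + poisson_hermite a f x \<le> A / \<alpha> * b powr \<alpha> + poisson_hermite b f x"
  proof (rule DERIV_nonneg_imp_nondecreasing[OF ab(2)])
    fix s assume "a \<le> s" "s \<le> b"
    then have s: "s > 0" using ab by simp
    have "- (A * s powr (\<alpha> - 1)) \<le> poisson_hermite_deriv 1 s f x" using A[rule_format, OF s, of x] by (simp add: abs_le_iff)
    then show "\<exists>y. ((\<lambda>s. A / \<alpha> * s powr \<alpha> + poisson_hermite s f x) has_real_derivative y) (at s) \<and> 0 \<le> y"
      using DERIV_add[OF pw[OF s] poisson_hermite_has_derivative(1)[OF f M s, of x]] by auto
  qed
  moreover have "0 \<le> A / \<alpha> * a powr \<alpha>" using A0 \<alpha> by simp
  ultimately show ?thesis by (simp add: abs_le_iff)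
qed

text \<open>With \<open>q = Q\<^bsub>t/2\<^esub> f\<close> the increment is \<open>P\<^bsub>s+t/2\<^esub> q - P\<^bsub>t/2\<^esub> q\<close>, and the smoothing estimate for the bounded
  function \<open>q\<close> gives the first bound. It takes the place of a bound on the second derivative in
  time. The second bound is the triangle inequality, as \<open>t powr (\<alpha> - 1)\<close> decreases in \<open>t\<close>.\<close>

lemma poisson_hermite_deriv_increment:
  fixes f :: "'a::euclidean_space \<Rightarrow> real"
  assumes f: "f \<in> borel_measurable borel" and M: "\<And>x. \<bar>f x\<bar> \<le> M" and \<alpha>: "0 < \<alpha>" "\<alpha> < 1"
    and A: "\<forall>t>0. \<forall>x. \<bar>poisson_hermite_deriv 1 t f x\<bar> \<le> A * t powr (\<alpha> - 1)" and t: "t > 0" and s: "s > 0"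
  shows "\<bar>poisson_hermite_deriv 1 (t + s) f x - poisson_hermite_deriv 1 t f x\<bar> \<le> 8 * A * t powr (\<alpha> - 2) * s"
    and "\<bar>poisson_hermite_deriv 1 (t + s) f x - poisson_hermite_deriv 1 t f x\<bar> \<le> 2 * A * t powr (\<alpha> - 1)"
proof -
  have A0: "0 \<le> A" using order_trans[OF abs_ge_zero A[rule_format, of 1 x]] by simp
  let ?q = "poisson_hermite_deriv 1 (t / 2) f" and ?B = "A * (t / 2) powr (\<alpha> - 1)"
  have t2: "t / 2 > 0" using t by simp
  have "\<bar>poisson_hermite (t / 2 + s) ?q x - poisson_hermite (t / 2) ?q x\<bar> \<le> 2 * ?B / (t / 2) * \<bar>(t / 2 + s) - t / 2\<bar>"
    by (rule poisson_hermite_lipschitz[OF measurable_poisson_hermite_deriv[OF f M t2] A[rule_format, OF t2] t2]) (use s in simp_all)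
  moreover have "poisson_hermite (t / 2 + s) ?q x = poisson_hermite_deriv 1 (t + s) f x"
    using poisson_hermite_deriv_semigroup[OF f M, of "t / 2 + s" "t / 2" x] t s by (simp add: algebra_simps)
  moreover have "poisson_hermite (t / 2) ?q x = poisson_hermite_deriv 1 t f x"
    using poisson_hermite_deriv_semigroup[OF f M t2 t2, of x] by simp
  ultimately have "\<bar>poisson_hermite_deriv 1 (t + s) f x - poisson_hermite_deriv 1 t f x\<bar> \<le> 2 * ?B / (t / 2) * s"
    using s by simp
  also have "\<dots> \<le> 8 * A * t powr (\<alpha> - 2) * s"
  proof -
    have "(t / 2) powr (\<alpha> - 1) = t powr (\<alpha> - 1) * 2 powr (1 - \<alpha>)"
      using t powr_divide[of t 2 "\<alpha> - 1"] powr_minus_divide[of 2 "\<alpha> - 1"] by simp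
    also have "\<dots> \<le> t powr (\<alpha> - 1) * 2"
      using powr_mono[of "1 - \<alpha>" 1 2] \<alpha> by (intro mult_left_mono) auto
    finally have "2 * ?B / (t / 2) * s \<le> 2 * (A * (t powr (\<alpha> - 1) * 2)) / (t / 2) * s"
      using A0 t s by (intro mult_right_mono divide_right_mono mult_left_mono) auto
    also have "\<dots> = 8 * A * (t powr (\<alpha> - 1) / t) * s" by simp
    also have "t powr (\<alpha> - 1) / t = t powr (\<alpha> - 2)"
      using t powr_diff[of t "\<alpha> - 1" 1] by simp
    finally show ?thesis .
  qed
  finally show "\<bar>poisson_hermite_deriv 1 (t + s) f x - poisson_hermite_deriv 1 t f x\<bar> \<le> 8 * A * t powr (\<alpha> - 2) * s" .
  have "(t + s) powr (\<alpha> - 1) \<le> t powr (\<alpha> - 1)" using t s \<alpha> by (intro powr_mono2') auto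
  then have "A * (t + s) powr (\<alpha> - 1) \<le> A * t powr (\<alpha> - 1)" using A0 by (rule mult_left_mono)
  then show "\<bar>poisson_hermite_deriv 1 (t + s) f x - poisson_hermite_deriv 1 t f x\<bar> \<le> 2 * A * t powr (\<alpha> - 1)"
    using A[rule_format, of "t + s" x] A[rule_format, of t x] t s by linarith
qed

section \<open>Convergence at time zero\<close>

text \<open>As the time shrinks, every path \<open>ou_path\<close> returns to its starting point, whatever the values of the
  two random variables.\<close>

lemma poisson_hermite_tendsto_continuous:
  fixes g :: "'a::euclidean_space \<Rightarrow> real"
  assumes g: "continuous_on UNIV g" and M: "\<And>x. \<bar>g x\<bar> \<le> M"
  shows "(\<lambda>n. poisson_hermite (1 / real (Suc n)) g x) \<longlonglongrightarrow> g x"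
proof -
  have gm[measurable]: "g \<in> borel_measurable borel" using g by (rule borel_measurable_continuous_onI)
  have eq: "poisson_hermite (1 / real (Suc n)) g x
     = (\<integral>p. g (ou_path \<bar>(1 / real (Suc n))\<^sup>2 / (4 * fst p)\<bar> x (snd p)) \<partial>(half_gamma \<Otimes>\<^sub>M gauss))" for n
  proof -
    have "poisson_hermite (1 / real (Suc n)) g x = (\<integral>y. g y \<partial>ph_kernel (1 / real (Suc n)) x)"
      by (rule poisson_hermite_eq_integral_kernel[OF gm M]) simp
    also have "\<dots> = (\<integral>p. g ((\<lambda>(u, z). ou_path \<bar>(1 / real (Suc n))\<^sup>2 / (4 * u)\<bar> x z) p) \<partial>(half_gamma \<Otimes>\<^sub>M gauss))"
      unfolding ph_kernel_def by (rule integral_distr) measurable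
    finally show ?thesis by (simp only: case_prod_beta)
  qed
  have "(\<lambda>n. \<integral>p. g (ou_path \<bar>(1 / real (Suc n))\<^sup>2 / (4 * fst p)\<bar> x (snd p)) \<partial>(half_gamma \<Otimes>\<^sub>M gauss))
     \<longlonglongrightarrow> (\<integral>p. g x \<partial>(half_gamma \<Otimes>\<^sub>M gauss :: (real \<times> 'a) measure))"
  proof (rule integral_dominated_convergence[where w="\<lambda>_. M"])
    show "AE p in half_gamma \<Otimes>\<^sub>M gauss. (\<lambda>n. g (ou_path \<bar>(1 / real (Suc n))\<^sup>2 / (4 * fst p)\<bar> x (snd p))) \<longlonglongrightarrow> g x"
    proof (rule AE_I2)
      fix p :: "real \<times> 'a"
      have "(\<lambda>n. (1 / real (Suc n))\<^sup>2 * inverse (4 * fst p)) \<longlonglongrightarrow> 0\<^sup>2 * inverse (4 * fst p)"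
        using LIMSEQ_inverse_real_of_nat by (intro tendsto_intros) (simp add: inverse_eq_divide)
      then have r: "(\<lambda>n. \<bar>(1 / real (Suc n))\<^sup>2 / (4 * fst p)\<bar>) \<longlonglongrightarrow> 0"
        using tendsto_rabs[of "\<lambda>n. (1 / real (Suc n))\<^sup>2 * inverse (4 * fst p)" 0 sequentially]
        by (simp only: divide_inverse zero_power2 mult_zero_left abs_zero)
      have "(\<lambda>n. ou_path \<bar>(1 / real (Suc n))\<^sup>2 / (4 * fst p)\<bar> x (snd p)) \<longlonglongrightarrow> exp (- 0) *\<^sub>R x + sqrt (1 - exp (- 2 * 0)) *\<^sub>R snd p"
        unfolding ou_path_def by (intro tendsto_intros r)
      then have "(\<lambda>n. ou_path \<bar>(1 / real (Suc n))\<^sup>2 / (4 * fst p)\<bar> x (snd p)) \<longlonglongrightarrow> x" by simp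
      moreover have "isCont g x" using g by (simp add: continuous_on_eq_continuous_at)
      ultimately show "(\<lambda>n. g (ou_path \<bar>(1 / real (Suc n))\<^sup>2 / (4 * fst p)\<bar> x (snd p))) \<longlonglongrightarrow> g x"
        by (rule isCont_tendsto_compose[rotated])
    qed
  next
    show "AE p in half_gamma \<Otimes>\<^sub>M gauss. norm (g (ou_path \<bar>(1 / real (Suc n))\<^sup>2 / (4 * fst p)\<bar> x (snd p))) \<le> M" for n
      using M by (intro AE_I2) (simp only: real_norm_def)
  qed measurable
  moreover have "(\<integral>p. g x \<partial>(half_gamma \<Otimes>\<^sub>M gauss :: (real \<times> 'a) measure)) = g x"
    by (simp add: gamma_gauss.prob_space)
  ultimately show ?thesis by (simp only: eq)
qed

text \<open>A measurable function is an almost everywhere limit of continuous functions. Truncating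
  these at the bound of \<open>f\<close> makes dominated convergence applicable.\<close>

lemma bounded_borel_approx_continuous_L1:
  fixes f :: "'a::euclidean_space \<Rightarrow> real"
  assumes [measurable]: "f \<in> borel_measurable borel" and M: "\<And>x. \<bar>f x\<bar> \<le> M" and e: "e > 0"
  obtains g where "continuous_on UNIV g" "\<And>x. \<bar>g x\<bar> \<le> M" "(\<integral>x. \<bar>g x - f x\<bar> \<partial>gauss) < e"
proof -
  have M0: "0 \<le> M" using M[of 0] by linarith
  have "f \<in> borel_measurable lebesgue" by (rule measurable_completion) simp
  then have "f \<in> borel_measurable (lebesgue_on UNIV)" by (simp only: lebesgue_on_UNIV_eq)
  then have "f measurable_on UNIV" by (simp add: measurable_on_iff_borel_measurable)
  then obtain N h where N: "negligible N" and h: "\<And>n. continuous_on UNIV (h n)"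
    and lim: "\<And>x. x \<notin> N \<Longrightarrow> (\<lambda>n. h n x) \<longlonglongrightarrow> f x"
    unfolding measurable_on_def by auto
  define g where "g n x = max (- M) (min M (h n x))" for n :: nat and x
  have gc: "continuous_on UNIV (g n)" for n
    unfolding g_def by (intro continuous_intros h)
  then have [measurable]: "g n \<in> borel_measurable borel" for n by (rule borel_measurable_continuous_onI)
  have gM: "\<bar>g n x\<bar> \<le> M" for n x using M0 by (auto simp: g_def abs_le_iff)
  have "AE x in lborel. x \<notin> N"
  proof -
    have "AE x in lebesgue. x \<notin> N" using N by (intro AE_not_in) (simp add: negligible_iff_null_sets)
    then show ?thesis by (simp add: AE_completion_iff)
  qed
  then have ae: "AE x in gauss. x \<notin> N" by (simp add: AE_gauss_iff)
  have "(\<lambda>n. \<integral>x. \<bar>g n x - f x\<bar> \<partial>gauss) \<longlonglongrightarrow> (\<integral>x. 0 \<partial>(gauss :: 'a measure))"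
  proof (rule integral_dominated_convergence[where w="\<lambda>_. 2 * M"])
    show "AE x in gauss. (\<lambda>n. \<bar>g n x - f x\<bar>) \<longlonglongrightarrow> 0"
      using ae
    proof eventually_elim
      case (elim x)
      have "(\<lambda>n. \<bar>max (- M) (min M (h n x)) - f x\<bar>) \<longlonglongrightarrow> \<bar>max (- M) (min M (f x)) - f x\<bar>"
        by (intro tendsto_intros lim elim)
      moreover have "max (- M) (min M (f x)) = f x" using M[of x] by (auto simp: abs_le_iff)
      ultimately show ?case by (simp add: g_def)
    qed
    show "AE x in gauss. norm \<bar>g n x - f x\<bar> \<le> 2 * M" for n
    proof (rule AE_I2)
      fix x show "norm \<bar>g n x - f x\<bar> \<le> 2 * M" using gM[of n x] M[of x] by simp
    qed
  qed auto
  then have "eventually (\<lambda>n. (\<integral>x. \<bar>g n x - f x\<bar> \<partial>gauss) < e) sequentially"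
    using e by (auto dest: order_tendstoD(2))
  then obtain n where "(\<integral>x. \<bar>g n x - f x\<bar> \<partial>gauss) < e" by (auto simp: eventually_sequentially)
  then show ?thesis using that[OF gc gM] by blast
qed

lemma integrable_gauss_bounded:
  fixes f :: "'a::euclidean_space \<Rightarrow> real"
  assumes [measurable]: "f \<in> borel_measurable borel" and M: "\<And>x. \<bar>f x\<bar> \<le> M"
  shows "integrable gauss f"
  by (rule gauss.integrable_const_bound[where B=M]) (auto simp: M)

text \<open>The Gaussian measure is invariant and the kernel is positive.\<close>

lemma poisson_hermite_contraction_L1:
  fixes f :: "'a::euclidean_space \<Rightarrow> real"
  assumes [measurable]: "f \<in> borel_measurable borel" and M: "\<And>x. \<bar>f x\<bar> \<le> M" and t: "t \<noteq> 0"
  shows "(\<integral>x. \<bar>poisson_hermite t f x\<bar> \<partial>gauss) \<le> (\<integral>x. \<bar>f x\<bar> \<partial>gauss)"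
proof -
  have "ennreal (\<integral>x. \<bar>poisson_hermite t f x\<bar> \<partial>gauss) = (\<integral>\<^sup>+x. ennreal \<bar>poisson_hermite t f x\<bar> \<partial>gauss)"
    by (rule nn_integral_eq_integral[symmetric])
       (auto intro!: integrable_abs integrable_gauss_bounded[where M=M] poisson_hermite_bound M t)
  also have "\<dots> \<le> (\<integral>\<^sup>+x. \<integral>\<^sup>+y. ennreal \<bar>f y\<bar> \<partial>ph_kernel t x \<partial>gauss)"
  proof (rule nn_integral_mono)
    fix x :: 'a
    have "integrable (ph_kernel t x) f"
      by (rule ph_kernel.integrable_const_bound[where B=M]) (simp_all add: M)
    then have "ennreal (norm (\<integral>y. f y \<partial>ph_kernel t x)) \<le> (\<integral>\<^sup>+y. ennreal (norm (f y)) \<partial>ph_kernel t x)"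
      by (rule integral_norm_bound_ennreal)
    then show "ennreal \<bar>poisson_hermite t f x\<bar> \<le> (\<integral>\<^sup>+y. ennreal \<bar>f y\<bar> \<partial>ph_kernel t x)"
      unfolding poisson_hermite_eq_integral_kernel[OF assms(1) M t] by (simp only: real_norm_def)
  qed
  also have "\<dots> = (\<integral>\<^sup>+x. ennreal \<bar>f x\<bar> \<partial>gauss)"
    using t by (intro nn_integral_ph_kernel_invariant) auto
  also have "\<dots> = ennreal (\<integral>x. \<bar>f x\<bar> \<partial>gauss)"
    by (rule nn_integral_eq_integral) (auto intro!: integrable_abs integrable_gauss_bounded[where M=M] M)
  finally show ?thesis by (simp add: ennreal_le_iff)
qed

lemma poisson_hermite_diff:
  fixes f g :: "'a::euclidean_space \<Rightarrow> real"
  assumes [measurable]: "f \<in> borel_measurable borel" "g \<in> borel_measurable borel"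
    and M: "\<And>x. \<bar>f x\<bar> \<le> M" "\<And>x. \<bar>g x\<bar> \<le> M" and t: "t \<noteq> 0"
  shows "poisson_hermite t (\<lambda>x. f x - g x) x = poisson_hermite t f x - poisson_hermite t g x"
proof -
  have b: "\<bar>f x - g x\<bar> \<le> 2 * M" for x using M(1)[of x] M(2)[of x] by linarith
  have "(\<integral>y. f y - g y \<partial>ph_kernel t x) = (\<integral>y. f y \<partial>ph_kernel t x) - (\<integral>y. g y \<partial>ph_kernel t x)"
    by (intro Bochner_Integration.integral_diff ph_kernel.integrable_const_bound[where B=M]) (auto simp: M)
  then show ?thesis
    using t by (simp add: poisson_hermite_eq_integral_kernel[where M=M] poisson_hermite_eq_integral_kernel[where M="2 * M"] M b)
qed

text \<open>Strong continuity in \<open>L\<^sup>1\<close> follows from that on continuous functions by density and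
  contractivity.\<close>

lemma poisson_hermite_tendsto_L1:
  fixes f :: "'a::euclidean_space \<Rightarrow> real"
  assumes f[measurable]: "f \<in> borel_measurable borel" and M: "\<And>x. \<bar>f x\<bar> \<le> M"
  shows "(\<lambda>n. \<integral>x. \<bar>poisson_hermite (1 / real (Suc n)) f x - f x\<bar> \<partial>gauss) \<longlonglongrightarrow> 0"
proof (rule LIMSEQ_I)
  fix e :: real assume e: "e > 0"
  \<comment> \<open>The three thirds of \<open>e\<close> pay for replacing \<open>f\<close> by \<open>g\<close> before and after the semigroup acts, and for \<open>g\<close> itself.\<close>
  obtain g where gc: "continuous_on UNIV g" and gM: "\<And>x. \<bar>g x\<bar> \<le> M" and ge: "(\<integral>x. \<bar>g x - f x\<bar> \<partial>gauss) < e / 3"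
    using bounded_borel_approx_continuous_L1[OF f M, of "e / 3"] e by auto
  have gm[measurable]: "g \<in> borel_measurable borel" using gc by (rule borel_measurable_continuous_onI)
  let ?P = "\<lambda>n. poisson_hermite (1 / real (Suc n))"
  have PM: "\<bar>?P n f x\<bar> \<le> M" "\<bar>?P n g x\<bar> \<le> M" for n x
    by (intro poisson_hermite_bound M gM; simp)+
  have diffM: "\<bar>?P n f x - ?P n g x\<bar> \<le> 2 * M" "\<bar>?P n g x - g x\<bar> \<le> 2 * M" "\<bar>g x - f x\<bar> \<le> 2 * M"
      "\<bar>?P n f x - f x\<bar> \<le> 2 * M" for n x
    using PM[of n x] gM[of x] M[of x] by linarith+
  have int: "integrable gauss (\<lambda>x. \<bar>?P n f x - ?P n g x\<bar>)" "integrable gauss (\<lambda>x. \<bar>?P n g x - g x\<bar>)"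
      "integrable gauss (\<lambda>x. \<bar>g x - f x\<bar>)" "integrable gauss (\<lambda>x. \<bar>?P n f x - f x\<bar>)" for n
    by (intro integrable_abs integrable_gauss_bounded[where M="2 * M"] diffM; measurable)+
  have "(\<lambda>n. \<integral>x. \<bar>?P n g x - g x\<bar> \<partial>gauss) \<longlonglongrightarrow> (\<integral>x. 0 \<partial>(gauss :: 'a measure))"
  proof (rule integral_dominated_convergence[where w="\<lambda>_. 2 * M"])
    show "AE x in gauss. (\<lambda>n. \<bar>?P n g x - g x\<bar>) \<longlonglongrightarrow> 0"
    proof (rule AE_I2)
      fix x
      have "(\<lambda>n. \<bar>?P n g x - g x\<bar>) \<longlonglongrightarrow> \<bar>g x - g x\<bar>"
        by (intro tendsto_intros poisson_hermite_tendsto_continuous[OF gc gM])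
      then show "(\<lambda>n. \<bar>?P n g x - g x\<bar>) \<longlonglongrightarrow> 0" by simp
    qed
    show "AE x in gauss. norm \<bar>?P n g x - g x\<bar> \<le> 2 * M" for n
      using diffM(2)[of n] by (intro AE_I2) (simp only: real_norm_def abs_abs)
  qed auto
  then have "eventually (\<lambda>n. (\<integral>x. \<bar>?P n g x - g x\<bar> \<partial>gauss) < e / 3) sequentially"
    by (rule order_tendstoD(2)) (use e in simp)
  then obtain N where N: "\<And>n. n \<ge> N \<Longrightarrow> (\<integral>x. \<bar>?P n g x - g x\<bar> \<partial>gauss) < e / 3"
    by (auto simp: eventually_sequentially)
  show "\<exists>no. \<forall>n\<ge>no. norm ((\<integral>x. \<bar>?P n f x - f x\<bar> \<partial>gauss) - 0) < e"
  proof (intro exI allI impI)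
    fix n assume n: "n \<ge> N"
    have gf: "(\<integral>x. \<bar>?P n f x - ?P n g x\<bar> \<partial>gauss) \<le> (\<integral>x. \<bar>g x - f x\<bar> \<partial>gauss)"
    proof -
      have b: "\<bar>f x - g x\<bar> \<le> 2 * M" for x using M[of x] gM[of x] by linarith
      show ?thesis
        using poisson_hermite_contraction_L1[of "\<lambda>x. f x - g x" "2 * M" "1 / real (Suc n)"] b
        by (simp add: poisson_hermite_diff[OF f gm M gM] abs_minus_commute)
    qed
    have "(\<integral>x. \<bar>?P n f x - f x\<bar> \<partial>gauss) \<le> (\<integral>x. \<bar>?P n f x - ?P n g x\<bar> + \<bar>?P n g x - g x\<bar> + \<bar>g x - f x\<bar> \<partial>gauss)"
      by (intro integral_mono int Bochner_Integration.integrable_add) auto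
    also have "\<dots> = (\<integral>x. \<bar>?P n f x - ?P n g x\<bar> \<partial>gauss) + (\<integral>x. \<bar>?P n g x - g x\<bar> \<partial>gauss) + (\<integral>x. \<bar>g x - f x\<bar> \<partial>gauss)"
      by (simp only: Bochner_Integration.integral_add int Bochner_Integration.integrable_add)
    also have "\<dots> < e" using gf ge N[OF n] by linarith
    finally show "norm ((\<integral>x. \<bar>?P n f x - f x\<bar> \<partial>gauss) - 0) < e"
      by (simp add: integral_nonneg_AE)
  qed
qed

text \<open>The Hoelder bound makes the family converge at every point as the time tends to
  \<open>0\<close>. Convergence in \<open>L\<^sup>1\<close> shows that the limit is \<open>f\<close> almost everywhere.\<close>

lemma poisson_hermite_holder_at_0:
  fixes f :: "'a::euclidean_space \<Rightarrow> real"
  assumes f[measurable]: "f \<in> borel_measurable borel" and M: "\<And>x. \<bar>f x\<bar> \<le> M" and \<alpha>: "\<alpha> > 0"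
    and A: "\<forall>t>0. \<forall>x. \<bar>poisson_hermite_deriv 1 t f x\<bar> \<le> A * t powr (\<alpha> - 1)"
  shows "AE x in gauss. \<forall>s>0. \<bar>poisson_hermite s f x - f x\<bar> \<le> A / \<alpha> * s powr \<alpha>"
proof -
  let ?P = "\<lambda>n. poisson_hermite (1 / real (Suc n)) f"
  define F where "F x = lim (\<lambda>n. ?P n x)" for x
  have A0: "0 \<le> A" using order_trans[OF abs_ge_zero A[rule_format, of 1 undefined]] by simp
  have PM: "\<bar>?P n x\<bar> \<le> M" for n x by (intro poisson_hermite_bound M f) simp
  have rate: "(\<lambda>n. A / \<alpha> * (1 / real (Suc n)) powr \<alpha>) \<longlonglongrightarrow> 0"
  proof -
    have "(\<lambda>n. 1 / real (Suc n)) \<longlonglongrightarrow> 0" using LIMSEQ_inverse_real_of_nat by (simp add: inverse_eq_divide)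
    then have "(\<lambda>n. (1 / real (Suc n)) powr \<alpha>) \<longlonglongrightarrow> 0 powr \<alpha>"
      by (rule tendsto_powr2) (use \<alpha> in auto)
    then have "(\<lambda>n. A / \<alpha> * (1 / real (Suc n)) powr \<alpha>) \<longlonglongrightarrow> A / \<alpha> * 0 powr \<alpha>"
      by (intro tendsto_mult tendsto_const)
    then show ?thesis by simp
  qed
  have lim: "(\<lambda>n. ?P n x) \<longlonglongrightarrow> F x" for x
  proof -
    have "Cauchy (\<lambda>n. ?P n x)"
    proof (rule CauchyI')
      fix e :: real assume "e > 0"
      then have "eventually (\<lambda>n. A / \<alpha> * (1 / real (Suc n)) powr \<alpha> < e) sequentially"
        using rate by (rule order_tendstoD(2)[rotated])
      then obtain N where N: "\<And>n. n \<ge> N \<Longrightarrow> A / \<alpha> * (1 / real (Suc n)) powr \<alpha> < e"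
        by (auto simp: eventually_sequentially)
      show "\<exists>K. \<forall>m\<ge>K. \<forall>n>m. dist (?P m x) (?P n x) < e"
      proof (intro exI allI impI)
        fix m n assume "m \<ge> N" "n > m"
        then show "dist (?P m x) (?P n x) < e"
          using poisson_hermite_holder[OF f M \<alpha> A, of "1 / real (Suc n)" "1 / real (Suc m)" x] N[of m]
          by (auto simp: dist_real_def frac_le)
      qed
    qed
    then show ?thesis unfolding F_def by (simp add: Cauchy_convergent_iff convergent_LIMSEQ_iff)
  qed
  have bound: "\<bar>poisson_hermite s f x - F x\<bar> \<le> A / \<alpha> * s powr \<alpha>" if s: "s > 0" for s x
  proof (rule tendsto_upperbound)
    show "(\<lambda>n. \<bar>poisson_hermite s f x - ?P n x\<bar>) \<longlonglongrightarrow> \<bar>poisson_hermite s f x - F x\<bar>"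
      by (intro tendsto_intros lim)
    have "eventually (\<lambda>n. inverse (real (Suc n)) < s) sequentially"
      using LIMSEQ_inverse_real_of_nat s by (rule order_tendstoD(2))
    then show "eventually (\<lambda>n. \<bar>poisson_hermite s f x - ?P n x\<bar> \<le> A / \<alpha> * s powr \<alpha>) sequentially"
    proof eventually_elim
      case (elim n)
      then show ?case using poisson_hermite_holder[OF f M \<alpha> A, of "1 / real (Suc n)" s x] by (simp add: inverse_eq_divide)
    qed
  qed simp
  have [measurable]: "F \<in> borel_measurable borel"
    by (rule borel_measurable_LIMSEQ_real[OF lim]) measurable
  have "(\<lambda>n. \<integral>x. \<bar>?P n x - f x\<bar> \<partial>gauss) \<longlonglongrightarrow> (\<integral>x. \<bar>F x - f x\<bar> \<partial>gauss)"
  proof (rule integral_dominated_convergence[where w="\<lambda>_. 2 * M"])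
    show "AE x in gauss. (\<lambda>n. \<bar>?P n x - f x\<bar>) \<longlonglongrightarrow> \<bar>F x - f x\<bar>"
      by (intro AE_I2 tendsto_intros lim)
    show "AE x in gauss. norm \<bar>?P n x - f x\<bar> \<le> 2 * M" for n
    proof (rule AE_I2)
      fix x show "norm \<bar>?P n x - f x\<bar> \<le> 2 * M" using PM[of n x] M[of x] by simp
    qed
  qed auto
  then have I0: "(\<integral>x. \<bar>F x - f x\<bar> \<partial>gauss) = 0"
    using poisson_hermite_tendsto_L1[OF f M] by (rule LIMSEQ_unique)
  have FM: "\<bar>F x\<bar> \<le> M" for x
    by (rule tendsto_upperbound[OF tendsto_rabs[OF lim[of x]]]) (use PM in \<open>auto simp del: of_nat_Suc\<close>)
  have "integrable gauss (\<lambda>x. \<bar>F x - f x\<bar>)"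
  proof (intro integrable_abs integrable_gauss_bounded[where M="2 * M"])
    fix x show "\<bar>F x - f x\<bar> \<le> 2 * M" using FM[of x] M[of x] by linarith
  qed measurable
  then have "AE x in gauss. \<bar>F x - f x\<bar> = 0"
    using I0 by (subst (asm) integral_nonneg_eq_0_iff_AE) auto
  then show ?thesis
  proof eventually_elim
    case (elim x)
    then show ?case using bound[of _ x] by simp
  qed
qed

section \<open>The Riesz derivative along the semigroup\<close>

lemma has_bochner_integral_powr_0:
  fixes \<gamma> T :: real
  assumes \<gamma>: "\<gamma> > 0" and T: "T > 0"
  shows "has_bochner_integral lborel (\<lambda>s. indicator {0<..T} s * s powr (\<gamma> - 1)) (T powr \<gamma> / \<gamma>)"
proof -
  have "((\<lambda>s. s powr (\<gamma> - 1)) has_integral (T powr \<gamma> / \<gamma>)) {0..T}"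
    using has_integral_powr_from_0[of "\<gamma> - 1" T] assms by simp
  then have "(\<integral>\<^sup>+s. ennreal (indicator {0..T} s * s powr (\<gamma> - 1)) \<partial>lborel) = ennreal (T powr \<gamma> / \<gamma>)"
    by (intro nn_integral_has_integral_lebesgue) auto
  moreover have "indicator {0..T} s * s powr (\<gamma> - 1) = indicator {0<..T} s * s powr (\<gamma> - 1)" for s :: real
    by (cases "s = 0") (auto simp: indicator_def)
  ultimately show ?thesis
    using assms by (intro has_bochner_integral_nn_integral) auto
qed

lemma has_bochner_integral_powr_inf:
  fixes \<beta> T :: real
  assumes \<beta>: "\<beta> > 0" and T: "T > 0"
  shows "has_bochner_integral lborel (\<lambda>s. indicator {T..} s * s powr (- \<beta> - 1)) (T powr (- \<beta>) / \<beta>)"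
proof -
  have "((\<lambda>s. s powr (- \<beta> - 1)) has_integral (T powr (- \<beta>) / \<beta>)) {T..}"
    using has_integral_powr_to_inf[of "- \<beta> - 1" T] assms by simp
  then have "(\<integral>\<^sup>+s. ennreal (indicator {T..} s * s powr (- \<beta> - 1)) \<partial>lborel) = ennreal (T powr (- \<beta>) / \<beta>)"
    by (intro nn_integral_has_integral_lebesgue) auto
  then show ?thesis
    using assms by (intro has_bochner_integral_nn_integral) auto
qed

text \<open>A bound for the integrands met below, split at \<open>T\<close>: the weight \<open>s powr (- \<beta> - 1)\<close> times
  a quantity of order \<open>s powr (\<gamma> + \<beta>)\<close> for small \<open>s\<close> and of order \<open>1\<close> for large \<open>s\<close>. It is used with
  \<open>T = 1\<close> and \<open>\<gamma> = \<alpha> - \<beta>\<close> for the integral itself, and with \<open>T = t\<close> and \<open>\<gamma> = 1 - \<beta>\<close> for its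
  increments in time.\<close>

definition riesz_majorant :: "real \<Rightarrow> real \<Rightarrow> real \<Rightarrow> real \<Rightarrow> real \<Rightarrow> real \<Rightarrow> real" where
  "riesz_majorant \<beta> \<gamma> T a b s =
     a * (indicator {0<..T} s * s powr (\<gamma> - 1)) + b * (indicator {T..} s * s powr (- \<beta> - 1))"

lemma has_bochner_integral_riesz_majorant:
  assumes "\<beta> > 0" "\<gamma> > 0" "T > 0"
  shows "has_bochner_integral lborel (riesz_majorant \<beta> \<gamma> T a b) (a * (T powr \<gamma> / \<gamma>) + b * (T powr (- \<beta>) / \<beta>))"
  unfolding riesz_majorant_def using assms
  by (intro has_bochner_integral_add has_bochner_integral_mult_right
      has_bochner_integral_powr_0 has_bochner_integral_powr_inf)

lemma riesz_majorant_bound: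
  assumes s: "s > 0" and T: "T > 0" and b0: "b \<ge> 0" and a0: "a \<ge> 0"
    and a: "\<bar>v\<bar> \<le> a * s powr (\<gamma> + \<beta>)" and b: "\<bar>v\<bar> \<le> b"
  shows "\<bar>s powr (- \<beta> - 1) * v\<bar> \<le> riesz_majorant \<beta> \<gamma> T a b s"
proof (cases "s \<le> T")
  case True
  have "\<bar>s powr (- \<beta> - 1) * v\<bar> = s powr (- \<beta> - 1) * \<bar>v\<bar>" by (simp add: abs_mult)
  also have "\<dots> \<le> s powr (- \<beta> - 1) * (a * s powr (\<gamma> + \<beta>))" using a by (intro mult_left_mono) auto
  also have "\<dots> = a * s powr (\<gamma> - 1)" by (simp add: powr_add[symmetric] mult.left_commute)
  also have "\<dots> \<le> riesz_majorant \<beta> \<gamma> T a b s" using s True b0 by (simp add: riesz_majorant_def)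
  finally show ?thesis .
next
  case False
  have "\<bar>s powr (- \<beta> - 1) * v\<bar> = s powr (- \<beta> - 1) * \<bar>v\<bar>" by (simp add: abs_mult)
  also have "\<dots> \<le> s powr (- \<beta> - 1) * b" using b by (intro mult_left_mono) auto
  also have "\<dots> \<le> riesz_majorant \<beta> \<gamma> T a b s" using s False a0 by (simp add: riesz_majorant_def mult.commute)
  finally show ?thesis .
qed

lemma riesz_majorant_nonneg: "a \<ge> 0 \<Longrightarrow> b \<ge> 0 \<Longrightarrow> riesz_majorant \<beta> \<gamma> T a b s \<ge> 0"
  by (simp add: riesz_majorant_def)

lemma set_integral_le_riesz_majorant:
  fixes h :: "real \<Rightarrow> real"
  assumes [measurable]: "h \<in> borel_measurable borel" and pos: "\<beta> > 0" "\<gamma> > 0" "T > 0" "a \<ge> 0" "b \<ge> 0"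
    and bound: "\<And>s. s > 0 \<Longrightarrow> \<bar>h s\<bar> \<le> riesz_majorant \<beta> \<gamma> T a b s"
  shows "set_integrable lborel {0<..} h"
    and "(LINT s|lborel. \<bar>indicator {0<..} s *\<^sub>R h s\<bar>) \<le> a * (T powr \<gamma> / \<gamma>) + b * (T powr (- \<beta>) / \<beta>)"
    and "\<bar>LINT s:{0<..}|lborel. h s\<bar> \<le> a * (T powr \<gamma> / \<gamma>) + b * (T powr (- \<beta>) / \<beta>)"
proof -
  let ?m = "riesz_majorant \<beta> \<gamma> T a b"
  have m: "integrable lborel ?m" "integral\<^sup>L lborel ?m = a * (T powr \<gamma> / \<gamma>) + b * (T powr (- \<beta>) / \<beta>)"
    using has_bochner_integral_riesz_majorant[OF pos(1-3), of a b] by (auto simp: has_bochner_integral_iff)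
  have le: "\<bar>indicator {0<..} s *\<^sub>R h s\<bar> \<le> ?m s" for s
    using bound[of s] riesz_majorant_nonneg[OF pos(4,5), of \<beta> \<gamma> T s] by (cases "s > 0") auto
  have int: "integrable lborel (\<lambda>s. indicator {0<..} s *\<^sub>R h s)"
    by (rule Bochner_Integration.integrable_bound[OF m(1)]) (use le in \<open>auto intro!: AE_I2 intro: order_trans[OF _ abs_ge_self]\<close>)
  then show "set_integrable lborel {0<..} h" by (simp add: set_integrable_def)
  show 1: "(LINT s|lborel. \<bar>indicator {0<..} s *\<^sub>R h s\<bar>) \<le> a * (T powr \<gamma> / \<gamma>) + b * (T powr (- \<beta>) / \<beta>)"
    unfolding m(2)[symmetric] by (intro integral_mono integrable_abs int m(1) le)
  show "\<bar>LINT s:{0<..}|lborel. h s\<bar> \<le> a * (T powr \<gamma> / \<gamma>) + b * (T powr (- \<beta>) / \<beta>)"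
    unfolding set_lebesgue_integral_def using integral_abs_bound 1 by (rule order_trans)
qed

lemma measurable_riesz_integrand[measurable]:
  fixes f :: "'a::euclidean_space \<Rightarrow> real"
  assumes [measurable]: "f \<in> borel_measurable borel" "g \<in> M \<rightarrow>\<^sub>M borel" "r \<in> borel_measurable M"
  shows "(\<lambda>w. riesz_integrand \<beta> f (g w) (r w)) \<in> borel_measurable M"
  unfolding riesz_integrand_def by measurable

lemma measurable_riesz_deriv[measurable]:
  fixes f :: "'a::euclidean_space \<Rightarrow> real"
  assumes [measurable]: "f \<in> borel_measurable borel"
  shows "riesz_deriv \<beta> f \<in> borel_measurable borel"
  unfolding riesz_deriv_def set_lebesgue_integral_def by measurable

lemma AE_riesz_integrand_bound:
  fixes f :: "'a::euclidean_space \<Rightarrow> real"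
  assumes f[measurable]: "f \<in> borel_measurable borel" and M: "\<And>x. \<bar>f x\<bar> \<le> M" and \<alpha>: "\<alpha> > 0"
    and A: "\<forall>t>0. \<forall>x. \<bar>poisson_hermite_deriv 1 t f x\<bar> \<le> A * t powr (\<alpha> - 1)"
  shows "AE x in gauss. \<forall>s>0. \<bar>riesz_integrand \<beta> f x s\<bar> \<le> riesz_majorant \<beta> (\<alpha> - \<beta>) 1 (A / \<alpha>) (2 * M) s"
  using poisson_hermite_holder_at_0[OF f M \<alpha> A]
proof eventually_elim
  case (elim x)
  have A0: "0 \<le> A" using order_trans[OF abs_ge_zero A[rule_format, of 1 x]] by simp
  have M0: "0 \<le> M" using M[of x] by linarith
  show ?case
  proof (intro allI impI)
    fix s :: real assume s: "s > 0"
    have "\<bar>poisson_hermite s f x - f x\<bar> \<le> 2 * M"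
      using poisson_hermite_bound[OF f M, of s x] M[of x] s by simp
    then show "\<bar>riesz_integrand \<beta> f x s\<bar> \<le> riesz_majorant \<beta> (\<alpha> - \<beta>) 1 (A / \<alpha>) (2 * M) s"
      unfolding riesz_integrand_def using elim s A0 M0 \<alpha> by (intro riesz_majorant_bound) auto
  qed
qed

text \<open>Beside the bound on the Riesz derivative, the bound on the integral of the absolute value is
  kept: it gives the joint integrability needed for Fubini's theorem.\<close>

lemma AE_riesz_deriv_bound:
  fixes f :: "'a::euclidean_space \<Rightarrow> real"
  assumes f[measurable]: "f \<in> borel_measurable borel" and M: "\<And>x. \<bar>f x\<bar> \<le> M" and ab: "0 < \<beta>" "\<beta> < \<alpha>"
    and A: "\<forall>t>0. \<forall>x. \<bar>poisson_hermite_deriv 1 t f x\<bar> \<le> A * t powr (\<alpha> - 1)"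
  shows "AE x in gauss. set_integrable lborel {0<..} (riesz_integrand \<beta> f x) \<and>
     (LINT s|lborel. \<bar>indicator {0<..} s *\<^sub>R riesz_integrand \<beta> f x s\<bar>) \<le> A / (\<alpha> * (\<alpha> - \<beta>)) + 2 * M / \<beta> \<and>
     \<bar>riesz_deriv \<beta> f x\<bar> \<le> 1 / \<bar>riesz_const \<beta>\<bar> * (A / (\<alpha> * (\<alpha> - \<beta>)) + 2 * M / \<beta>)"
proof -
  have \<alpha>: "\<alpha> > 0" using ab by simp
  show ?thesis
    using AE_riesz_integrand_bound[where \<beta>=\<beta>, OF f M \<alpha> A]
  proof eventually_elim
    case (elim x)
    have A0: "0 \<le> A" using order_trans[OF abs_ge_zero A[rule_format, of 1 x]] by simp
    have M0: "0 \<le> M" using M[of x] by linarith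
    have pos: "\<beta> > 0" "\<alpha> - \<beta> > 0" "(1::real) > 0" "A / \<alpha> \<ge> 0" "2 * M \<ge> 0" using ab A0 M0 \<alpha> by auto
    have meas: "riesz_integrand \<beta> f x \<in> borel_measurable borel" by measurable
    note I = set_integral_le_riesz_majorant[OF meas pos elim[rule_format]]
    have c: "A / \<alpha> * (1 powr (\<alpha> - \<beta>) / (\<alpha> - \<beta>)) + 2 * M * (1 powr (- \<beta>) / \<beta>) = A / (\<alpha> * (\<alpha> - \<beta>)) + 2 * M / \<beta>"
      by simp
    have "\<bar>riesz_deriv \<beta> f x\<bar> = 1 / \<bar>riesz_const \<beta>\<bar> * \<bar>LINT s:{0<..}|lborel. riesz_integrand \<beta> f x s\<bar>"
      by (simp add: riesz_deriv_def abs_mult)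
    also have "\<dots> \<le> 1 / \<bar>riesz_const \<beta>\<bar> * (A / (\<alpha> * (\<alpha> - \<beta>)) + 2 * M / \<beta>)"
      using I(3) unfolding c by (intro mult_left_mono) auto
    finally show ?case using I(1,2) unfolding c by simp
  qed
qed

lemma poisson_hermite_eq_integral_kernel_AE:
  fixes g :: "'a::euclidean_space \<Rightarrow> real"
  assumes [measurable]: "g \<in> borel_measurable borel" and B: "AE x in gauss. \<bar>g x\<bar> \<le> B" and t: "t \<noteq> 0"
  shows "poisson_hermite t g x = (\<integral>y. g y \<partial>ph_kernel t x)"
proof -
  define h where "h x = max (- \<bar>B\<bar>) (min \<bar>B\<bar> (g x))" for x
  have [measurable]: "h \<in> borel_measurable borel" unfolding h_def by measurable
  have hB: "\<bar>h x\<bar> \<le> \<bar>B\<bar>" for x by (auto simp: h_def abs_le_iff max_def min_def)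
  have eq: "AE x in gauss. g x = h x"
    using B by eventually_elim (auto simp: h_def abs_le_iff max_def min_def)
  have "poisson_hermite t g x = poisson_hermite t h x"
    by (rule poisson_hermite_cong_AE[OF _ _ eq t]) measurable
  also have "\<dots> = (\<integral>y. h y \<partial>ph_kernel t x)"
    by (rule poisson_hermite_eq_integral_kernel[OF _ hB t]) measurable
  also have "\<dots> = (\<integral>y. g y \<partial>ph_kernel t x)"
  proof (rule integral_cong_AE)
    show "AE y in ph_kernel t x. h y = g y"
      using AE_ph_kernel[OF eq t] by eventually_elim simp
  qed measurable
  finally show ?thesis .
qed

text \<open>Fubini's theorem moves the semigroup inside the integral over \<open>s\<close>, where the semigroup law
  turns \<open>P\<^sub>t (P\<^sub>s f - f)\<close> into \<open>P\<^bsub>t+s\<^esub> f - P\<^sub>t f\<close>.\<close>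

lemma poisson_hermite_riesz_deriv:
  fixes f :: "'a::euclidean_space \<Rightarrow> real"
  assumes f[measurable]: "f \<in> borel_measurable borel" and M: "\<And>x. \<bar>f x\<bar> \<le> M" and ab: "0 < \<beta>" "\<beta> < \<alpha>"
    and A: "\<forall>t>0. \<forall>x. \<bar>poisson_hermite_deriv 1 t f x\<bar> \<le> A * t powr (\<alpha> - 1)" and t: "t > 0"
  shows "set_integrable lborel {0<..} (\<lambda>s. s powr (- \<beta> - 1) * (poisson_hermite (t + s) f x - poisson_hermite t f x))"
    and "poisson_hermite t (riesz_deriv \<beta> f) x = 1 / riesz_const \<beta> *
      (LINT s:{0<..}|lborel. s powr (- \<beta> - 1) * (poisson_hermite (t + s) f x - poisson_hermite t f x))"
proof -
  interpret P: pair_sigma_finite "ph_kernel t x" lborel ..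
  let ?k = "\<lambda>y s. indicator {0<..} s *\<^sub>R riesz_integrand \<beta> f y s"
  define I where "I = A / (\<alpha> * (\<alpha> - \<beta>)) + 2 * M / \<beta>"
  have t0: "t \<noteq> 0" using t by simp
  have ae: "AE y in ph_kernel t x. set_integrable lborel {0<..} (riesz_integrand \<beta> f y) \<and> (LINT s|lborel. \<bar>?k y s\<bar>) \<le> I"
    using AE_ph_kernel[OF AE_riesz_deriv_bound[OF f M ab A] t0, of x] unfolding I_def by eventually_elim simp
  have int: "integrable (ph_kernel t x \<Otimes>\<^sub>M lborel) (case_prod ?k)"
  proof (rule P.Fubini_integrable)
    show "integrable (ph_kernel t x) (\<lambda>y. LINT s|lborel. norm (case (y, s) of (y, s) \<Rightarrow> ?k y s))"
    proof (rule ph_kernel.integrable_const_bound)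
      show "AE y in ph_kernel t x. norm (LINT s|lborel. norm (case (y, s) of (y, s) \<Rightarrow> ?k y s)) \<le> I"
        using ae
      proof eventually_elim
        case (elim y)
        have "0 \<le> (LINT s|lborel. \<bar>?k y s\<bar>)" by (rule integral_nonneg_AE) auto
        then show ?case using elim by (simp only: real_norm_def prod.case abs_of_nonneg)
      qed
    qed measurable
    show "AE y in ph_kernel t x. integrable lborel (\<lambda>s. case (y, s) of (y, s) \<Rightarrow> ?k y s)"
      using ae by eventually_elim (simp add: set_integrable_def)
  qed measurable
  have inner: "(\<integral>y. ?k y s \<partial>ph_kernel t x)
      = indicator {0<..} s *\<^sub>R (s powr (- \<beta> - 1) * (poisson_hermite (t + s) f x - poisson_hermite t f x))" for s
  proof (cases "s > 0")
    case True
    have Pb: "\<bar>poisson_hermite s f y\<bar> \<le> M" for y using True by (intro poisson_hermite_bound f M) simp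
    have "integrable (ph_kernel t x) f" "integrable (ph_kernel t x) (poisson_hermite s f)"
      by (rule ph_kernel.integrable_const_bound[where B=M]; simp add: M Pb)+
    then have "(\<integral>y. riesz_integrand \<beta> f y s \<partial>ph_kernel t x)
       = s powr (- \<beta> - 1) * ((\<integral>y. poisson_hermite s f y \<partial>ph_kernel t x) - (\<integral>y. f y \<partial>ph_kernel t x))"
      unfolding riesz_integrand_def by (simp only: integral_mult_right_zero Bochner_Integration.integral_diff)
    also have "(\<integral>y. poisson_hermite s f y \<partial>ph_kernel t x) = poisson_hermite t (poisson_hermite s f) x"
      by (rule poisson_hermite_eq_integral_kernel[OF _ Pb t0, symmetric]) measurable
    also have "\<dots> = poisson_hermite (t + s) f x" by (rule poisson_hermite_semigroup[OF f M t True])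
    also have "(\<integral>y. f y \<partial>ph_kernel t x) = poisson_hermite t f x"
      by (rule poisson_hermite_eq_integral_kernel[OF f M t0, symmetric])
    finally show ?thesis using True by simp
  next
    case False
    then show ?thesis by simp
  qed
  have "integrable lborel (\<lambda>s. \<integral>y. ?k y s \<partial>ph_kernel t x)" using int by (rule P.integrable_snd)
  then show "set_integrable lborel {0<..} (\<lambda>s. s powr (- \<beta> - 1) * (poisson_hermite (t + s) f x - poisson_hermite t f x))"
    unfolding inner set_integrable_def .
  have aeb: "AE y in gauss. \<bar>riesz_deriv \<beta> f y\<bar> \<le> 1 / \<bar>riesz_const \<beta>\<bar> * I"
    using AE_riesz_deriv_bound[OF f M ab A] unfolding I_def by eventually_elim simp
  have "poisson_hermite t (riesz_deriv \<beta> f) x = (\<integral>y. riesz_deriv \<beta> f y \<partial>ph_kernel t x)"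
    by (rule poisson_hermite_eq_integral_kernel_AE[OF measurable_riesz_deriv[OF f] aeb t0])
  also have "\<dots> = 1 / riesz_const \<beta> * (\<integral>y. \<integral>s. ?k y s \<partial>lborel \<partial>ph_kernel t x)"
    unfolding riesz_deriv_def set_lebesgue_integral_def by (simp only: integral_mult_right_zero)
  also have "(\<integral>y. \<integral>s. ?k y s \<partial>lborel \<partial>ph_kernel t x) = (\<integral>s. \<integral>y. ?k y s \<partial>ph_kernel t x \<partial>lborel)"
    by (rule P.Fubini_integral[OF int, symmetric])
  finally show "poisson_hermite t (riesz_deriv \<beta> f) x = 1 / riesz_const \<beta> *
      (LINT s:{0<..}|lborel. s powr (- \<beta> - 1) * (poisson_hermite (t + s) f x - poisson_hermite t f x))"
    unfolding inner set_lebesgue_integral_def .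
qed

text \<open>The mean value theorem in \<open>t\<close> for the function \<open>P\<^bsub>t+s\<^esub> f x - P\<^sub>t f x\<close>; the bounds on its derivative
  decrease in time, hence the values at the left end \<open>t\<close> suffice.\<close>

lemma poisson_hermite_second_difference:
  fixes f :: "'a::euclidean_space \<Rightarrow> real" and x :: 'a
  assumes f: "f \<in> borel_measurable borel" and M: "\<And>x. \<bar>f x\<bar> \<le> M" and \<alpha>: "0 < \<alpha>" "\<alpha> < 1"
    and A: "\<forall>t>0. \<forall>x. \<bar>poisson_hermite_deriv 1 t f x\<bar> \<le> A * t powr (\<alpha> - 1)"
    and t: "0 < t" "t \<le> t'" and s: "s > 0"
  defines "D \<equiv> (poisson_hermite (t' + s) f x - poisson_hermite t' f x) - (poisson_hermite (t + s) f x - poisson_hermite t f x)"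
  shows "\<bar>D\<bar> \<le> 8 * A * t powr (\<alpha> - 2) * (t' - t) * s" and "\<bar>D\<bar> \<le> 2 * A * t powr (\<alpha> - 1) * (t' - t)"
proof -
  have A0: "0 \<le> A" using order_trans[OF abs_ge_zero A[rule_format, of 1 x]] by simp
  have gen: "\<bar>D\<bar> \<le> K * (t' - t)"
    if K: "\<And>r. r \<ge> t \<Longrightarrow> \<bar>poisson_hermite_deriv 1 (r + s) f x - poisson_hermite_deriv 1 r f x\<bar> \<le> K" for K
  proof -
    have "norm ((poisson_hermite (t' + s) f x - poisson_hermite t' f x) - (poisson_hermite (t + s) f x - poisson_hermite t f x))
       \<le> K * norm (t' - t)"
    proof (rule field_differentiable_bound[where S="{t..}"
          and f'="\<lambda>r. poisson_hermite_deriv 1 (r + s) f x - poisson_hermite_deriv 1 r f x"])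
      fix r assume r: "r \<in> {t..}"
      then have r0: "r > 0" "r + s > 0" using t s by auto
      have "((\<lambda>r. r + s) has_field_derivative 1) (at r)" by (auto intro!: derivative_eq_intros)
      from DERIV_chain2[OF poisson_hermite_has_derivative(1)[OF f M r0(2), of x] this]
      have "((\<lambda>r. poisson_hermite (r + s) f x) has_field_derivative poisson_hermite_deriv 1 (r + s) f x) (at r)"
        by (simp only: mult_1_right)
      from DERIV_diff[OF this poisson_hermite_has_derivative(1)[OF f M r0(1), of x]]
      show "((\<lambda>r. poisson_hermite (r + s) f x - poisson_hermite r f x) has_field_derivative
           poisson_hermite_deriv 1 (r + s) f x - poisson_hermite_deriv 1 r f x) (at r within {t..})"
        by (rule has_field_derivative_at_within)
      show "norm (poisson_hermite_deriv 1 (r + s) f x - poisson_hermite_deriv 1 r f x) \<le> K"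
        using K[of r] r by (simp only: real_norm_def atLeast_iff)
    qed (use t in auto)
    then show ?thesis using t by (simp add: D_def)
  qed
  have "\<bar>poisson_hermite_deriv 1 (r + s) f x - poisson_hermite_deriv 1 r f x\<bar> \<le> 8 * A * t powr (\<alpha> - 2) * s" if r: "r \<ge> t" for r
  proof -
    have r0: "r > 0" using r t by simp
    have "r powr (\<alpha> - 2) \<le> t powr (\<alpha> - 2)" using r t \<alpha> by (intro powr_mono2') auto
    then have "8 * A * r powr (\<alpha> - 2) * s \<le> 8 * A * t powr (\<alpha> - 2) * s"
      using A0 s by (intro mult_right_mono mult_left_mono) auto
    with poisson_hermite_deriv_increment(1)[OF f M \<alpha> A r0 s, of x] show ?thesis by linarith
  qed
  from gen[OF this] show "\<bar>D\<bar> \<le> 8 * A * t powr (\<alpha> - 2) * (t' - t) * s" by (simp add: mult_ac)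
  have "\<bar>poisson_hermite_deriv 1 (r + s) f x - poisson_hermite_deriv 1 r f x\<bar> \<le> 2 * A * t powr (\<alpha> - 1)" if r: "r \<ge> t" for r
  proof -
    have r0: "r > 0" using r t by simp
    have "r powr (\<alpha> - 1) \<le> t powr (\<alpha> - 1)" using r t \<alpha> by (intro powr_mono2') auto
    then have "2 * A * r powr (\<alpha> - 1) \<le> 2 * A * t powr (\<alpha> - 1)"
      using A0 by (intro mult_left_mono) auto
    with poisson_hermite_deriv_increment(2)[OF f M \<alpha> A r0 s, of x] show ?thesis by linarith
  qed
  from gen[OF this] show "\<bar>D\<bar> \<le> 2 * A * t powr (\<alpha> - 1) * (t' - t)" .
qed

text \<open>The second difference is integrated with the weight \<open>s powr (- \<beta> - 1)\<close>: the bound linear in \<open>s\<close>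
  contributes \<open>8 / (1 - \<beta>)\<close> on \<open>s \<le> t\<close>, and the constant one \<open>2 / \<beta>\<close> on \<open>s \<ge> t\<close>. Bounding increments
  in place of the derivative avoids differentiating under this integral.\<close>

lemma poisson_hermite_riesz_deriv_lipschitz:
  fixes f :: "'a::euclidean_space \<Rightarrow> real"
  assumes f[measurable]: "f \<in> borel_measurable borel" and M: "\<And>x. \<bar>f x\<bar> \<le> M" and ab: "0 < \<beta>" "\<beta> < \<alpha>" "\<alpha> < 1"
    and A: "\<forall>t>0. \<forall>x. \<bar>poisson_hermite_deriv 1 t f x\<bar> \<le> A * t powr (\<alpha> - 1)" and t: "t > 0" "t \<le> t'"
  shows "\<bar>poisson_hermite t' (riesz_deriv \<beta> f) x - poisson_hermite t (riesz_deriv \<beta> f) x\<bar>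
     \<le> 1 / \<bar>riesz_const \<beta>\<bar> * (8 / (1 - \<beta>) + 2 / \<beta>) * A * t powr (\<alpha> - \<beta> - 1) * (t' - t)"
proof -
  have \<alpha>: "0 < \<alpha>" and t': "t' > 0" using ab t by auto
  have A0: "0 \<le> A" using order_trans[OF abs_ge_zero A[rule_format, of 1 x]] by simp
  let ?\<Delta> = "\<lambda>t s. poisson_hermite (t + s) f x - poisson_hermite t f x"
  let ?w = "\<lambda>s::real. s powr (- \<beta> - 1)"
  have "poisson_hermite t' (riesz_deriv \<beta> f) x - poisson_hermite t (riesz_deriv \<beta> f) x
    = 1 / riesz_const \<beta> * ((LINT s:{0<..}|lborel. ?w s * ?\<Delta> t' s) - (LINT s:{0<..}|lborel. ?w s * ?\<Delta> t s))"
    unfolding poisson_hermite_riesz_deriv(2)[OF f M ab(1,2) A t(1)] poisson_hermite_riesz_deriv(2)[OF f M ab(1,2) A t']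
    by (rule right_diff_distrib[symmetric])
  also have "(LINT s:{0<..}|lborel. ?w s * ?\<Delta> t' s) - (LINT s:{0<..}|lborel. ?w s * ?\<Delta> t s)
    = (LINT s:{0<..}|lborel. ?w s * ?\<Delta> t' s - ?w s * ?\<Delta> t s)"
    by (rule set_integral_diff(2)[symmetric])
       (intro poisson_hermite_riesz_deriv(1)[OF f M ab(1,2) A] t t')+
  also have "\<dots> = (LINT s:{0<..}|lborel. ?w s * (?\<Delta> t' s - ?\<Delta> t s))"
    by (simp only: right_diff_distrib)
  finally have eq: "\<bar>poisson_hermite t' (riesz_deriv \<beta> f) x - poisson_hermite t (riesz_deriv \<beta> f) x\<bar>
    = 1 / \<bar>riesz_const \<beta>\<bar> * \<bar>LINT s:{0<..}|lborel. ?w s * (?\<Delta> t' s - ?\<Delta> t s)\<bar>"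
    by (simp only: abs_mult abs_divide abs_one)
  have "\<bar>LINT s:{0<..}|lborel. ?w s * (?\<Delta> t' s - ?\<Delta> t s)\<bar>
    \<le> (8 * A * t powr (\<alpha> - 2) * (t' - t)) * (t powr (1 - \<beta>) / (1 - \<beta>)) + (2 * A * t powr (\<alpha> - 1) * (t' - t)) * (t powr (- \<beta>) / \<beta>)"
  proof (rule set_integral_le_riesz_majorant(3))
    fix s :: real assume s: "s > 0"
    note D = poisson_hermite_second_difference[OF f M \<alpha> ab(3) A t s, of x]
    show "\<bar>?w s * (?\<Delta> t' s - ?\<Delta> t s)\<bar>
      \<le> riesz_majorant \<beta> (1 - \<beta>) t (8 * A * t powr (\<alpha> - 2) * (t' - t)) (2 * A * t powr (\<alpha> - 1) * (t' - t)) s"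
      by (rule riesz_majorant_bound) (use D s t A0 in auto)
  qed (use ab t A0 in auto)
  also have "\<dots> = (8 / (1 - \<beta>) + 2 / \<beta>) * A * t powr (\<alpha> - \<beta> - 1) * (t' - t)"
  proof -
    have p: "t powr (\<alpha> - 2) * t powr (1 - \<beta>) = t powr (\<alpha> - \<beta> - 1)" "t powr (\<alpha> - 1) * t powr (- \<beta>) = t powr (\<alpha> - \<beta> - 1)"
      by (simp_all add: powr_add[symmetric] algebra_simps)
    have "(8 * A * t powr (\<alpha> - 2) * (t' - t)) * (t powr (1 - \<beta>) / (1 - \<beta>)) + (2 * A * t powr (\<alpha> - 1) * (t' - t)) * (t powr (- \<beta>) / \<beta>)
      = 8 / (1 - \<beta>) * A * (t powr (\<alpha> - 2) * t powr (1 - \<beta>)) * (t' - t) + 2 / \<beta> * A * (t powr (\<alpha> - 1) * t powr (- \<beta>)) * (t' - t)"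
      by (simp only: divide_inverse mult_ac)
    then show ?thesis unfolding p by (simp only: distrib_right)
  qed
  finally show ?thesis unfolding eq
    by (simp only: mult.assoc) (rule mult_left_mono, simp_all)
qed

section \<open>Lipschitz norms and boundedness of the Riesz derivative\<close>

lemma lip_order_eq_1: "0 < \<alpha> \<Longrightarrow> \<alpha> < 1 \<Longrightarrow> lip_order \<alpha> = 1"
  unfolding lip_order_def by (rule Least_equality) (auto simp: Suc_le_eq intro: gr0I)

lemma Linf_norm_nonneg: "0 \<le> Linf_norm f"
proof (cases "(\<lambda>x. ereal \<bar>f x\<bar>) \<in> borel_measurable gauss")
  case True
  have "0 = esssup (gauss :: 'a measure) (\<lambda>x. 0 :: ereal)"
    by (subst esssup_const) (simp_all only: gauss.emeasure_space_1 one_neq_zero not_False_eq_True)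
  also have "\<dots> \<le> Linf_norm f"
    unfolding Linf_norm_def by (rule esssup_mono) auto
  finally show ?thesis .
next
  case False
  then show ?thesis by (simp add: Linf_norm_def esssup_non_measurable)
qed

lemma AE_le_Linf_norm:
  assumes "Linf_norm f \<le> ereal c"
  shows "AE x in gauss. \<bar>f x\<bar> \<le> c"
  using esssup_AE[of "\<lambda>x. ereal \<bar>f x\<bar>" gauss]
proof eventually_elim
  case (elim x)
  then have "ereal \<bar>f x\<bar> \<le> ereal c" using assms unfolding Linf_norm_def by (rule order_trans)
  then show ?case by simp
qed

lemma Linf_norm_le:
  assumes [measurable]: "f \<in> borel_measurable borel" and c: "AE x in gauss. \<bar>f x\<bar> \<le> c"
  shows "Linf_norm f \<le> ereal c"
  unfolding Linf_norm_def by (rule esssup_I) (use c in auto)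

lemma is_lip_const_nonneg:
  assumes "is_lip_const \<alpha> f A"
  shows "0 \<le> A"
proof -
  have "Linf_norm (poisson_hermite_deriv (lip_order \<alpha>) 1 f) \<le> ereal (A * 1 powr (- real (lip_order \<alpha>) + \<alpha>))"
    using assms unfolding is_lip_const_def by (auto dest!: spec[of _ 1])
  from order_trans[OF Linf_norm_nonneg this] show ?thesis by simp
qed

text \<open>The admissible constants form a closed half-line bounded below by \<open>0\<close>, hence the infimum is
  attained and \<open>LEAST\<close> denotes it.\<close>

lemma lip_const_is_least:
  assumes A: "is_lip_const \<alpha> f A"
  shows "is_lip_const \<alpha> f (lip_const \<alpha> f)" and "lip_const \<alpha> f \<le> A"
proof -
  let ?S = "{A. is_lip_const \<alpha> f A}"
  define I where "I = Inf ?S"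
  have bdd: "bdd_below ?S" by (rule bdd_belowI[of _ 0]) (auto dest: is_lip_const_nonneg)
  have le: "I \<le> B" if "is_lip_const \<alpha> f B" for B
    unfolding I_def using that by (intro cInf_lower bdd) auto
  have I: "is_lip_const \<alpha> f I"
    unfolding is_lip_const_def
  proof (intro allI impI)
    fix t :: real assume t: "t > 0"
    let ?N = "Linf_norm (poisson_hermite_deriv (lip_order \<alpha>) t f)" and ?p = "t powr (- real (lip_order \<alpha>) + \<alpha>)"
    have p: "?p > 0" using t by simp
    have N: "?N \<le> ereal (B * ?p)" if "is_lip_const \<alpha> f B" for B
      using that t by (simp add: is_lip_const_def)
    then obtain n where n: "?N = ereal n"
      using A Linf_norm_nonneg[of "poisson_hermite_deriv (lip_order \<alpha>) t f"] by (cases ?N) auto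
    have "n / ?p \<le> I"
      unfolding I_def
    proof (rule cInf_greatest)
      show "?S \<noteq> {}" using A by auto
      fix B assume "B \<in> ?S"
      then have "n \<le> B * ?p" using N[of B] n by simp
      then show "n / ?p \<le> B" using p by (simp add: divide_le_eq)
    qed
    then show "?N \<le> ereal (I * ?p)" using p n by (simp add: divide_le_eq)
  qed
  have "lip_const \<alpha> f = I"
    unfolding lip_const_def by (rule Least_equality) (use I le in auto)
  then show "is_lip_const \<alpha> f (lip_const \<alpha> f)" "lip_const \<alpha> f \<le> A"
    using I le[OF A] by auto
qed

lemma poisson_hermite_deriv_cong_AE:
  fixes f g :: "'a::euclidean_space \<Rightarrow> real"
  assumes "f \<in> borel_measurable borel" "g \<in> borel_measurable borel" "AE x in gauss. f x = g x" and t: "t > 0"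
  shows "poisson_hermite_deriv 1 t f x = poisson_hermite_deriv 1 t g x"
proof -
  have "eventually (\<lambda>s. s \<in> {0<..}) (nhds t)" using t by (intro eventually_nhds_in_open) auto
  then have "eventually (\<lambda>s. poisson_hermite s f x = poisson_hermite s g x) (nhds t)"
    by eventually_elim (use assms in \<open>auto intro!: poisson_hermite_cong_AE\<close>)
  then have "deriv (\<lambda>s. poisson_hermite s f x) t = deriv (\<lambda>s. poisson_hermite s g x) t"
    by (rule deriv_cong_ev) simp
  then show ?thesis by (simp add: poisson_hermite_deriv_def)
qed

lemma DERIV_bound_right_lipschitz:
  fixes \<phi> :: "real \<Rightarrow> real"
  assumes D: "(\<phi> has_field_derivative D) (at t)" and K: "\<And>s. s > t \<Longrightarrow> \<bar>\<phi> s - \<phi> t\<bar> \<le> K * (s - t)"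
  shows "\<bar>D\<bar> \<le> K"
proof (rule tendsto_upperbound)
  have "(\<phi> has_field_derivative D) (at t within {t<..})" using D by (rule has_field_derivative_at_within)
  then show "((\<lambda>s. \<bar>(\<phi> s - \<phi> t) / (s - t)\<bar>) \<longlongrightarrow> \<bar>D\<bar>) (at_right t)"
    unfolding has_field_derivative_iff by (rule tendsto_rabs)
  show "eventually (\<lambda>s. \<bar>(\<phi> s - \<phi> t) / (s - t)\<bar> \<le> K) (at_right t)"
    unfolding eventually_at_right_field
  proof (intro exI[of _ "t + 1"] conjI allI impI)
    fix s assume s: "t < s" "s < t + 1"
    then show "\<bar>(\<phi> s - \<phi> t) / (s - t)\<bar> \<le> K" using K[OF s(1)] by (simp add: divide_le_eq)
  qed simp
qed simp

text \<open>The sum of the constants for the supremum norm and for the Lipschitz constant, enlarged so that one factor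
  serves for both terms of the norm.\<close>

definition riesz_bound :: "real \<Rightarrow> real \<Rightarrow> real" where
  "riesz_bound \<alpha> \<beta> = 1 / \<bar>riesz_const \<beta>\<bar> * (1 / (\<alpha> * (\<alpha> - \<beta>)) + 8 / (1 - \<beta>) + 4 / \<beta>)"

text \<open>Elements of \<open>L\<^sup>\<infinity>\<close> are only bounded almost everywhere, and so is the Riesz derivative.
  Both are truncated to everywhere bounded representatives; for positive times the semigroup
  does not notice the change.\<close>

lemma riesz_deriv_gauss_Lip:
  fixes f :: "'a::euclidean_space \<Rightarrow> real"
  assumes ab: "0 < \<beta>" "\<beta> < \<alpha>" "\<alpha> < 1" and f: "f \<in> gauss_Lip \<alpha>"
  shows "AE x in gauss. set_integrable lborel {0<..} (riesz_integrand \<beta> f x)"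
    and "riesz_deriv \<beta> f \<in> gauss_Lip (\<alpha> - \<beta>)"
    and "lip_norm (\<alpha> - \<beta>) (riesz_deriv \<beta> f) \<le> riesz_bound \<alpha> \<beta> * lip_norm \<alpha> f"
proof -
  have \<alpha>: "0 < \<alpha>" using ab by simp
  have fm[measurable]: "f \<in> borel_measurable borel" and fin: "Linf_norm f < \<infinity>"
    using f by (auto simp: gauss_Lip_def Linf_def)
  define M where "M = real_of_ereal (Linf_norm f)"
  define A where "A = lip_const \<alpha> f"
  have NM: "Linf_norm f = ereal M"
    using fin Linf_norm_nonneg[of f] unfolding M_def by (cases "Linf_norm f") auto
  have M0: "M \<ge> 0" using Linf_norm_nonneg[of f] NM by simp
  have isA: "is_lip_const \<alpha> f A"
    using f lip_const_is_least(1) unfolding A_def gauss_Lip_def by blast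
  have A0: "A \<ge> 0" using isA by (rule is_lip_const_nonneg)
  have exponent: "- real (lip_order \<alpha>) + \<alpha> = \<alpha> - 1" using lip_order_eq_1[OF \<alpha> ab(3)] by simp

  \<comment> \<open>Truncation replaces \<open>f\<close> by an everywhere bounded representative of its class.\<close>
  define h where "h x = max (- M) (min M (f x))" for x
  have hm[measurable]: "h \<in> borel_measurable borel" unfolding h_def by measurable
  have hM: "\<bar>h x\<bar> \<le> M" for x using M0 by (auto simp: h_def abs_le_iff max_def min_def)
  have eq: "AE x in gauss. f x = h x"
  proof -
    have "AE x in gauss. \<bar>f x\<bar> \<le> M" by (rule AE_le_Linf_norm) (simp add: NM)
    then show ?thesis by eventually_elim (auto simp: h_def abs_le_iff max_def min_def)
  qed
  have hA: "\<forall>t>0. \<forall>x. \<bar>poisson_hermite_deriv 1 t h x\<bar> \<le> A * t powr (\<alpha> - 1)"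
  proof (intro allI impI)
    fix t :: real and x :: 'a assume t: "t > 0"
    show "\<bar>poisson_hermite_deriv 1 t h x\<bar> \<le> A * t powr (\<alpha> - 1)"
    proof (rule poisson_hermite_deriv_bound_everywhere[OF hm hM _ t])
      fix s :: real assume s: "s > 0"
      have "Linf_norm (poisson_hermite_deriv 1 s f) \<le> ereal (A * s powr (\<alpha> - 1))"
        using isA s unfolding is_lip_const_def exponent by (simp add: lip_order_eq_1[OF \<alpha> ab(3)])
      from AE_le_Linf_norm[OF this] show "AE x in gauss. \<bar>poisson_hermite_deriv 1 s h x\<bar> \<le> A * s powr (\<alpha> - 1)"
        by (simp only: poisson_hermite_deriv_cong_AE[OF fm hm eq s])
    qed
  qed

  have integrand_eq: "riesz_integrand \<beta> f x s = riesz_integrand \<beta> h x s" if "f x = h x" "s > 0" for x s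
    using that poisson_hermite_cong_AE[OF fm hm eq, of s x] by (simp add: riesz_integrand_def)
  have deriv_eq: "AE x in gauss. riesz_deriv \<beta> f x = riesz_deriv \<beta> h x"
    using eq
  proof eventually_elim
    case (elim x)
    have "(LINT s:{0<..}|lborel. riesz_integrand \<beta> f x s) = (LINT s:{0<..}|lborel. riesz_integrand \<beta> h x s)"
      by (rule set_lebesgue_integral_cong) (use integrand_eq[OF elim] in auto)
    then show ?case by (simp add: riesz_deriv_def)
  qed
  have bound: "AE x in gauss. set_integrable lborel {0<..} (riesz_integrand \<beta> f x) \<and>
     \<bar>riesz_deriv \<beta> f x\<bar> \<le> 1 / \<bar>riesz_const \<beta>\<bar> * (A / (\<alpha> * (\<alpha> - \<beta>)) + 2 * M / \<beta>)"
    using AE_riesz_deriv_bound[OF hm hM ab(1,2) hA] eq deriv_eq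
  proof eventually_elim
    case (elim x)
    have "set_integrable lborel {0<..} (riesz_integrand \<beta> f x) \<longleftrightarrow> set_integrable lborel {0<..} (riesz_integrand \<beta> h x)"
      by (rule set_integrable_cong) (use integrand_eq[OF elim(2)] in auto)
    then show ?case using elim by simp
  qed
  then show "AE x in gauss. set_integrable lborel {0<..} (riesz_integrand \<beta> f x)"
    by eventually_elim simp
  define B where "B = 1 / \<bar>riesz_const \<beta>\<bar> * (A / (\<alpha> * (\<alpha> - \<beta>)) + 2 * M / \<beta>)"
  define K where "K = 1 / \<bar>riesz_const \<beta>\<bar> * (8 / (1 - \<beta>) + 2 / \<beta>) * A"
  have gm[measurable]: "riesz_deriv \<beta> f \<in> borel_measurable borel" by measurable
  have gB: "AE x in gauss. \<bar>riesz_deriv \<beta> f x\<bar> \<le> B" using bound unfolding B_def by eventually_elim simp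
  have normB: "Linf_norm (riesz_deriv \<beta> f) \<le> ereal B" using gB by (intro Linf_norm_le) auto
  have B0: "0 \<le> B" using order_trans[OF Linf_norm_nonneg normB] by simp

  define g where "g x = max (- B) (min B (riesz_deriv \<beta> f x))" for x
  have gm'[measurable]: "g \<in> borel_measurable borel" unfolding g_def by measurable
  have gB': "\<bar>g x\<bar> \<le> B" for x using B0 by (auto simp: g_def abs_le_iff max_def min_def)
  have eqg: "AE x in gauss. riesz_deriv \<beta> f x = g x"
    using gB by eventually_elim (auto simp: g_def abs_le_iff max_def min_def)
  have eqgh: "AE x in gauss. g x = riesz_deriv \<beta> h x"
    using eqg deriv_eq by eventually_elim simp
  have K: "is_lip_const (\<alpha> - \<beta>) (riesz_deriv \<beta> f) K"
    unfolding is_lip_const_def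
  proof (intro allI impI)
    fix t :: real assume t: "t > 0"
    have o1: "lip_order (\<alpha> - \<beta>) = 1" using ab by (intro lip_order_eq_1) auto
    have b: "\<bar>poisson_hermite_deriv 1 t g x\<bar> \<le> K * t powr (\<alpha> - \<beta> - 1)" for x
    proof (rule DERIV_bound_right_lipschitz[OF poisson_hermite_has_derivative(1)[OF gm' gB' t]])
      fix s :: real assume s: "s > t"
      have "poisson_hermite r g x = poisson_hermite r (riesz_deriv \<beta> h) x" if "r > 0" for r
        using that by (intro poisson_hermite_cong_AE eqgh) auto
      then show "\<bar>poisson_hermite s g x - poisson_hermite t g x\<bar> \<le> K * t powr (\<alpha> - \<beta> - 1) * (s - t)"
        using poisson_hermite_riesz_deriv_lipschitz[OF hm hM ab hA t, of s x] s t by (simp add: K_def)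
    qed
    have "Linf_norm (poisson_hermite_deriv 1 t g) \<le> ereal (K * t powr (\<alpha> - \<beta> - 1))"
      by (intro Linf_norm_le measurable_poisson_hermite_deriv[OF gm' gB' t] AE_I2 b)
    moreover have "poisson_hermite_deriv 1 t (riesz_deriv \<beta> f) = poisson_hermite_deriv 1 t g"
      by (rule ext) (rule poisson_hermite_deriv_cong_AE[OF gm gm' eqg t])
    ultimately show "Linf_norm (poisson_hermite_deriv (lip_order (\<alpha> - \<beta>)) t (riesz_deriv \<beta> f))
       \<le> ereal (K * t powr (- real (lip_order (\<alpha> - \<beta>)) + (\<alpha> - \<beta>)))"
      unfolding o1 by (simp add: algebra_simps)
  qed
  show "riesz_deriv \<beta> f \<in> gauss_Lip (\<alpha> - \<beta>)"
    using K normB by (auto simp: gauss_Lip_def Linf_def intro: le_less_trans)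

  have "real_of_ereal (Linf_norm (riesz_deriv \<beta> f)) \<le> B"
    using normB Linf_norm_nonneg[of "riesz_deriv \<beta> f"] B0 by (cases "Linf_norm (riesz_deriv \<beta> f)") auto
  then have "lip_norm (\<alpha> - \<beta>) (riesz_deriv \<beta> f) \<le> B + K"
    using lip_const_is_least(2)[OF K] by (simp add: lip_norm_def)
  also have "\<dots> = 1 / \<bar>riesz_const \<beta>\<bar> * ((1 / (\<alpha> * (\<alpha> - \<beta>)) + 8 / (1 - \<beta>) + 2 / \<beta>) * A + 2 / \<beta> * M)"
    unfolding B_def K_def by (simp add: algebra_simps)
  also have "\<dots> \<le> 1 / \<bar>riesz_const \<beta>\<bar> * ((1 / (\<alpha> * (\<alpha> - \<beta>)) + 8 / (1 - \<beta>) + 4 / \<beta>) * (M + A))"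
  proof (rule mult_left_mono)
    define p where "p = 1 / (\<alpha> * (\<alpha> - \<beta>)) + 8 / (1 - \<beta>)"
    have p: "p \<ge> 0" "2 / \<beta> \<ge> 0" using ab by (auto simp: p_def)
    have "4 / \<beta> = 2 / \<beta> + 2 / \<beta>" by simp
    then have c: "p + 2 / \<beta> \<le> p + 4 / \<beta>" "2 / \<beta> \<le> p + 4 / \<beta>" using p by linarith+
    have "(p + 2 / \<beta>) * A + 2 / \<beta> * M \<le> (p + 4 / \<beta>) * A + (p + 4 / \<beta>) * M"
      by (rule add_mono[OF mult_right_mono[OF c(1) A0] mult_right_mono[OF c(2) M0]])
    then show "(1 / (\<alpha> * (\<alpha> - \<beta>)) + 8 / (1 - \<beta>) + 2 / \<beta>) * A + 2 / \<beta> * M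
      \<le> (1 / (\<alpha> * (\<alpha> - \<beta>)) + 8 / (1 - \<beta>) + 4 / \<beta>) * (M + A)"
      unfolding p_def[symmetric] by (simp only: distrib_left add.commute)
  qed simp
  finally show "lip_norm (\<alpha> - \<beta>) (riesz_deriv \<beta> f) \<le> riesz_bound \<alpha> \<beta> * lip_norm \<alpha> f"
    by (simp only: riesz_bound_def lip_norm_def M_def A_def mult.assoc)
qed

theorem theorem3p2:
  fixes \<alpha> \<beta> :: real
  assumes "0 < \<beta>" and "\<beta> < \<alpha>" and "\<alpha> < 1"
  shows "(\<forall>f \<in> (gauss_Lip \<alpha> :: ('a::euclidean_space \<Rightarrow> real) set).
            (AE x in gauss. set_integrable lborel {0<..} (riesz_integrand \<beta> f x)) \<and>
            riesz_deriv \<beta> f \<in> gauss_Lip (\<alpha> - \<beta>)) \<and>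
         (\<exists>C. \<forall>f \<in> (gauss_Lip \<alpha> :: ('a \<Rightarrow> real) set).
            lip_norm (\<alpha> - \<beta>) (riesz_deriv \<beta> f) \<le> C * lip_norm \<alpha> f)"
  using riesz_deriv_gauss_Lip[OF assms] by blast

end
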